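(* Let $\mathfrak{A}$ be a $C^*$-algebra, let $H$ and $K$ be Hilbert $\mathfrak{A}$-modules, and let $M$ and $N$ be orthogonally complemented closed submodules of $H$ and $K$, respectively. Every $(M,N)$-complementable operator $T\in\mathcal{L}(H,K)$ is $(M,N)$-weakly complementable, and its bilateral shorted operator can be expressed as $$T_{/(M,N)}=U_{P_N}^*\begin{pmatrix}T_{11}-F^*E&0\\0&0\end{pmatrix}U_{P_M},$$ where $E$ and $F$ are the reduced solutions of the systems $V_{T_{22}}Y_1=T_{21}$, $Y_1\in\mathcal{L}(M,M^\perp)$, and $|T_{22}|^{\frac12}Y_2=T_{12}^*$, $Y_2\in\mathcal{L}(N,M^\perp)$, respectively.
   Context: For Hilbert $\mathfrak{A}$-modules $H,K$, $\mathcal{L}(H,K)$ denotes the set of adjointable operators from $H$ to $K$, $\mathcal{L}(H)=\mathcal{L}(H,H)$. $\mathcal{R}(\cdot)$ denotes range, the bar norm closure, $|T|=(T^*T)^{1/2}$. A closed submodule $M\subseteq H$ is orthogonally complemented if $H=M+M^\perp$; $P_M$ is then the projection onto $M$. $U_{P_M}:H\to M\oplus M^\perp$ is the unitary $h\mapsto (P_Mh,(I_H-P_M)h)^T$, and $U_{P_N}:K\to N\oplus N^\perp$ is defined likewise. $T\in\mathcal{L}(H,K)$ is $(M,N)$-complementable if there exist $M_r\in\mathcal{L}(H)$ and $M_l\in\mathcal{L}(K)$ such that $(I_H-P_M)M_r=M_r$, $M_l(I_K-P_N)=M_l$, $(I_K-P_N)TM_r=(I_K-P_N)T$ and $M_lT(I_H-P_M)=T(I_H-P_M)$.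 Reduced solution: for $A\in\mathcal{L}(H_1,K_1)$, $C\in\mathcal{L}(E_1,K_1)$, an operator $D\in\mathcal{L}(E_1,H_1)$ is the reduced solution of $AX=C$, $X\in\mathcal{L}(E_1,H_1)$, if $AD=C$ and $\mathcal{R}(D)\subseteq\overline{\mathcal{R}(A^* )}$ (unique if it exists). For every $R\in\mathcal{L}(H_1,K_1)$ the system $|R^*|^{1/2}X=R$, $X\in\mathcal{L}(H_1,K_1)$, has a reduced solution, denoted $V_R$. Blocks of $T\in\mathcal{L}(H,K)$: with $P_{M^\perp}=I_H-P_M$, $P_{N^\perp}=I_K-P_N$, $T_{11}=P_NTP_M|_M\in\mathcal{L}(M,N)$, $T_{12}=P_NTP_{M^\perp}|_{M^\perp}\in\mathcal{L}(M^\perp,N)$, $T_{21}=P_{N^\perp}TP_M|_M\in\mathcal{L}(M,N^\perp)$, $T_{22}=P_{N^\perp}TP_{M^\perp}|_{M^\perp}\in\mathcal{L}(M^\perp,N^\perp)$. $T$ is $(M,N)$-weakly complementable if all four systems $V_{T_{22}}Y_1=T_{21}$ ($Y_1\in\mathcal{L}(M,M^\perp)$), $|T_{22}|^{1/2}Y_2=T_{12}^*$ ($Y_2\in\mathcal{L}(N,M^\perp)$), $|T_{22}^*|^{1/2}Z_1=T_{21}$ ($Z_1\in\mathcal{L}(M,N^\perp)$), $V_{T_{22}}^*Z_2=T_{12}^*$ ($Z_2\in\mathcal{L}(N,N^\perp)$) have reduced solutions, denoted $E,F,\widetilde{E},\widetilde{F}$ respectively. In that case the bilateral shorted operator of $T$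 with respect to $(M,N)$ is $$T_{/(M,N)}=U_{P_N}^*\begin{pmatrix}T_{11}-\frac12\big[F^*E+\widetilde{F}^*\widetilde{E}\big]&0\\0&0\end{pmatrix}U_{P_M}\in\mathcal{L}(H,K).$$ *)

theory Defs
  imports "HOL-Analysis.Analysis"
begin

section \<open>C*-algebras\<close>

text \<open>Not assumed unital.  The class \<^class>\<open>real_normed_algebra\<close> contributes the ring laws and
  submultiplicativity of the norm, and \<^class>\<open>banach\<close> contributes completeness.\<close>

class cstar_algebra = real_normed_algebra + banach +
  fixes scaleC :: "complex \<Rightarrow> 'a \<Rightarrow> 'a" (infixr "*\<^sub>C" 75)
    and star :: "'a \<Rightarrow> 'a"
  assumes scaleR_scaleC: "r *\<^sub>R a = complex_of_real r *\<^sub>C a"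
    and scaleC_add_right: "c *\<^sub>C (a + b) = c *\<^sub>C a + c *\<^sub>C b"
    and scaleC_add_left: "(c + d) *\<^sub>C a = c *\<^sub>C a + d *\<^sub>C a"
    and scaleC_scaleC: "c *\<^sub>C d *\<^sub>C a = (c * d) *\<^sub>C a"
    and mult_scaleC_left: "(c *\<^sub>C a) * b = c *\<^sub>C (a * b)"
    and mult_scaleC_right: "a * (c *\<^sub>C b) = c *\<^sub>C (a * b)"
    and norm_scaleC: "norm (c *\<^sub>C a) = cmod c * norm a"
    and star_add: "star (a + b) = star a + star b"
    and star_scaleC: "star (c *\<^sub>C a) = cnj c *\<^sub>C star a"
    and star_mult: "star (a * b) = star b * star a"
    and star_star: "star (star a) = a"
    and cstar_identity: "norm (star a * a) = (norm a)\<^sup>2"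

definition cstar_pos :: "'a::cstar_algebra \<Rightarrow> bool" where
  "cstar_pos a \<longleftrightarrow> (\<exists>b. a = star b * b)"


section \<open>Hilbert modules\<close>

text \<open>Submodules such as M and its complement have to be Hilbert modules in their own right, so a
  Hilbert module carries an explicit underlying set inside an abelian group type.  It is a right
  module, and its inner product is linear in the second variable.\<close>

record ('a, 'h) hmod =
  hcar :: "'h set"
  hscale :: "complex \<Rightarrow> 'h \<Rightarrow> 'h"
  hact :: "'h \<Rightarrow> 'a \<Rightarrow> 'h"
  hip :: "'h \<Rightarrow> 'h \<Rightarrow> 'a"

definition hnorm :: "('a::cstar_algebra, 'h::ab_group_add) hmod \<Rightarrow> 'h \<Rightarrow> real" where
  "hnorm H x = sqrt (norm (hip H x x))"

text \<open>The value 0 outside the carrier is needed because the locale \<^locale>\<open>Metric_space\<close> asks for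
  nonnegativity and symmetry on the whole type.\<close>

definition hdist :: "('a::cstar_algebra, 'h::ab_group_add) hmod \<Rightarrow> 'h \<Rightarrow> 'h \<Rightarrow> real" where
  "hdist H x y = (if x \<in> hcar H \<and> y \<in> hcar H then hnorm H (x - y) else 0)"

abbreviation htopology :: "('a::cstar_algebra, 'h::ab_group_add) hmod \<Rightarrow> 'h topology" where
  "htopology H \<equiv> Metric_space.mtopology (hcar H) (hdist H)"

locale hilbert_module =
  fixes H :: "('a::cstar_algebra, 'h::ab_group_add) hmod"
  assumes zero_closed: "0 \<in> hcar H"
    and add_closed: "\<lbrakk>x \<in> hcar H; y \<in> hcar H\<rbrakk> \<Longrightarrow> x + y \<in> hcar H"
    and scale_closed: "x \<in> hcar H \<Longrightarrow> hscale H c x \<in> hcar H"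
    and act_closed: "x \<in> hcar H \<Longrightarrow> hact H x a \<in> hcar H"
    and scale_add_right: "\<lbrakk>x \<in> hcar H; y \<in> hcar H\<rbrakk> \<Longrightarrow> hscale H c (x + y) = hscale H c x + hscale H c y"
    and scale_add_left: "x \<in> hcar H \<Longrightarrow> hscale H (c + d) x = hscale H c x + hscale H d x"
    and scale_scale: "x \<in> hcar H \<Longrightarrow> hscale H c (hscale H d x) = hscale H (c * d) x"
    and scale_one: "x \<in> hcar H \<Longrightarrow> hscale H 1 x = x"
    and act_add_left: "\<lbrakk>x \<in> hcar H; y \<in> hcar H\<rbrakk> \<Longrightarrow> hact H (x + y) a = hact H x a + hact H y a"
    and act_add_right: "x \<in> hcar H \<Longrightarrow> hact H x (a + b) = hact H x a + hact H x b"
    and act_mult: "x \<in> hcar H \<Longrightarrow> hact H x (a * b) = hact H (hact H x a) b"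
    and scale_act: "x \<in> hcar H \<Longrightarrow> hscale H c (hact H x a) = hact H (hscale H c x) a"
    and act_scaleC: "x \<in> hcar H \<Longrightarrow> hact H x (c *\<^sub>C a) = hscale H c (hact H x a)"
    and ip_add_right: "\<lbrakk>x \<in> hcar H; y \<in> hcar H; z \<in> hcar H\<rbrakk> \<Longrightarrow> hip H x (y + z) = hip H x y + hip H x z"
    and ip_scale_right: "\<lbrakk>x \<in> hcar H; y \<in> hcar H\<rbrakk> \<Longrightarrow> hip H x (hscale H c y) = c *\<^sub>C hip H x y"
    and ip_act_right: "\<lbrakk>x \<in> hcar H; y \<in> hcar H\<rbrakk> \<Longrightarrow> hip H x (hact H y a) = hip H x y * a"
    and ip_star: "\<lbrakk>x \<in> hcar H; y \<in> hcar H\<rbrakk> \<Longrightarrow> hip H y x = star (hip H x y)"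
    and ip_pos: "x \<in> hcar H \<Longrightarrow> cstar_pos (hip H x x)"
    and ip_definite: "\<lbrakk>x \<in> hcar H; hip H x x = 0\<rbrakk> \<Longrightarrow> x = 0"
    and complete: "Metric_space.mcomplete (hcar H) (hdist H)"

definition sub :: "('a::cstar_algebra, 'h::ab_group_add) hmod \<Rightarrow> 'h set \<Rightarrow> ('a, 'h) hmod" where
  "sub H M = H\<lparr>hcar := M\<rparr>"

definition dsum :: "('a::cstar_algebra, 'h::ab_group_add) hmod \<Rightarrow> ('a, 'k::ab_group_add) hmod
    \<Rightarrow> ('a, 'h \<times> 'k) hmod" where
  "dsum H K =
     \<lparr>hcar = hcar H \<times> hcar K,
      hscale = (\<lambda>c (x, y). (hscale H c x, hscale K c y)),
      hact = (\<lambda>(x, y) a. (hact H x a, hact K y a)),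
      hip = (\<lambda>(x, y) (x', y'). hip H x x' + hip K y y')\<rparr>"

definition closed_submodule :: "('a::cstar_algebra, 'h::ab_group_add) hmod \<Rightarrow> 'h set \<Rightarrow> bool" where
  "closed_submodule H M \<longleftrightarrow>
     0 \<in> M \<and> (\<forall>x\<in>M. \<forall>y\<in>M. x + y \<in> M) \<and> (\<forall>c. \<forall>x\<in>M. hscale H c x \<in> M) \<and>
     (\<forall>a. \<forall>x\<in>M. hact H x a \<in> M) \<and> M \<subseteq> hcar H \<and> closedin (htopology H) M"

definition orth :: "('a::cstar_algebra, 'h::ab_group_add) hmod \<Rightarrow> 'h set \<Rightarrow> 'h set" where
  "orth H M = {y \<in> hcar H. \<forall>x\<in>M. hip H x y = 0}"

definition orth_complemented :: "('a::cstar_algebra, 'h::ab_group_add) hmod \<Rightarrow> 'h set \<Rightarrow> bool" where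
  "orth_complemented H M \<longleftrightarrow>
     closed_submodule H M \<and> hcar H = {x + y |x y. x \<in> M \<and> y \<in> orth H M}"


section \<open>Adjointable operators\<close>

text \<open>An operator is a function on the whole type that vanishes outside its domain, so that
  operators between given modules are equal iff they are equal as functions, and composition and
  pointwise difference of operators are those of functions.\<close>

definition restr :: "'h set \<Rightarrow> ('h \<Rightarrow> 'k::zero) \<Rightarrow> 'h \<Rightarrow> 'k" where
  "restr M f = (\<lambda>x. if x \<in> M then f x else 0)"

definition maps :: "('a::cstar_algebra, 'h::ab_group_add) hmod \<Rightarrow> ('a, 'k::ab_group_add) hmod
    \<Rightarrow> ('h \<Rightarrow> 'k) set" where
  "maps H K = {T. (\<forall>x\<in>hcar H. T x \<in> hcar K) \<and> (\<forall>x. x \<notin> hcar H \<longrightarrow> T x = 0)}"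

definition is_adjoint :: "('a::cstar_algebra, 'h::ab_group_add) hmod \<Rightarrow> ('a, 'k::ab_group_add) hmod
    \<Rightarrow> ('h \<Rightarrow> 'k) \<Rightarrow> ('k \<Rightarrow> 'h) \<Rightarrow> bool" where
  "is_adjoint H K T S \<longleftrightarrow>
     S \<in> maps K H \<and> (\<forall>x\<in>hcar H. \<forall>y\<in>hcar K. hip K (T x) y = hip H x (S y))"

definition adjointable :: "('a::cstar_algebra, 'h::ab_group_add) hmod
    \<Rightarrow> ('a, 'k::ab_group_add) hmod \<Rightarrow> ('h \<Rightarrow> 'k) set" where
  "adjointable H K = {T \<in> maps H K. \<exists>S. is_adjoint H K T S}"

definition adj :: "('a::cstar_algebra, 'h::ab_group_add) hmod \<Rightarrow> ('a, 'k::ab_group_add) hmod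
    \<Rightarrow> ('h \<Rightarrow> 'k) \<Rightarrow> 'k \<Rightarrow> 'h" where
  "adj H K T = (THE S. is_adjoint H K T S)"

definition idop :: "('a::cstar_algebra, 'h::ab_group_add) hmod \<Rightarrow> 'h \<Rightarrow> 'h" where
  "idop H = restr (hcar H) id"

definition proj :: "('a::cstar_algebra, 'h::ab_group_add) hmod \<Rightarrow> 'h set \<Rightarrow> 'h \<Rightarrow> 'h" where
  "proj H M = restr (hcar H) (\<lambda>x. THE y. y \<in> M \<and> x - y \<in> orth H M)"

text \<open>Positivity and square roots in the C*-algebra of adjointable operators on a module.\<close>

definition op_pos :: "('a::cstar_algebra, 'h::ab_group_add) hmod \<Rightarrow> ('h \<Rightarrow> 'h) \<Rightarrow> bool" where
  "op_pos H S \<longleftrightarrow> (\<exists>B\<in>adjointable H H. S = adj H H B \<circ> B)"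

definition op_sqrt :: "('a::cstar_algebra, 'h::ab_group_add) hmod \<Rightarrow> ('h \<Rightarrow> 'h) \<Rightarrow> 'h \<Rightarrow> 'h" where
  "op_sqrt H A = (THE S. op_pos H S \<and> S \<circ> S = A)"

definition op_abs :: "('a::cstar_algebra, 'h::ab_group_add) hmod \<Rightarrow> ('a, 'k::ab_group_add) hmod
    \<Rightarrow> ('h \<Rightarrow> 'k) \<Rightarrow> 'h \<Rightarrow> 'h" where
  "op_abs H K T = op_sqrt H (adj H K T \<circ> T)"


section \<open>Reduced solutions\<close>

text \<open>\<open>D\<close> is the reduced solution of \<open>A X = C\<close>, where \<open>A\<close> maps \<open>H\<close> to \<open>K\<close> and \<open>C\<close> maps \<open>E\<close> to \<open>K\<close>.\<close>

definition reduced_solution :: "('a::cstar_algebra, 'h::ab_group_add) hmod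
    \<Rightarrow> ('a, 'k::ab_group_add) hmod \<Rightarrow> ('a, 'e::ab_group_add) hmod
    \<Rightarrow> ('h \<Rightarrow> 'k) \<Rightarrow> ('e \<Rightarrow> 'k) \<Rightarrow> ('e \<Rightarrow> 'h) \<Rightarrow> bool" where
  "reduced_solution H K E A C D \<longleftrightarrow>
     D \<in> adjointable E H \<and> A \<circ> D = C \<and>
     D ` hcar E \<subseteq> htopology H closure_of (adj H K A ` hcar K)"

definition V_op :: "('a::cstar_algebra, 'h::ab_group_add) hmod \<Rightarrow> ('a, 'k::ab_group_add) hmod
    \<Rightarrow> ('h \<Rightarrow> 'k) \<Rightarrow> 'h \<Rightarrow> 'k" where
  "V_op H K R = (THE D. reduced_solution K K H (op_sqrt K (op_abs K H (adj H K R))) R D)"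


section \<open>Complementable operators and the bilateral shorted operator\<close>

definition complementable :: "('a::cstar_algebra, 'h::ab_group_add) hmod
    \<Rightarrow> ('a, 'k::ab_group_add) hmod \<Rightarrow> 'h set \<Rightarrow> 'k set \<Rightarrow> ('h \<Rightarrow> 'k) \<Rightarrow> bool" where
  "complementable H K M N T \<longleftrightarrow>
     (\<exists>Mr\<in>adjointable H H. \<exists>Ml\<in>adjointable K K.
        (idop H - proj H M) \<circ> Mr = Mr \<and>
        Ml \<circ> (idop K - proj K N) = Ml \<and>
        (idop K - proj K N) \<circ> T \<circ> Mr = (idop K - proj K N) \<circ> T \<and>
        Ml \<circ> T \<circ> (idop H - proj H M) = T \<circ> (idop H - proj H M))"

definition T11 :: "('a::cstar_algebra, 'h::ab_group_add) hmod \<Rightarrow> ('a, 'k::ab_group_add) hmod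
    \<Rightarrow> 'h set \<Rightarrow> 'k set \<Rightarrow> ('h \<Rightarrow> 'k) \<Rightarrow> 'h \<Rightarrow> 'k" where
  "T11 H K M N T = restr M (proj K N \<circ> T \<circ> proj H M)"

definition T12 :: "('a::cstar_algebra, 'h::ab_group_add) hmod \<Rightarrow> ('a, 'k::ab_group_add) hmod
    \<Rightarrow> 'h set \<Rightarrow> 'k set \<Rightarrow> ('h \<Rightarrow> 'k) \<Rightarrow> 'h \<Rightarrow> 'k" where
  "T12 H K M N T = restr (orth H M) (proj K N \<circ> T \<circ> (idop H - proj H M))"

definition T21 :: "('a::cstar_algebra, 'h::ab_group_add) hmod \<Rightarrow> ('a, 'k::ab_group_add) hmod
    \<Rightarrow> 'h set \<Rightarrow> 'k set \<Rightarrow> ('h \<Rightarrow> 'k) \<Rightarrow> 'h \<Rightarrow> 'k" where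
  "T21 H K M N T = restr M ((idop K - proj K N) \<circ> T \<circ> proj H M)"

definition T22 :: "('a::cstar_algebra, 'h::ab_group_add) hmod \<Rightarrow> ('a, 'k::ab_group_add) hmod
    \<Rightarrow> 'h set \<Rightarrow> 'k set \<Rightarrow> ('h \<Rightarrow> 'k) \<Rightarrow> 'h \<Rightarrow> 'k" where
  "T22 H K M N T = restr (orth H M) ((idop K - proj K N) \<circ> T \<circ> (idop H - proj H M))"

text \<open>The reduced solutions of the four systems, with \<open>R\<close> standing for \<^const>\<open>T22\<close>:
  \<open>E\<close> of \<open>V_R Y = T21\<close>, \<open>F\<close> of \<open>|R|^(1/2) Y = T12*\<close>, \<open>E_tilde\<close> of \<open>|R*|^(1/2) Z = T21\<close> and
  \<open>F_tilde\<close> of \<open>V_R* Z = T12*\<close>.  \<open>Hp\<close> and \<open>Kp\<close> are the orthogonal complements as modules.\<close>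

definition is_E :: "('a::cstar_algebra, 'h::ab_group_add) hmod \<Rightarrow> ('a, 'k::ab_group_add) hmod
    \<Rightarrow> 'h set \<Rightarrow> 'k set \<Rightarrow> ('h \<Rightarrow> 'k) \<Rightarrow> ('h \<Rightarrow> 'h) \<Rightarrow> bool" where
  "is_E H K M N T E \<longleftrightarrow>
     (let Hp = sub H (orth H M); Kp = sub K (orth K N)
      in reduced_solution Hp Kp (sub H M) (V_op Hp Kp (T22 H K M N T)) (T21 H K M N T) E)"

definition is_F :: "('a::cstar_algebra, 'h::ab_group_add) hmod \<Rightarrow> ('a, 'k::ab_group_add) hmod
    \<Rightarrow> 'h set \<Rightarrow> 'k set \<Rightarrow> ('h \<Rightarrow> 'k) \<Rightarrow> ('k \<Rightarrow> 'h) \<Rightarrow> bool" where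
  "is_F H K M N T F \<longleftrightarrow>
     (let Hp = sub H (orth H M); Kp = sub K (orth K N)
      in reduced_solution Hp Hp (sub K N) (op_sqrt Hp (op_abs Hp Kp (T22 H K M N T)))
           (adj Hp (sub K N) (T12 H K M N T)) F)"

definition is_E_tilde :: "('a::cstar_algebra, 'h::ab_group_add) hmod
    \<Rightarrow> ('a, 'k::ab_group_add) hmod
    \<Rightarrow> 'h set \<Rightarrow> 'k set \<Rightarrow> ('h \<Rightarrow> 'k) \<Rightarrow> ('h \<Rightarrow> 'k) \<Rightarrow> bool" where
  "is_E_tilde H K M N T E \<longleftrightarrow>
     (let Hp = sub H (orth H M); Kp = sub K (orth K N)
      in reduced_solution Kp Kp (sub H M)
           (op_sqrt Kp (op_abs Kp Hp (adj Hp Kp (T22 H K M N T)))) (T21 H K M N T) E)"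

definition is_F_tilde :: "('a::cstar_algebra, 'h::ab_group_add) hmod
    \<Rightarrow> ('a, 'k::ab_group_add) hmod
    \<Rightarrow> 'h set \<Rightarrow> 'k set \<Rightarrow> ('h \<Rightarrow> 'k) \<Rightarrow> ('k \<Rightarrow> 'k) \<Rightarrow> bool" where
  "is_F_tilde H K M N T F \<longleftrightarrow>
     (let Hp = sub H (orth H M); Kp = sub K (orth K N)
      in reduced_solution Kp Hp (sub K N) (adj Hp Kp (V_op Hp Kp (T22 H K M N T)))
           (adj Hp (sub K N) (T12 H K M N T)) F)"

definition weakly_complementable :: "('a::cstar_algebra, 'h::ab_group_add) hmod
    \<Rightarrow> ('a, 'k::ab_group_add) hmod \<Rightarrow> 'h set \<Rightarrow> 'k set \<Rightarrow> ('h \<Rightarrow> 'k) \<Rightarrow> bool" where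
  "weakly_complementable H K M N T \<longleftrightarrow>
     (\<exists>E. is_E H K M N T E) \<and> (\<exists>F. is_F H K M N T F) \<and>
     (\<exists>E. is_E_tilde H K M N T E) \<and> (\<exists>F. is_F_tilde H K M N T F)"

definition U_op :: "('a::cstar_algebra, 'h::ab_group_add) hmod \<Rightarrow> 'h set \<Rightarrow> 'h \<Rightarrow> 'h \<times> 'h" where
  "U_op H M = restr (hcar H) (\<lambda>x. (proj H M x, (idop H - proj H M) x))"

definition block_op :: "('a::cstar_algebra, 'h::ab_group_add) hmod \<Rightarrow> 'h set
    \<Rightarrow> ('h \<Rightarrow> 'k::ab_group_add) \<Rightarrow> ('h \<Rightarrow> 'k) \<Rightarrow> ('h \<Rightarrow> 'k) \<Rightarrow> ('h \<Rightarrow> 'k)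
    \<Rightarrow> 'h \<times> 'h \<Rightarrow> 'k \<times> 'k" where
  "block_op H M A B C D = restr (M \<times> orth H M) (\<lambda>(x, y). (A x + B y, C x + D y))"

definition from_corner :: "('a::cstar_algebra, 'h::ab_group_add) hmod
    \<Rightarrow> ('a, 'k::ab_group_add) hmod \<Rightarrow> 'h set \<Rightarrow> 'k set \<Rightarrow> ('h \<Rightarrow> 'k) \<Rightarrow> 'h \<Rightarrow> 'k" where
  "from_corner H K M N A =
     adj K (dsum (sub K N) (sub K (orth K N))) (U_op K N)
       \<circ> block_op H M A (\<lambda>_. 0) (\<lambda>_. 0) (\<lambda>_. 0) \<circ> U_op H M"

definition shorted :: "('a::cstar_algebra, 'h::ab_group_add) hmod
    \<Rightarrow> ('a, 'k::ab_group_add) hmod \<Rightarrow> 'h set \<Rightarrow> 'k set \<Rightarrow> ('h \<Rightarrow> 'k) \<Rightarrow> 'h \<Rightarrow> 'k" where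
  "shorted H K M N T =
     (let Hp = sub H (orth H M); Kp = sub K (orth K N);
          E = (THE E. is_E H K M N T E); F = (THE F. is_F H K M N T F);
          Et = (THE E. is_E_tilde H K M N T E); Ft = (THE F. is_F_tilde H K M N T F)
      in from_corner H K M N
           (\<lambda>x. T11 H K M N T x -
              hscale K (1 / 2) ((adj (sub K N) Hp F \<circ> E) x + (adj (sub K N) Kp Ft \<circ> Et) x)))"

end

theory Submission
  imports Defs
begin

text \<open>
  Complementability gives \<open>T\<^sub>2\<^sub>1 = R X\<close> and \<open>T\<^sub>1\<^sub>2 = Y R\<close> with \<open>R = T\<^sub>2\<^sub>2\<close> and adjointable \<open>X\<close>, \<open>Y\<close>.  Put
  \<open>S = |R|\<^sup>1\<^sup>/\<^sup>2\<close>, \<open>S' = |R*|\<^sup>1\<^sup>/\<^sup>2\<close> and \<open>V = V\<^sub>R\<close>.  Then \<open>R = V S = S' V\<close>, \<open>V* V = S\<^sup>2\<close> and \<open>V V* = S'\<^sup>2\<close>, so the four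
  reduced solutions are \<open>E = S X\<close>, \<open>F = V* Y*\<close>, \<open>V X\<close> and \<open>S' Y*\<close>, and both products \<open>F* E\<close> and
  \<open>(S' Y*)* (V X)\<close> equal \<open>Y R X\<close>.

  The operator \<open>V\<close> is the norm limit of \<open>\<epsilon> R S (1 + B + \<dots> + B\<^sup>n)\<close> with \<open>B = 1 - \<epsilon> S\<^sup>2\<close>.  Square roots
  come from the iteration \<open>b \<mapsto> (x + b\<^sup>2) / 2\<close>, whose limit satisfies \<open>(1 - b)\<^sup>2 = 1 - x\<close>; it is used first
  in the unitization of the coefficient algebra, where it yields positivity of \<open>b* b\<close> and thereby the
  Cauchy-Schwarz inequality, and then for operators on Hilbert modules.
\<close>

section \<open>The positive cone of a C*-algebra\<close>

text \<open>Closed submodules of a Hilbert module need not be complemented, so there is no polar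
  decomposition from which \<open>V\<close> could be read off and no projection onto the closure of
  a range. Approximation replaces both: for \<open>B = 1 - eps S^2\<close> the operators
  \<open>S B^n\<close> tend to 0 in norm, although \<open>B^n\<close> need not, and
  \<open>1 - B^n\<close> is a multiple of \<open>S^2\<close>. This gives the convergence to
  \<open>V\<close> and also the density of the range of \<open>S^2\<close> in that of
  \<open>S\<close>. The density makes the solutions reduced: since \<open>S^2\<close> is the adjoint
  of \<open>V\<close> times \<open>V\<close>, the range of \<open>S X\<close> lies in the closure of
  the range of that adjoint, and symmetrically for \<open>S'\<close>. A second obstacle is that
  \<open>V_R\<close> is defined through the absolute value of the adjoint of \<open>R\<close>, while
  the construction starts from that of \<open>R\<close>. Uniqueness of positive square roots
  reconciles them: \<open>V\<close> times its adjoint is positive and has the right square. Modules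
  carry explicit sets, so their operators form no type to which the results on algebras could be
  applied. This is why the iteration is carried out a second time, on vectors.\<close>

lemma star_zero [simp]: "star (0::'a::cstar_algebra) = 0"
  by (metis add_cancel_right_right star_add)

lemma star_minus: "star (- a) = - star (a::'a::cstar_algebra)"
  by (metis add.right_inverse add_eq_0_iff2 star_add star_zero minus_unique)

lemma star_diff: "star (a - b) = star a - star (b::'a::cstar_algebra)"
  by (metis add_uminus_conv_diff star_add star_minus)

lemma star_scaleR: "star (r *\<^sub>R a) = r *\<^sub>R star (a::'a::cstar_algebra)"
  by (simp add: scaleR_scaleC star_scaleC)

lemma scaleC_zero_right [simp]: "c *\<^sub>C (0::'a::cstar_algebra) = 0"
  by (metis add_cancel_right_right scaleC_add_right)

lemma scaleC_zero_left [simp]: "0 *\<^sub>C (a::'a::cstar_algebra) = 0"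
  by (metis add_cancel_right_right scaleC_add_left)

lemma scaleC_one [simp]: "1 *\<^sub>C (a::'a::cstar_algebra) = a"
  by (metis of_real_1 scaleR_one scaleR_scaleC)

lemma scaleC_minus_left: "(- c) *\<^sub>C (a::'a::cstar_algebra) = - (c *\<^sub>C a)"
  by (metis add.right_inverse minus_unique scaleC_add_left scaleC_zero_left)

lemma scaleC_minus_right: "c *\<^sub>C (- a) = - (c *\<^sub>C (a::'a::cstar_algebra))"
  by (metis add.right_inverse minus_unique scaleC_add_right scaleC_zero_right)

lemma scaleC_diff_right: "c *\<^sub>C (a - b) = c *\<^sub>C a - c *\<^sub>C (b::'a::cstar_algebra)"
  by (metis add_uminus_conv_diff scaleC_add_right scaleC_minus_right)

lemma norm_le_norm_star: "norm a \<le> norm (star (a::'a::cstar_algebra))"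
proof (cases "a = 0")
  case False
  have "norm a * norm a \<le> norm (star a) * norm a"
    using norm_mult_ineq[of "star a" a] by (simp add: cstar_identity power2_eq_square)
  with False show ?thesis by simp
qed simp

lemma norm_star [simp]: "norm (star (a::'a::cstar_algebra)) = norm a"
  by (metis norm_le_norm_star order_antisym star_star)

lemma norm_square_self_adjoint: "star a = a \<Longrightarrow> norm (a * a) = (norm (a::'a::cstar_algebra))\<^sup>2"
  using cstar_identity[of a] by simp

lemma star_mult_self_eq_zero: "star a * a = 0 \<Longrightarrow> a = (0::'a::cstar_algebra)"
  using cstar_identity[of a] by simp

lemma bounded_linear_star: "bounded_linear (star :: 'a::cstar_algebra \<Rightarrow> 'a)"
  by (rule bounded_linear_intro[where K=1]) (simp_all add: star_add star_scaleR)

subsection \<open>Unital algebras\<close>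

class unital_cstar_algebra = cstar_algebra + real_normed_algebra_1

lemma star_one [simp]: "star (1::'a::unital_cstar_algebra) = 1"
  by (metis mult.left_neutral mult.right_neutral star_mult star_star)

section \<open>Convergence of the square root iteration in a unital algebra\<close>

fun sqrt_iter :: "'a::unital_cstar_algebra \<Rightarrow> nat \<Rightarrow> 'a" where
  "sqrt_iter x 0 = 0"
| "sqrt_iter x (Suc n) = (1/2) *\<^sub>R (x + sqrt_iter x n * sqrt_iter x n)"

text \<open>The scalar case \<open>x = 1\<close> of the iteration majorizes it.\<close>

fun majorant :: "nat \<Rightarrow> real" where
  "majorant 0 = 0"
| "majorant (Suc n) = (1 + majorant n * majorant n) / 2"

lemma majorant_bounds: "0 \<le> majorant n \<and> majorant n \<le> 1"
proof (induction n)
  case (Suc n)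
  then have "majorant n * majorant n \<le> 1 * 1" by (intro mult_mono) auto
  with Suc show ?case by auto
qed simp

lemma majorant_mono_Suc: "majorant n \<le> majorant (Suc n)"
proof -
  have "0 \<le> (1 - majorant n) * (1 - majorant n)" by simp
  then show ?thesis by (simp add: algebra_simps)
qed

text \<open>The map behind \<open>majorant\<close> has derivative 1 at its fixed point 1, so no
  geometric rate is available; monotonicity and boundedness give convergence instead.\<close>

lemma majorant_convergent: "convergent majorant"
proof (rule Bseq_mono_convergent)
  show "Bseq majorant" by (rule BseqI'[of _ 1]) (use majorant_bounds in simp)
  show "\<forall>m. \<forall>n\<ge>m. majorant m \<le> majorant n"
    using lift_Suc_mono_le[of majorant] majorant_mono_Suc by blast
qed

text \<open>The iterates are polynomials in \<open>x\<close>. Passing this to the limit gives roots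
  that commute with the commutant of \<open>x\<close>, which is all that is used of a functional
  calculus.\<close>

lemma sqrt_iter_commute:
  assumes "y * x = x * y"
  shows "y * sqrt_iter x n = sqrt_iter x n * (y::'a::unital_cstar_algebra)"
proof (induction n)
  case (Suc n)
  then have "y * (sqrt_iter x n * sqrt_iter x n) = sqrt_iter x n * sqrt_iter x n * y"
    by (metis mult.assoc)
  with assms show ?case by (simp add: algebra_simps)
qed simp

lemma sqrt_iter_star: "star x = x \<Longrightarrow> star (sqrt_iter x n) = sqrt_iter x n"
  by (induction n) (simp_all add: star_scaleR star_add star_mult)

lemma norm_sqrt_iter:
  assumes "norm x \<le> 1"
  shows "norm (sqrt_iter x n) \<le> majorant n"
proof (induction n)
  case (Suc n)
  have "norm (sqrt_iter x n * sqrt_iter x n) \<le> majorant n * majorant n"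
    using Suc by (meson mult_mono' norm_ge_zero norm_mult_ineq order_trans)
  with assms have "norm (x + sqrt_iter x n * sqrt_iter x n) \<le> 1 + majorant n * majorant n"
    by norm
  then show ?case by simp
qed simp

text \<open>Consecutive iterates commute, so the difference of their squares factors as sum times
  difference. The increments of \<open>majorant\<close> factor in the same way, so the induction
  closes exactly.\<close>

lemma norm_sqrt_iter_Suc_diff:
  assumes "norm x \<le> 1"
  shows "norm (sqrt_iter x (Suc n) - sqrt_iter x n) \<le> majorant (Suc n) - majorant n"
proof (induction n)
  case 0
  then show ?case using assms by simp
next
  case (Suc n)
  let ?b = "sqrt_iter x (Suc n)" and ?c = "sqrt_iter x n"
  have comm: "?c * ?b = ?b * ?c"
    by (rule sqrt_iter_commute) (simp add: sqrt_iter_commute)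
  have "sqrt_iter x (Suc (Suc n)) - ?b = (1/2) *\<^sub>R (?b * ?b - ?c * ?c)"
    by (simp only: sqrt_iter.simps(2)[of x "Suc n"])
      (simp add: algebra_simps)
  also have "?b * ?b - ?c * ?c = (?b + ?c) * (?b - ?c)"
    using comm by (simp only: distrib_left distrib_right right_diff_distrib left_diff_distrib) simp
  finally have eq: "sqrt_iter x (Suc (Suc n)) - ?b = (1/2) *\<^sub>R ((?b + ?c) * (?b - ?c))" .
  have "norm ((?b + ?c) * (?b - ?c)) \<le> (majorant (Suc n) + majorant n) * (majorant (Suc n) - majorant n)"
    by (rule order_trans[OF norm_mult_ineq mult_mono'])
      (use Suc norm_triangle_mono[OF norm_sqrt_iter[OF assms] norm_sqrt_iter[OF assms]]
        in \<open>simp_all del: sqrt_iter.simps majorant.simps\<close>)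
  then have "norm ((1/2) *\<^sub>R ((?b + ?c) * (?b - ?c)))
      \<le> (majorant (Suc n) + majorant n) * (majorant (Suc n) - majorant n) / 2" by simp
  also have "\<dots> = majorant (Suc (Suc n)) - majorant (Suc n)"
    by (simp only: majorant.simps(2)[of "Suc n"] majorant.simps(2)[of n])
      (simp add: field_simps)
  finally show ?case unfolding eq .
qed

text \<open>The increment bounds telescope to a bound of distances in \<open>f\<close> by
  differences of the convergent sequence \<open>g\<close>.\<close>

lemma Cauchy_if_increments_le:
  fixes f :: "nat \<Rightarrow> 'a::real_normed_vector"
  assumes "\<And>n. norm (f (Suc n) - f n) \<le> g (Suc n) - g n" "convergent g"
  shows "Cauchy f"
proof -
  have *: "norm (f n - f m) \<le> g n - g m" if "m \<le> n" for m n
    using that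
  proof (induction n rule: dec_induct)
    case (step n)
    then show ?case using assms(1)[of n] norm_triangle_ineq[of "f (Suc n) - f n" "f n - f m"] by simp
  qed simp
  show ?thesis
  proof (rule CauchyI)
    fix e :: real assume "0 < e"
    with assms(2) obtain N where N: "\<And>m n. m \<ge> N \<Longrightarrow> n \<ge> N \<Longrightarrow> norm (g m - g n) < e"
      using CauchyD convergent_Cauchy by metis
    show "\<exists>N. \<forall>m\<ge>N. \<forall>n\<ge>N. norm (f m - f n) < e"
    proof (intro exI allI impI)
      fix m n assume "N \<le> m" "N \<le> n"
      with *[of m n] *[of n m] N[of m n] show "norm (f m - f n) < e"
        by (cases "m \<le> n") (auto simp: norm_minus_commute)
    qed
  qed
qed

lemma one_minus_square_root:
  fixes x :: "'a::unital_cstar_algebra"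
  assumes "norm x \<le> 1"
  obtains b where "norm b \<le> 1" "(1 - b) * (1 - b) = 1 - x" "star x = x \<Longrightarrow> star b = b"
    "\<And>y. y * x = x * y \<Longrightarrow> y * b = b * y"
proof -
  have "Cauchy (sqrt_iter x)"
    using Cauchy_if_increments_le norm_sqrt_iter_Suc_diff[OF assms] majorant_convergent by blast
  then obtain b where b: "sqrt_iter x \<longlonglongrightarrow> b" using Cauchy_convergent convergent_def by blast
  have "(\<lambda>n. (1/2) *\<^sub>R (x + sqrt_iter x n * sqrt_iter x n)) \<longlonglongrightarrow> (1/2) *\<^sub>R (x + b * b)"
    by (intro tendsto_intros b)
  moreover have "(\<lambda>n. (1/2) *\<^sub>R (x + sqrt_iter x n * sqrt_iter x n)) \<longlonglongrightarrow> b"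
    using LIMSEQ_Suc[OF b] by simp
  ultimately have "b = (1/2) *\<^sub>R (x + b * b)" using LIMSEQ_unique by blast
  then have "b + b = x + b * b"
    by (metis scaleR_half_double scaleR_right_distrib)
  then have 1: "(1 - b) * (1 - b) = 1 - x" by (simp add: algebra_simps)
  have 2: "norm b \<le> 1"
    by (rule Lim_bounded[OF tendsto_norm[OF b], of 0])
      (use norm_sqrt_iter[OF assms] majorant_bounds order_trans in blast)
  have 3: "star b = b" if "star x = x"
    by (rule LIMSEQ_unique[OF bounded_linear.tendsto[OF bounded_linear_star b]])
      (simp add: sqrt_iter_star[OF that] b)
  have 4: "y * b = b * y" if "y * x = x * y" for y
    by (rule LIMSEQ_unique[OF tendsto_mult_left[OF b]])
      (simp add: sqrt_iter_commute[OF that] tendsto_mult_right[OF b])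
  from that[OF 2 1 3 4] show ?thesis .
qed

text \<open>Kelley and Vaught's description of the positive cone, evidently closed under addition.\<close>

definition kv_pos :: "'a::unital_cstar_algebra \<Rightarrow> bool" where
  "kv_pos a \<longleftrightarrow> star a = a \<and> (\<exists>r\<ge>0. norm (r *\<^sub>R 1 - a) \<le> r)"

lemma kv_pos_self_adjoint: "kv_pos a \<Longrightarrow> star a = a"
  by (simp add: kv_pos_def)

section \<open>Squares, roots and norms in the Kelley-Vaught cone\<close>

lemma kv_pos_add: "kv_pos a \<Longrightarrow> kv_pos b \<Longrightarrow> kv_pos (a + b)"
  unfolding kv_pos_def star_add
  by (metis add_diff_add add_nonneg_nonneg norm_triangle_mono scaleR_add_left)

lemma kv_pos_scaleR: "kv_pos a \<Longrightarrow> 0 \<le> t \<Longrightarrow> kv_pos (t *\<^sub>R a)"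
  unfolding kv_pos_def star_scaleR
proof safe
  fix r :: real assume "0 \<le> t" "0 \<le> r" "norm (r *\<^sub>R 1 - a) \<le> r"
  then have "norm ((t * r) *\<^sub>R 1 - t *\<^sub>R a) \<le> t * r"
    by (metis abs_of_nonneg mult_left_mono norm_scaleR scaleR_right_diff_distrib scaleR_scaleR)
  with \<open>0 \<le> t\<close> \<open>0 \<le> r\<close> show "\<exists>r\<ge>0. norm (r *\<^sub>R 1 - t *\<^sub>R a) \<le> r"
    using mult_nonneg_nonneg by blast
qed auto

lemma kv_pos_scalar: "0 \<le> t \<Longrightarrow> kv_pos (t *\<^sub>R (1::'a::unital_cstar_algebra))"
  unfolding kv_pos_def star_scaleR by force

text \<open>With \<open>m * m = r\<^sup>2 - a * a\<close> the element \<open>a + i m\<close> is \<open>r\<close> times a unitary one, which bounds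
  its real and imaginary parts.\<close>

lemma norm_real_imaginary_part_le:
  fixes a m :: "'a::unital_cstar_algebra"
  assumes "star a = a" "star m = m" "a * m = m * a" "a * a + m * m = (r * r) *\<^sub>R 1" "0 \<le> r"
  shows "norm a \<le> r" "norm m \<le> r"
proof -
  define u where "u = a + \<i> *\<^sub>C m"
  have su: "star u = a - \<i> *\<^sub>C m"
    by (simp add: u_def star_add star_scaleC assms scaleC_minus_left)
  have "star u * u = a * a + \<i> *\<^sub>C (a * m) - \<i> *\<^sub>C (m * a) - \<i> *\<^sub>C \<i> *\<^sub>C (m * m)"
    by (subst su) (simp add: u_def algebra_simps mult_scaleC_left mult_scaleC_right scaleC_diff_right)
  also have "\<dots> = (r * r) *\<^sub>R 1"
    using assms(4) by (simp add: scaleC_scaleC assms(3) scaleC_minus_left)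
  finally have "(norm u)\<^sup>2 = r\<^sup>2" using cstar_identity[of u] by (simp add: power2_eq_square)
  then have nu: "norm u = r" using assms(5) by (simp add: power2_eq_iff_nonneg)
  have "norm (2 *\<^sub>R a) = norm (u + star u)" by (subst su) (simp add: u_def scaleR_2)
  also have "\<dots> \<le> 2 * r" using norm_triangle_ineq[of u "star u"] nu by simp
  finally show "norm a \<le> r" by simp
  have "norm (2 *\<^sub>R m) = norm (\<i> *\<^sub>C (2 *\<^sub>R m))" by (simp add: norm_scaleC)
  also have "\<i> *\<^sub>C (2 *\<^sub>R m) = u - star u" by (subst su) (simp add: u_def scaleR_2 scaleC_add_right)
  also have "norm \<dots> \<le> 2 * r" using norm_triangle_ineq4[of u "star u"] nu by simp
  finally show "norm m \<le> r" by simp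
qed

text \<open>The root \<open>1 - b\<close> of \<open>1 - h * h\<close> is self-adjoint and commutes
  with \<open>h\<close>, and the two squares add up to 1. So it is a contraction, and then so is its
  square.\<close>

lemma norm_one_minus_square_le:
  fixes h :: "'a::unital_cstar_algebra"
  assumes "star h = h" "norm h \<le> 1"
  shows "norm (1 - h * h) \<le> 1"
proof -
  have "norm (h * h) \<le> 1"
    using assms by (simp add: norm_square_self_adjoint power_le_one)
  then obtain b where b: "(1 - b) * (1 - b) = 1 - h * h" "star (h * h) = h * h \<Longrightarrow> star b = b"
    "\<And>y. y * (h * h) = h * h * y \<Longrightarrow> y * b = b * y"
    using one_minus_square_root by metis
  have "h * b = b * h" by (rule b) (simp add: mult.assoc)
  then have "norm (1 - b) \<le> 1"
    by (intro norm_real_imaginary_part_le(2)[of h])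
      (simp_all add: assms b(1) b(2) star_diff star_mult, simp add: algebra_simps)
  moreover have "norm ((1 - b) * (1 - b)) = (norm (1 - b))\<^sup>2"
    by (rule norm_square_self_adjoint) (simp add: star_diff b assms star_mult)
  ultimately show ?thesis using b(1) by (simp add: power_le_one)
qed

text \<open>Normalizing \<open>h\<close> reduces this to contractions. The norm of a square can thus
  serve as its radius in \<open>kv_pos\<close>.\<close>

lemma norm_norm_minus_square_le:
  fixes h :: "'a::unital_cstar_algebra"
  assumes "star h = h"
  shows "norm ((norm (h * h)) *\<^sub>R 1 - h * h) \<le> norm (h * h)"
proof (cases "h = 0")
  case False
  define g where "g = (1 / norm h) *\<^sub>R h"
  have "norm (1 - g * g) \<le> 1"
    by (rule norm_one_minus_square_le) (use False in \<open>simp_all add: g_def star_scaleR assms\<close>)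
  then have "(norm h)\<^sup>2 * norm (1 - g * g) \<le> (norm h)\<^sup>2"
    by (simp add: mult_left_le)
  moreover have "(norm h)\<^sup>2 *\<^sub>R (1 - g * g) = (norm h)\<^sup>2 *\<^sub>R 1 - h * h"
    using False by (simp add: g_def scaleR_right_diff_distrib power2_eq_square)
  ultimately show ?thesis
    by (metis assms norm_square_self_adjoint abs_of_nonneg norm_scaleR zero_le_power2)
qed simp

lemma kv_pos_square: "star h = h \<Longrightarrow> kv_pos (h * h)"
  unfolding kv_pos_def using norm_norm_minus_square_le[of h]
  by (metis norm_ge_zero star_mult)

text \<open>Dividing by the radius \<open>r\<close> makes \<open>1 - a / r\<close> a contraction, to
  which the iteration applies. The bound on \<open>b\<close> puts the rescaled root into the cone
  again, with radius \<open>sqrt r\<close>.\<close>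

lemma kv_pos_square_root:
  fixes a :: "'a::unital_cstar_algebra"
  assumes "kv_pos a"
  obtains l where "kv_pos l" "l * l = a" "\<And>y. y * a = a * y \<Longrightarrow> y * l = l * y"
proof -
  from assms obtain r where r: "0 \<le> r" "norm (r *\<^sub>R 1 - a) \<le> r" and sa: "star a = a"
    by (auto simp: kv_pos_def)
  show ?thesis
  proof (cases "r = 0")
    case True
    with r have "a = 0" by simp
    then show ?thesis using that[of 0] kv_pos_scalar[of 0] by simp
  next
    case False
    with r have "r > 0" by simp
    define x where "x = 1 - (1/r) *\<^sub>R a"
    have "x = (1/r) *\<^sub>R (r *\<^sub>R 1 - a)" using \<open>r > 0\<close> by (simp add: x_def scaleR_right_diff_distrib)
    then have "norm x \<le> 1" using r \<open>r > 0\<close> by simp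
    then obtain b where b: "norm b \<le> 1" "(1 - b) * (1 - b) = 1 - x" "star x = x \<Longrightarrow> star b = b"
      "\<And>y. y * x = x * y \<Longrightarrow> y * b = b * y" using one_minus_square_root by metis
    define l where "l = sqrt r *\<^sub>R (1 - b)"
    have "star l = l" by (simp add: l_def star_scaleR star_diff b x_def sa)
    moreover have "norm (sqrt r *\<^sub>R 1 - l) \<le> sqrt r"
      using b(1) r by (simp add: l_def scaleR_right_diff_distrib mult_left_le)
    ultimately have "kv_pos l" unfolding kv_pos_def using r(1) real_sqrt_ge_zero by blast
    moreover have "l * l = a" using b(2) \<open>r > 0\<close> by (simp add: l_def x_def)
    moreover have "y * l = l * y" if "y * a = a * y" for y
      using b(4)[of y] that by (simp add: l_def x_def algebra_simps)
    ultimately show ?thesis using that by blast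
  qed
qed

text \<open>The radius in \<open>kv_pos\<close> is arbitrary; writing \<open>a\<close> as a square
  shows that its own norm will do.\<close>

lemma kv_pos_norm_minus: "kv_pos a \<Longrightarrow> norm (norm a *\<^sub>R 1 - a) \<le> norm a"
  by (metis kv_pos_square_root kv_pos_self_adjoint norm_norm_minus_square_le)

text \<open>With \<open>r = norm b\<close>, the element \<open>r - b\<close> is in the cone with
  radius \<open>r\<close>, hence so are \<open>r - a\<close> and \<open>r + a\<close>. Their roots
  \<open>k\<close> and \<open>l\<close> commute with each other and with \<open>a\<close>, and
  \<open>k * l\<close> squares to \<open>r^2 - a^2\<close>. So \<open>a\<close> is the real part of
  \<open>r\<close> times a unitary element.\<close>

lemma kv_pos_norm_mono:
  fixes a b :: "'a::unital_cstar_algebra"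
  assumes "kv_pos a" "kv_pos (b - a)"
  shows "norm a \<le> norm b"
proof -
  let ?r = "norm b"
  have b: "kv_pos b" using kv_pos_add[OF assms] by simp
  then have "kv_pos (?r *\<^sub>R 1 - b)"
    unfolding kv_pos_def[of "?r *\<^sub>R 1 - b"]
    by (auto intro!: exI[of _ ?r] simp: star_diff star_scaleR kv_pos_self_adjoint)
  then have "kv_pos (?r *\<^sub>R 1 - a)" using kv_pos_add[OF _ assms(2)] by fastforce
  then obtain k where k: "kv_pos k" "k * k = ?r *\<^sub>R 1 - a"
    "\<And>y. y * (?r *\<^sub>R 1 - a) = (?r *\<^sub>R 1 - a) * y \<Longrightarrow> y * k = k * y"
    using kv_pos_square_root by metis
  have "kv_pos (?r *\<^sub>R 1 + a)" using kv_pos_add kv_pos_scalar assms by (metis norm_ge_zero)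
  then obtain l where l: "kv_pos l" "l * l = ?r *\<^sub>R 1 + a"
    "\<And>y. y * (?r *\<^sub>R 1 + a) = (?r *\<^sub>R 1 + a) * y \<Longrightarrow> y * l = l * y"
    using kv_pos_square_root by metis
  have ak: "a * k = k * a" by (rule k) (simp add: algebra_simps)
  have al: "a * l = l * a" by (rule l) (simp add: algebra_simps)
  have kl: "k * l = l * k" by (rule l) (simp add: algebra_simps ak)
  have "(k * l) * (k * l) = (k * k) * (l * l)" by (metis kl mult.assoc)
  also have "\<dots> = (?r * ?r) *\<^sub>R 1 - a * a" by (simp add: k l algebra_simps)
  finally have sq: "a * a + (k * l) * (k * l) = (?r * ?r) *\<^sub>R 1" by simp
  have "star (k * l) = k * l" using k(1) l(1) by (simp add: star_mult kv_pos_self_adjoint kl)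
  moreover have "a * (k * l) = (k * l) * a" by (metis ak al mult.assoc)
  ultimately show ?thesis
    using norm_real_imaginary_part_le(1)[OF kv_pos_self_adjoint[OF assms(1)] _ _ sq] by simp
qed

text \<open>The usual proof compares the spectra of \<open>star c * c\<close> and
  \<open>c * star c\<close>. Here \<open>g = c * (r + k)\<close> is estimated twice, with
  \<open>r\<close> the square of the norm of \<open>c\<close>: since
  \<open>c * k = - (w * c)\<close>, it equals \<open>(r - w) * c\<close>, so its squared norm is at
  most \<open>r^3\<close>; but \<open>- (star g * g)\<close> dominates \<open>2 r k^2\<close>, which
  forces at least \<open>2 r^3\<close>. Hence \<open>r = 0\<close>.\<close>

lemma star_mult_self_kv_neg:
  fixes c :: "'a::unital_cstar_algebra"
  assumes "star c * c = - k" "kv_pos k"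
  shows "c = 0"
proof -
  define w where "w = c * star c"
  define r where "r = norm w"
  \<comment> \<open>Up to sign, \<open>p\<close> and \<open>q\<close> are twice the real and
    imaginary parts of \<open>c\<close>; their squares add up to
    \<open>2 (c * star c + star c * c)\<close>, so \<open>w\<close> is half this sum plus
    \<open>k\<close>.\<close>
  define p q where "p = c + star c" and "q = \<i> *\<^sub>C (c - star c)"
  have sp: "star p = p" and sq: "star q = q"
    by (simp_all add: p_def q_def star_add star_scaleC star_diff star_star scaleC_minus_left
        scaleC_diff_right algebra_simps)
  have "q * q = - ((c - star c) * (c - star c))"
    by (simp add: q_def mult_scaleC_left mult_scaleC_right scaleC_scaleC scaleC_minus_left)
  then have "p * p + q * q = 2 *\<^sub>R (w + star c * c)"
    by (simp add: p_def w_def scaleR_2 algebra_simps)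
  then have "w = (1/2) *\<^sub>R (p * p + q * q) + k"
    using assms(1) by simp
  then have "kv_pos w"
    by (simp add: kv_pos_add kv_pos_scaleR kv_pos_square sp sq assms(2))
  then have nw: "norm (r *\<^sub>R 1 - w) \<le> r" unfolding r_def by (rule kv_pos_norm_minus)
  have r: "r = (norm c)\<^sup>2" unfolding r_def w_def using cstar_identity[of "star c"] by (simp add: star_star)
  have nk: "norm k = r" using assms(1) cstar_identity[of c] r by simp
  have sk: "star k = k" using assms(2) by (rule kv_pos_self_adjoint)
  obtain l where l: "kv_pos l" "l * l = k" using kv_pos_square_root[OF assms(2)] by metis
  have sl: "star l = l" using l kv_pos_self_adjoint by blast
  define g where "g = c * (r *\<^sub>R 1 + k)"
  have "g = (r *\<^sub>R 1 - w) * c"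
    using assms(1) by (simp add: g_def w_def algebra_simps)
  then have "norm g \<le> r * norm c"
    by (metis mult_right_mono norm_ge_zero norm_mult_ineq nw order_trans)
  then have "(norm g)\<^sup>2 \<le> (r * norm c)\<^sup>2" by (rule power_mono) simp
  also have "(r * norm c)\<^sup>2 = r ^ 3"
    by (simp add: power_mult_distrib r[symmetric] power3_eq_cube power2_eq_square[of r])
  finally have g1: "norm (star g * g) \<le> r ^ 3" by (simp add: cstar_identity)
  have sg: "- (star g * g) = (r * r) *\<^sub>R k + (2 * r) *\<^sub>R (k * k) + k * k * k"
  proof -
    have "star g * g = (r *\<^sub>R 1 + k) * (star c * c) * (r *\<^sub>R 1 + k)"
      by (simp add: g_def star_mult star_add star_scaleR sk mult.assoc)
    then have "- (star g * g) = (r *\<^sub>R 1 + k) * k * (r *\<^sub>R 1 + k)" by (simp add: assms(1))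
    then show ?thesis by (simp add: algebra_simps scaleR_2 flip: scaleR_scaleR)
  qed
  have "k * k * k = (l * l * l) * (l * l * l)" by (simp add: l(2)[symmetric] mult.assoc)
  then have "kv_pos (k * k * k)"
    by (simp only:) (rule kv_pos_square, simp add: star_mult sl mult.assoc)
  then have "kv_pos (- (star g * g) - (2 * r) *\<^sub>R (k * k))"
    unfolding sg using assms(2) by (simp add: kv_pos_add kv_pos_scaleR)
  moreover have "kv_pos ((2 * r) *\<^sub>R (k * k))"
    using sk by (simp add: kv_pos_scaleR kv_pos_square r)
  ultimately have "norm ((2 * r) *\<^sub>R (k * k)) \<le> norm (- (star g * g))" by (intro kv_pos_norm_mono)
  then have "2 * r ^ 3 \<le> r ^ 3"
    using g1 nk r by (simp add: norm_square_self_adjoint[OF sk] power3_eq_cube power2_eq_square)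
  then have "r ^ 3 \<le> 0" by simp
  then have "r = 0" using r by (metis power_le_zero_eq zero_le_power2 order_antisym odd_numeral)
  then show ?thesis using r by simp
qed

text \<open>Let \<open>k\<close> be the absolute value of \<open>h = star b * b\<close>, so that
  \<open>e = k - h\<close> is twice the negative part of \<open>h\<close>. From
  \<open>(h + k) * e = 0\<close> the inner square of \<open>b * e\<close> is
  \<open>- (e * k * e)\<close>, the negative of a square, so \<open>b * e = 0\<close> by the
  preceding lemma. Then \<open>e^3 = 0\<close>, and a self-adjoint nilpotent element vanishes, so
  \<open>h = k\<close>.\<close>

lemma kv_pos_star_mult_self:
  fixes b :: "'a::unital_cstar_algebra"
  shows "kv_pos (star b * b)"
proof -
  define h where "h = star b * b"
  have sh: "star h = h" by (simp add: h_def star_mult star_star)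
  obtain k where k: "kv_pos k" "k * k = h * h" "\<And>y. y * (h * h) = h * h * y \<Longrightarrow> y * k = k * y"
    using kv_pos_square_root[OF kv_pos_square[OF sh]] by metis
  obtain m where m: "kv_pos m" "m * m = k" "\<And>y. y * k = k * y \<Longrightarrow> y * m = m * y"
    using kv_pos_square_root[OF k(1)] by metis
  have hk: "h * k = k * h" by (rule k) (simp add: mult.assoc)
  define e where "e = k - h"
  have se: "star e = e" by (simp add: e_def star_diff sh k kv_pos_self_adjoint)
  have em: "e * m = m * e" by (rule m) (simp add: e_def algebra_simps hk)
  have "(h + k) * e = 0" by (simp add: e_def algebra_simps hk k)
  then have ehk: "e * h * e = - (e * k * e)"
    by (metis add_eq_0_iff2 distrib_left distrib_right mult.assoc mult_zero_right)
  have eke: "e * k * e = (e * m) * (e * m)" by (metis em m(2) mult.assoc)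
  have "b * e = 0"
  proof (rule star_mult_self_kv_neg)
    show "star (b * e) * (b * e) = - (e * k * e)"
      using ehk by (simp add: star_mult se h_def mult.assoc)
    show "kv_pos (e * k * e)"
      unfolding eke by (rule kv_pos_square) (simp add: star_mult se em m kv_pos_self_adjoint)
  qed
  then have "e * h * e = 0" by (simp add: h_def mult.assoc)
  with ehk have "e * (k - h) * e = 0"
    by (simp add: left_diff_distrib right_diff_distrib)
  then have "e * e * e = 0" by (simp only: e_def)
  then have "star (e * e) * (e * e) = 0" by (metis se star_mult mult.assoc mult_zero_right)
  then have "e * e = 0" by (rule star_mult_self_eq_zero)
  then have "e = 0" using se star_mult_self_eq_zero by metis
  then show ?thesis using k by (simp add: e_def h_def)
qed


subsection \<open>Unitization\<close>

datatype 'a unitization = Unitization (alg_part: 'a) (scalar_part: complex)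

text \<open>Left multiplication by \<open>u\<close>, restricted to the original algebra as an ideal
  of its unitization; its operator norm enters the norm below.\<close>

definition unit_act :: "'a::cstar_algebra unitization \<Rightarrow> 'a \<Rightarrow> 'a" where
  "unit_act u b = alg_part u * b + scalar_part u *\<^sub>C b"

lemma bounded_linear_unit_act: "bounded_linear (unit_act u)"
proof (rule bounded_linear_intro[where K="norm (alg_part u) + cmod (scalar_part u)"])
  show "unit_act u (r *\<^sub>R x) = r *\<^sub>R unit_act u x" for r x
    by (simp add: unit_act_def scaleR_scaleC scaleC_add_right scaleC_scaleC mult_scaleC_right mult.commute)
  show "norm (unit_act u x) \<le> norm x * (norm (alg_part u) + cmod (scalar_part u))" for x
    unfolding unit_act_def
    by (rule order_trans[OF norm_triangle_ineq])
      (simp add: norm_scaleC distrib_left norm_mult_ineq mult.commute[of "norm x"])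
qed (simp add: unit_act_def scaleC_add_right distrib_left)

instantiation unitization :: (cstar_algebra) real_vector
begin

definition "0 = Unitization (0::'a) 0"
definition "u + v = Unitization (alg_part u + alg_part v :: 'a) (scalar_part u + scalar_part v)"
definition "u - v = Unitization (alg_part u - alg_part v :: 'a) (scalar_part u - scalar_part v)"
definition "- u = Unitization (- alg_part u :: 'a) (- scalar_part u)"
definition "r *\<^sub>R u = Unitization (r *\<^sub>R alg_part u :: 'a) (r *\<^sub>R scalar_part u)"

lemmas unitization_defs =
  zero_unitization_def plus_unitization_def minus_unitization_def uminus_unitization_def
  scaleR_unitization_def

instance
  by standard (simp_all add: unitization_defs algebra_simps)

end

instantiation unitization :: (cstar_algebra) real_normed_vector
begin

text \<open>The second argument of the maximum is needed because the operator seminorm is degenerate on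
  the unitization if the given algebra already has a unit.\<close>

definition "norm (u :: 'a unitization) = max (onorm (unit_act u)) (cmod (scalar_part u))"
definition "dist (u :: 'a unitization) v = norm (u - v)"
definition "sgn (u :: 'a unitization) = u /\<^sub>R norm u"
definition [code del]:
  "(uniformity :: ('a unitization \<times> 'a unitization) filter) = (INF e\<in>{0 <..}. principal {(x, y). dist x y < e})"
definition open_unitization [code del]:
  "open (U :: 'a unitization set) = (\<forall>x\<in>U. eventually (\<lambda>(x', y). x' = x \<longrightarrow> y \<in> U) uniformity)"

instance
proof
  fix u v w :: "'a unitization" and r s :: real
  show "dist u v = norm (u - v)" by (rule dist_unitization_def)
  show "sgn u = u /\<^sub>R norm u" by (rule sgn_unitization_def)
  show "(uniformity :: ('a unitization \<times> 'a unitization) filter) = (INF e\<in>{0 <..}. principal {(x, y). dist x y < e})"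
    by (rule uniformity_unitization_def)
  show "open U = (\<forall>x\<in>U. eventually (\<lambda>(x', y). x' = x \<longrightarrow> y \<in> U) uniformity)" for U :: "'a unitization set"
    by (rule open_unitization)
  show "norm u = 0 \<longleftrightarrow> u = 0"
  proof
    assume "norm u = 0"
    then have "cmod (scalar_part u) \<le> 0" "onorm (unit_act u) \<le> 0"
      unfolding norm_unitization_def by (metis max.cobounded2, metis max.cobounded1)
    then have s: "scalar_part u = 0" and "onorm (unit_act u) = 0"
      using onorm_pos_le[OF bounded_linear_unit_act[of u]] by auto
    \<comment> \<open>With zero scalar part, testing the action on the adjoint of
      \<open>alg_part u\<close> turns a vanishing action into the vanishing of an inner
      square.\<close>
    then have "unit_act u (star (alg_part u)) = 0"
      using onorm_eq_0[OF bounded_linear_unit_act] by auto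
    then have "star (star (alg_part u)) * star (alg_part u) = 0"
      by (simp add: unit_act_def s star_star)
    then have "star (alg_part u) = 0" by (rule star_mult_self_eq_zero)
    then have "alg_part u = 0" by (metis star_star star_zero)
    with s show "u = 0" by (cases u) (simp add: zero_unitization_def)
  next
    assume "u = 0"
    then have "unit_act u = (\<lambda>x. 0)" "scalar_part u = 0"
      by (auto simp: unit_act_def unitization_defs)
    then show "norm u = 0" by (simp add: norm_unitization_def onorm_zero)
  qed
  have "unit_act (u + v) = (\<lambda>x. unit_act u x + unit_act v x)"
    by (auto simp: unit_act_def unitization_defs algebra_simps scaleC_add_left)
  then have "onorm (unit_act (u + v)) \<le> onorm (unit_act u) + onorm (unit_act v)"
    by (simp add: onorm_triangle bounded_linear_unit_act)
  moreover have "cmod (scalar_part (u + v)) \<le> cmod (scalar_part u) + cmod (scalar_part v)"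
    by (simp add: unitization_defs norm_triangle_ineq)
  ultimately show "norm (u + v) \<le> norm u + norm v"
    unfolding norm_unitization_def by linarith
  have "unit_act (r *\<^sub>R u) = (\<lambda>x. r *\<^sub>R unit_act u x)"
    by (rule ext) (simp add: unit_act_def scaleR_unitization_def scaleR_scaleC scaleC_add_right
        scaleC_scaleC scaleR_conv_of_real mult_scaleC_left)
  then show "norm (r *\<^sub>R u) = \<bar>r\<bar> * norm u"
    by (simp add: norm_unitization_def onorm_scaleR bounded_linear_unit_act max_mult_distrib_left)
      (simp add: unitization_defs)
qed

end

lemma norm_unit_act_le: "norm (unit_act u b) \<le> norm u * norm b"
  by (rule order_trans[OF onorm[OF bounded_linear_unit_act]])
    (simp add: norm_unitization_def mult_right_mono)

lemma norm_scalar_part_le: "cmod (scalar_part u) \<le> norm u"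
  by (simp add: norm_unitization_def)

lemma norm_Unitization_le: "norm (Unitization a l) \<le> norm a + cmod l"
proof -
  have "onorm (unit_act (Unitization a l)) \<le> norm a + cmod l"
  proof (rule onorm_bound)
    show "norm (unit_act (Unitization a l) x) \<le> (norm a + cmod l) * norm x" for x
      unfolding unit_act_def
      by (rule order_trans[OF norm_triangle_ineq])
        (simp add: norm_scaleC distrib_right norm_mult_ineq)
  qed simp
  then show ?thesis by (simp add: norm_unitization_def)
qed

text \<open>For the lower bound, left multiplication by \<open>a\<close> is tested on
  \<open>star a\<close>, where the C*-identity gives the square of \<open>norm a\<close>.\<close>

lemma norm_Unitization_0: "norm (Unitization a 0) = norm a"
proof (rule antisym)
  show "norm (Unitization a 0) \<le> norm a" using norm_Unitization_le[of a 0] by simp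
  have "norm a * norm a \<le> norm (Unitization a 0) * norm a"
    using norm_unit_act_le[of "Unitization a 0" "star a"] cstar_identity[of "star a"]
    by (simp add: unit_act_def star_star power2_eq_square)
  then show "norm a \<le> norm (Unitization a 0)" by (cases "a = 0") auto
qed

text \<open>Makes Cauchy sequences in the unitization Cauchy in both coordinates, from which
  completeness follows. The factor 2 pays for subtracting the scalar part.\<close>

lemma norm_alg_part_le: "norm (alg_part u) \<le> 2 * norm u"
proof -
  have "Unitization (alg_part u) 0 = u - Unitization 0 (scalar_part u)"
    by (cases u) (simp add: minus_unitization_def)
  then have "norm (alg_part u) \<le> norm u + norm (Unitization (0::'a) (scalar_part u))"
    by (metis norm_Unitization_0 norm_triangle_ineq4)
  then show ?thesis using norm_Unitization_le[of "0::'a" "scalar_part u"] norm_scalar_part_le[of u] by simp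
qed

instantiation unitization :: (cstar_algebra) unital_cstar_algebra
begin

definition "1 = Unitization (0::'a) 1"
definition "u * v = Unitization (alg_part u * alg_part v + scalar_part u *\<^sub>C alg_part v
  + scalar_part v *\<^sub>C alg_part u :: 'a) (scalar_part u * scalar_part v)"
definition "c *\<^sub>C u = Unitization (c *\<^sub>C alg_part u :: 'a) (c * scalar_part u)"
definition "star u = Unitization (star (alg_part u) :: 'a) (cnj (scalar_part u))"

lemmas unitization_alg_defs = unitization_defs
  one_unitization_def times_unitization_def scaleC_unitization_def star_unitization_def

lemma unit_act_mult: "unit_act (u * v) = unit_act u \<circ> unit_act v"
  for u v :: "'a unitization"
  by (auto simp: unit_act_def unitization_alg_defs algebra_simps scaleC_add_right scaleC_scaleC
      mult_scaleC_left mult_scaleC_right)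

lemma star_unit_act: "star (unit_act u b) * unit_act u b = star b * unit_act (star u * u) b"
  by (simp add: unit_act_mult) 
    (simp add: unit_act_def unitization_alg_defs star_add star_mult star_scaleC algebra_simps
      mult_scaleC_left mult_scaleC_right scaleC_add_right scaleC_scaleC)

lemma norm_unitization_mult: "norm (u * v) \<le> norm u * norm v" for u v :: "'a unitization"
proof -
  have "onorm (unit_act (u * v)) \<le> onorm (unit_act u) * onorm (unit_act v)"
    by (simp add: unit_act_mult onorm_compose bounded_linear_unit_act)
  also have "\<dots> \<le> norm u * norm v"
    by (rule mult_mono) (auto simp: norm_unitization_def onorm_pos_le bounded_linear_unit_act le_max_iff_disj)
  finally have "onorm (unit_act (u * v)) \<le> norm u * norm v" .
  moreover have "cmod (scalar_part (u * v)) \<le> norm u * norm v"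
    by (simp add: times_unitization_def norm_mult mult_mono norm_scalar_part_le)
  ultimately show ?thesis unfolding norm_unitization_def[of "u * v"] by simp
qed

text \<open>The inner square of \<open>unit_act u b\<close> lies in the original algebra, whose
  C*-identity applies there. The opposite inequality follows from submultiplicativity once
  \<open>star\<close> is isometric, and this inequality yields that too.\<close>

lemma norm_unitization_square_le: "(norm u)\<^sup>2 \<le> norm (star u * u)" for u :: "'a unitization"
proof -
  have "onorm (unit_act u) \<le> sqrt (norm (star u * u))"
  proof (rule onorm_bound)
    fix b :: 'a
    have "(norm (unit_act u b))\<^sup>2 = norm (star b * unit_act (star u * u) b)"
      by (simp add: cstar_identity flip: star_unit_act)
    also have "\<dots> \<le> norm b * norm (unit_act (star u * u) b)"
      using norm_mult_ineq[of "star b"] by simp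
    also have "\<dots> \<le> norm b * (norm (star u * u) * norm b)"
      by (intro mult_left_mono norm_unit_act_le) simp
    also have "\<dots> = (sqrt (norm (star u * u)) * norm b)\<^sup>2"
      by (simp add: power_mult_distrib power2_eq_square)
    finally show "norm (unit_act u b) \<le> sqrt (norm (star u * u)) * norm b"
      by (rule power2_le_imp_le) simp
  qed simp
  moreover have "cmod (scalar_part u) \<le> sqrt (norm (star u * u))"
  proof (rule real_le_rsqrt)
    show "(cmod (scalar_part u))\<^sup>2 \<le> norm (star u * u)"
      using norm_scalar_part_le[of "star u * u"]
      by (simp add: unitization_alg_defs norm_mult power2_eq_square)
  qed
  ultimately have "norm u \<le> sqrt (norm (star u * u))" by (simp add: norm_unitization_def)
  then show ?thesis using power_mono[of "norm u" "sqrt (norm (star u * u))" 2] by simp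
qed

instance
proof
  fix u v w :: "'a unitization" and r :: real and c d :: complex
  show "u * v * w = u * (v * w)" "(u + v) * w = u * w + v * w" "u * (v + w) = u * v + u * w"
    "1 * u = u" "u * 1 = u" "(0::'a unitization) \<noteq> 1"
    "c *\<^sub>C (u + v) = c *\<^sub>C u + c *\<^sub>C v"
    "(c + d) *\<^sub>C u = c *\<^sub>C u + d *\<^sub>C u" "c *\<^sub>C d *\<^sub>C u = (c * d) *\<^sub>C u"
    "(c *\<^sub>C u) * v = c *\<^sub>C (u * v)" "u * (c *\<^sub>C v) = c *\<^sub>C (u * v)"
    "star (u + v) = star u + star v" "star (c *\<^sub>C u) = cnj c *\<^sub>C star u"
    "star (u * v) = star v * star u" "star (star u) = u"
    by (simp_all add: unitization_alg_defs algebra_simps scaleC_add_left scaleC_add_right scaleC_scaleC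
        mult_scaleC_left mult_scaleC_right star_add star_mult star_scaleC star_star)
  show sc: "r *\<^sub>R u = complex_of_real r *\<^sub>C u" for r and u :: "'a unitization"
    by (simp add: unitization_alg_defs scaleR_scaleC scaleR_conv_of_real)
  show "(r *\<^sub>R u) * v = r *\<^sub>R (u * v)" "u * (r *\<^sub>R v) = r *\<^sub>R (u * v)"
    unfolding sc by (simp_all add: unitization_alg_defs algebra_simps scaleC_add_right scaleC_scaleC
        mult_scaleC_left mult_scaleC_right)
  show "norm (u * v) \<le> norm u * norm v" by (rule norm_unitization_mult)
  show "norm (1::'a unitization) = 1"
  proof -
    have "onorm (unit_act (1::'a unitization)) \<le> 1"
      by (rule onorm_bound) (simp_all add: unit_act_def one_unitization_def)
    then show ?thesis by (simp add: norm_unitization_def one_unitization_def)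
  qed
  have le: "norm (c *\<^sub>C u) \<le> cmod c * norm u" for c and u :: "'a unitization"
  proof -
    have "unit_act (c *\<^sub>C u) = (\<lambda>b. c *\<^sub>C unit_act u b)"
      by (auto simp: unit_act_def unitization_alg_defs mult_scaleC_left scaleC_add_right scaleC_scaleC)
    then have "onorm (unit_act (c *\<^sub>C u)) \<le> cmod c * norm u"
      by (simp only:) (rule onorm_bound, simp_all add: norm_scaleC mult.assoc mult_left_mono norm_unit_act_le)
    moreover have "cmod (scalar_part (c *\<^sub>C u)) \<le> cmod c * norm u"
      by (simp add: scaleC_unitization_def norm_mult mult_left_mono norm_scalar_part_le)
    ultimately show ?thesis unfolding norm_unitization_def[of "c *\<^sub>C u"] by simp
  qed
  show "norm (c *\<^sub>C u) = cmod c * norm u"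
  proof (cases "c = 0")
    case True
    with le[of c u] show ?thesis by simp
  next
    case False
    then have "inverse c *\<^sub>C (c *\<^sub>C u) = u" by (cases u) (simp add: scaleC_unitization_def scaleC_scaleC)
    then have "norm u \<le> inverse (cmod c) * norm (c *\<^sub>C u)"
      using le[of "inverse c" "c *\<^sub>C u"] by (simp add: norm_inverse)
    with le[of c u] False show ?thesis by (simp add: field_simps)
  qed
  have star_le: "norm u \<le> norm (star u)" for u :: "'a unitization"
  proof (cases "u = 0")
    case False
    have "norm u * norm u \<le> norm (star u) * norm u"
      using norm_unitization_square_le[of u] norm_unitization_mult[of "star u" u]
      by (simp add: power2_eq_square)
    with False show ?thesis by simp
  qed simp
  have "star (star u) = u" by (simp add: star_unitization_def star_star)
  then have "norm (star u) = norm u" using star_le[of u] star_le[of "star u"] by simp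
  then show "norm (star u * u) = (norm u)\<^sup>2"
    using norm_unitization_square_le[of u] norm_unitization_mult[of "star u" u]
    by (simp add: power2_eq_square)
  show "convergent X" if X: "Cauchy X" for X :: "nat \<Rightarrow> 'a unitization"
  proof -
    have "bounded_linear (alg_part :: 'a unitization \<Rightarrow> 'a)"
      by (rule bounded_linear_intro[where K=2])
        (use norm_alg_part_le in \<open>auto simp: unitization_defs mult.commute\<close>)
    then have "Cauchy (\<lambda>n. alg_part (X n))" using X bounded_linear.Cauchy by blast
    then obtain a where a: "(\<lambda>n. alg_part (X n)) \<longlonglongrightarrow> a" using Cauchy_convergent convergent_def by blast
    have "bounded_linear (scalar_part :: 'a unitization \<Rightarrow> complex)"
      by (rule bounded_linear_intro[where K=1])
        (use norm_scalar_part_le in \<open>auto simp: unitization_defs\<close>)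
    then have "Cauchy (\<lambda>n. scalar_part (X n))" using X bounded_linear.Cauchy by blast
    then obtain l where l: "(\<lambda>n. scalar_part (X n)) \<longlonglongrightarrow> l" using Cauchy_convergent convergent_def by blast
    have lim: "(\<lambda>n. norm (alg_part (X n) - a) + cmod (scalar_part (X n) - l)) \<longlonglongrightarrow> 0"
      by (intro tendsto_add_zero tendsto_norm_zero LIM_zero a l)
    have "norm (X n - Unitization a l) \<le> norm (alg_part (X n) - a) + cmod (scalar_part (X n) - l)" for n
      using norm_Unitization_le by (simp add: minus_unitization_def)
    then have "(\<lambda>n. X n - Unitization a l) \<longlonglongrightarrow> 0"
      by (intro Lim_null_comparison[OF always_eventually lim] allI)
    then have "X \<longlonglongrightarrow> Unitization a l" by (rule LIM_zero_cancel)
    then show ?thesis by (auto simp: convergent_def)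
  qed
qed

end

subsection \<open>The order of a general C*-algebra\<close>

text \<open>A sum of elements \<open>star b * b\<close> is not visibly of this form, whereas sums
  are immediate in the cone of the unitization. The implication from \<open>cstar_pos\<close> brings
  the axiom \<open>ip_pos\<close> into this order.\<close>

definition alg_pos :: "'a::cstar_algebra \<Rightarrow> bool" where
  "alg_pos a \<longleftrightarrow> kv_pos (Unitization a 0)"

lemma alg_pos_star_mult_self: "alg_pos (star b * b)"
proof -
  have "Unitization (star b * b) 0 = star (Unitization b 0) * Unitization b 0"
    by (simp add: unitization_alg_defs)
  then show ?thesis by (simp add: alg_pos_def kv_pos_star_mult_self)
qed

lemma cstar_pos_imp_alg_pos: "cstar_pos a \<Longrightarrow> alg_pos a"
  by (auto simp: cstar_pos_def alg_pos_star_mult_self)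

lemma alg_pos_add: "alg_pos a \<Longrightarrow> alg_pos b \<Longrightarrow> alg_pos (a + b)"
  using kv_pos_add[of "Unitization a 0" "Unitization b 0"] by (simp add: alg_pos_def unitization_defs)

lemma alg_pos_0: "alg_pos 0"
  using alg_pos_star_mult_self[of 0] by simp

lemma alg_pos_scaleR: "alg_pos a \<Longrightarrow> 0 \<le> t \<Longrightarrow> alg_pos (t *\<^sub>R a)"
  using kv_pos_scaleR[of "Unitization a 0" t] by (simp add: alg_pos_def unitization_defs)

lemma alg_pos_norm_mono: "alg_pos a \<Longrightarrow> alg_pos (b - a) \<Longrightarrow> norm a \<le> norm b"
  using kv_pos_norm_mono[of "Unitization a 0" "Unitization b 0"]
  by (simp add: alg_pos_def unitization_defs norm_Unitization_0)

section \<open>Hilbert modules\<close>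

lemma hcar_sub [simp]: "hcar (sub H M) = M"
  and hscale_sub [simp]: "hscale (sub H M) = hscale H"
  and hact_sub [simp]: "hact (sub H M) = hact H"
  and hip_sub [simp]: "hip (sub H M) = hip H"
  by (simp_all add: sub_def)

lemma hnorm_sub [simp]: "hnorm (sub H M) = hnorm H"
  by (simp add: hnorm_def fun_eq_iff)

lemma hnorm_nonneg [simp]: "0 \<le> hnorm H x"
  by (simp add: hnorm_def)

lemma hnorm_square: "(hnorm H x)\<^sup>2 = norm (hip H x x)"
  by (simp add: hnorm_def)

text \<open>Carrier membership is built in, because the module laws, and with them the properties of
  \<open>hnorm\<close>, hold only on the carrier.\<close>

definition hlim :: "('a::cstar_algebra, 'h::ab_group_add) hmod \<Rightarrow> (nat \<Rightarrow> 'h) \<Rightarrow> 'h \<Rightarrow> bool" where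
  "hlim H s x \<longleftrightarrow> (\<forall>n. s n \<in> hcar H) \<and> x \<in> hcar H \<and> (\<lambda>n. hnorm H (s n - x)) \<longlonglongrightarrow> 0"

context hilbert_module
begin

lemma hscale_0_left: "x \<in> hcar H \<Longrightarrow> hscale H 0 x = 0"
  by (metis add_cancel_right_right scale_add_left)

lemma hscale_0_right [simp]: "hscale H c 0 = 0"
  by (metis add_cancel_right_right scale_add_right zero_closed)

lemma hscale_minus_one: "x \<in> hcar H \<Longrightarrow> hscale H (-1) x = - x"
  by (metis add.right_inverse hscale_0_left minus_unique scale_add_left scale_one)

lemma minus_closed: "x \<in> hcar H \<Longrightarrow> - x \<in> hcar H"
  by (metis hscale_minus_one scale_closed)

lemma diff_closed: "x \<in> hcar H \<Longrightarrow> y \<in> hcar H \<Longrightarrow> x - y \<in> hcar H"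
  by (metis add_closed add_uminus_conv_diff minus_closed)

lemma hscale_minus: "x \<in> hcar H \<Longrightarrow> hscale H c (- x) = - hscale H c x"
  using scale_add_right[of "- x" x c] by (simp add: minus_closed eq_neg_iff_add_eq_0)

lemma hscale_diff: "x \<in> hcar H \<Longrightarrow> y \<in> hcar H \<Longrightarrow> hscale H c (x - y) = hscale H c x - hscale H c y"
  by (metis add_uminus_conv_diff hscale_minus minus_closed scale_add_right)

lemma ip_0_right [simp]: "x \<in> hcar H \<Longrightarrow> hip H x 0 = 0"
  by (metis add_cancel_right_right ip_add_right zero_closed)

lemma ip_0_left [simp]: "x \<in> hcar H \<Longrightarrow> hip H 0 x = 0"
  by (metis ip_0_right ip_star star_zero zero_closed)

lemma ip_minus_right: "x \<in> hcar H \<Longrightarrow> y \<in> hcar H \<Longrightarrow> hip H x (- y) = - hip H x y"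
  by (metis add.right_inverse ip_0_right ip_add_right minus_closed minus_unique)

lemma ip_diff_right: "x \<in> hcar H \<Longrightarrow> y \<in> hcar H \<Longrightarrow> z \<in> hcar H \<Longrightarrow> hip H x (y - z) = hip H x y - hip H x z"
  by (metis add_uminus_conv_diff ip_add_right ip_minus_right minus_closed)

lemma ip_add_left: "x \<in> hcar H \<Longrightarrow> y \<in> hcar H \<Longrightarrow> z \<in> hcar H \<Longrightarrow> hip H (x + y) z = hip H x z + hip H y z"
  by (simp add: ip_star[of z "x + y"] ip_star[of z x] ip_star[of z y] add_closed ip_add_right star_add)

lemma ip_diff_left: "x \<in> hcar H \<Longrightarrow> y \<in> hcar H \<Longrightarrow> z \<in> hcar H \<Longrightarrow> hip H (x - y) z = hip H x z - hip H y z"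
  by (simp add: ip_star[of z "x - y"] ip_star[of z x] ip_star[of z y] diff_closed ip_diff_right star_diff)

lemma ip_scale_left: "x \<in> hcar H \<Longrightarrow> y \<in> hcar H \<Longrightarrow> hip H (hscale H c x) y = cnj c *\<^sub>C hip H x y"
  by (simp add: ip_star[of y "hscale H c x"] ip_star[of y x] scale_closed ip_scale_right star_scaleC)

lemma ip_act_left: "x \<in> hcar H \<Longrightarrow> y \<in> hcar H \<Longrightarrow> hip H (hact H x a) y = star a * hip H x y"
  by (simp add: ip_star[of y "hact H x a"] ip_star[of y x] act_closed ip_act_right star_mult)

lemma alg_pos_ip: "x \<in> hcar H \<Longrightarrow> alg_pos (hip H x x)"
  by (simp add: cstar_pos_imp_alg_pos ip_pos)

lemma hnorm_0 [simp]: "hnorm H 0 = 0"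
  by (simp add: hnorm_def zero_closed)

lemma hnorm_eq_0: "x \<in> hcar H \<Longrightarrow> hnorm H x = 0 \<longleftrightarrow> x = 0"
  using ip_definite by (auto simp: hnorm_def zero_closed)

lemma hnorm_le_add_pos:
  assumes "x \<in> hcar H" "alg_pos a"
  shows "(hnorm H x)\<^sup>2 \<le> norm (hip H x x + a)"
  unfolding hnorm_square using assms by (intro alg_pos_norm_mono) (simp_all add: alg_pos_ip)

text \<open>Expand positivity of the inner square of \<open>x \<langle>x, y\<rangle> - t y\<close> with \<open>t = \<parallel>x\<parallel>\<^sup>2\<close>.\<close>

lemma Cauchy_Schwarz:
  assumes x: "x \<in> hcar H" and y: "y \<in> hcar H"
  shows "norm (hip H x y) \<le> hnorm H x * hnorm H y"
proof (cases "x = 0")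
  case True
  then show ?thesis using y by simp
next
  case False
  define c where "c = hip H x y"
  define t where "t = norm (hip H x x)"
  have t: "t > 0" using False x ip_definite by (auto simp: t_def)
  define z where "z = hact H x c - hscale H (complex_of_real t) y"
  define q where "q = star c * hip H x x * c + (t * t) *\<^sub>R hip H y y"
  have cs: "hip H y x = star c" unfolding c_def by (rule ip_star[OF x y])
  have "hip H z z = q - (2 * t) *\<^sub>R (star c * c)"
    unfolding z_def q_def using x y
    by (simp add: ip_diff_left ip_diff_right act_closed scale_closed diff_closed ip_act_left
        ip_act_right ip_scale_left ip_scale_right cs c_def[symmetric] mult.assoc)
      (simp add: algebra_simps scaleR_2 mult_scaleC_left mult_scaleC_right
        flip: scaleR_scaleC scaleR_scaleR)
  then have "alg_pos (q - (2 * t) *\<^sub>R (star c * c))"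
    by (metis alg_pos_ip z_def act_closed diff_closed scale_closed x y)
  moreover have "(2 * t) *\<^sub>R (star c * c) = star (sqrt (2 * t) *\<^sub>R c) * (sqrt (2 * t) *\<^sub>R c)"
    using t by (simp add: star_scaleR)
  then have "alg_pos ((2 * t) *\<^sub>R (star c * c))" by (metis alg_pos_star_mult_self)
  \<comment> \<open>Of the order relation only the comparison of norms is kept. The triangle
    inequality for \<open>q\<close> then costs one copy of \<open>t * (norm c)^2\<close>, and the
    factor 2 leaves another.\<close>
  ultimately have "norm ((2 * t) *\<^sub>R (star c * c)) \<le> norm q" using alg_pos_norm_mono by blast
  then have "2 * t * (norm c)\<^sup>2 \<le> norm q" using t by (simp add: cstar_identity)
  also have "norm q \<le> norm c * t * norm c + t * t * norm (hip H y y)"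
    unfolding q_def
  proof (rule norm_triangle_le, rule add_mono)
    have "norm (star c * hip H x x) \<le> norm c * t" using norm_mult_ineq[of "star c"] by (simp add: t_def)
    then show "norm (star c * hip H x x * c) \<le> norm c * t * norm c"
      by (meson mult_right_mono norm_ge_zero norm_mult_ineq order_trans)
  qed simp
  finally have "t * (norm c)\<^sup>2 \<le> t * (t * norm (hip H y y))"
    by (simp add: power2_eq_square algebra_simps)
  then have "(norm c)\<^sup>2 \<le> t * norm (hip H y y)" using t by simp
  also have "\<dots> = (hnorm H x * hnorm H y)\<^sup>2" by (simp add: t_def hnorm_square power_mult_distrib)
  finally show ?thesis unfolding c_def by (rule power2_le_imp_le) simp
qed

lemma hnorm_triangle:
  assumes x: "x \<in> hcar H" and y: "y \<in> hcar H"
  shows "hnorm H (x + y) \<le> hnorm H x + hnorm H y"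
proof (rule power2_le_imp_le)
  have "(hnorm H (x + y))\<^sup>2 = norm (hip H x x + hip H y x + (hip H x y + hip H y y))"
    using x y by (simp add: hnorm_square ip_add_left ip_add_right add_closed)
  also have "\<dots> \<le> (hnorm H x)\<^sup>2 + hnorm H y * hnorm H x + (hnorm H x * hnorm H y + (hnorm H y)\<^sup>2)"
    unfolding hnorm_square using x y by (intro norm_triangle_mono Cauchy_Schwarz) auto
  finally show "(hnorm H (x + y))\<^sup>2 \<le> (hnorm H x + hnorm H y)\<^sup>2"
    by (simp add: power2_eq_square algebra_simps)
qed simp

lemma hnorm_scale: "x \<in> hcar H \<Longrightarrow> hnorm H (hscale H c x) = cmod c * hnorm H x"
  by (simp add: hnorm_def ip_scale_left ip_scale_right scale_closed norm_scaleC real_sqrt_mult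
      flip: mult.assoc)

lemma hnorm_minus: "x \<in> hcar H \<Longrightarrow> hnorm H (- x) = hnorm H x"
  by (metis hnorm_scale hscale_minus_one norm_minus_cancel norm_one mult_1)

lemma hnorm_diff_commute: "x \<in> hcar H \<Longrightarrow> y \<in> hcar H \<Longrightarrow> hnorm H (x - y) = hnorm H (y - x)"
  by (metis diff_closed hnorm_minus minus_diff_eq)

lemma hnorm_diff_triangle:
  "x \<in> hcar H \<Longrightarrow> y \<in> hcar H \<Longrightarrow> z \<in> hcar H \<Longrightarrow> hnorm H (x - z) \<le> hnorm H (x - y) + hnorm H (y - z)"
  using hnorm_triangle[of "x - y" "y - z"] by (simp add: diff_closed)

lemma hnorm_triangle_diff:
  "x \<in> hcar H \<Longrightarrow> y \<in> hcar H \<Longrightarrow> hnorm H (x - y) \<le> hnorm H x + hnorm H y"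
  by (metis add_uminus_conv_diff hnorm_minus hnorm_triangle minus_closed)

lemma ip_eq_imp_eq:
  assumes "x \<in> hcar H" "y \<in> hcar H" "\<And>z. z \<in> hcar H \<Longrightarrow> hip H z x = hip H z y"
  shows "x = y"
proof -
  have "hip H (x - y) (x - y) = 0" using assms by (simp add: ip_diff_right diff_closed)
  then show ?thesis using ip_definite[of "x - y"] assms diff_closed by auto
qed

subsection \<open>Limits\<close>

text \<open>Stated for subsets, so that one proof serves the module itself, via
  \<open>sub_hcar\<close>, and its submodules.\<close>

lemma Metric_space_sub:
  assumes "M \<subseteq> hcar H"
  shows "Metric_space M (hdist (sub H M))"
proof
  show "0 \<le> hdist (sub H M) x y" for x y by (simp add: hdist_def)
  show "hdist (sub H M) x y = hdist (sub H M) y x" for x y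
    using assms hnorm_diff_commute by (auto simp: hdist_def)
  show "hdist (sub H M) x y = 0 \<longleftrightarrow> x = y" if "x \<in> M" "y \<in> M" for x y
    using that assms hnorm_eq_0 diff_closed by (auto simp: hdist_def subset_iff)
  show "hdist (sub H M) x z \<le> hdist (sub H M) x y + hdist (sub H M) y z"
    if "x \<in> M" "y \<in> M" "z \<in> M" for x y z
    using that assms hnorm_diff_triangle by (auto simp: hdist_def subset_iff)
qed

lemma sub_hcar: "sub H (hcar H) = H"
  by (simp add: sub_def)

sublocale metric: Metric_space "hcar H" "hdist H"
  using Metric_space_sub[of "hcar H"] by (simp add: sub_hcar)

lemma Cauchy_imp_hlim:
  assumes "\<And>n. s n \<in> hcar H"
    and "\<And>e. e > 0 \<Longrightarrow> \<exists>N. \<forall>m\<ge>N. \<forall>n\<ge>N. hnorm H (s m - s n) < e"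
  obtains x where "hlim H s x"
proof -
  have "metric.MCauchy s"
    unfolding metric.MCauchy_def using assms by (auto simp: hdist_def)
  then obtain x where "limitin metric.mtopology s x sequentially"
    using complete metric.mcomplete_def by blast
  then have "x \<in> hcar H" "((\<lambda>n. hdist H (s n) x) \<longlongrightarrow> 0) sequentially"
    by (auto simp: metric.limitin_metric_dist_null)
  then have "hlim H s x" using assms(1) by (simp add: hlim_def hdist_def)
  then show ?thesis using that by blast
qed

text \<open>The limit keeps the rate \<open>d\<close>; later this makes pointwise limits of
  operators uniform on bounded sets.\<close>

lemma hlim_bound_Cauchy:
  assumes s: "\<And>n. s n \<in> hcar H" and d: "d \<longlonglongrightarrow> 0"
    and le: "\<And>m n. m \<le> n \<Longrightarrow> hnorm H (s n - s m) \<le> d m"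
  obtains x where "hlim H s x" "\<And>m. hnorm H (s m - x) \<le> d m"
proof -
  have "\<exists>N. \<forall>m\<ge>N. \<forall>n\<ge>N. hnorm H (s m - s n) < e" if e: "e > 0" for e
  proof -
    from d e obtain N where N: "\<And>n. n \<ge> N \<Longrightarrow> \<bar>d n\<bar> < e"
      using LIMSEQ_D[OF d e] by auto
    have "hnorm H (s m - s n) < e" if "m \<ge> N" "n \<ge> N" for m n
    proof (cases "m \<le> n")
      case True
      then show ?thesis using le[OF True] N[of m] that hnorm_diff_commute[OF s s, of m n] by linarith
    next
      case False
      then have "n \<le> m" by simp
      then show ?thesis using le[of n m] N[of n] that by linarith
    qed
    then show ?thesis by blast
  qed
  with s obtain x where x: "hlim H s x" using Cauchy_imp_hlim by blast
  have "hnorm H (s m - x) \<le> d m" for m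
  proof (rule LIMSEQ_le_const)
    have lim: "(\<lambda>n. hnorm H (s n - x)) \<longlonglongrightarrow> 0" using x by (simp add: hlim_def)
    show "(\<lambda>n. hnorm H (s n - x) + d m) \<longlonglongrightarrow> d m" using tendsto_add[OF lim tendsto_const] by simp
    show "\<exists>N. \<forall>n\<ge>N. hnorm H (s m - x) \<le> hnorm H (s n - x) + d m"
    proof (intro exI allI impI)
      fix n assume "m \<le> n"
      have "x \<in> hcar H" using x by (simp add: hlim_def)
      then show "hnorm H (s m - x) \<le> hnorm H (s n - x) + d m"
        using le[OF \<open>m \<le> n\<close>] hnorm_diff_triangle[OF s[of m] s[of n], of x]
          hnorm_diff_commute[OF s s, of m n] by simp
    qed
  qed
  with x that show ?thesis by blast
qed

lemma hlim_unique:
  assumes "hlim H s x" "hlim H s y"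
  shows "x = y"
proof -
  have "(\<lambda>n. hnorm H (s n - x) + hnorm H (s n - y)) \<longlonglongrightarrow> 0"
    using assms by (intro tendsto_add_zero) (simp_all add: hlim_def)
  moreover have "hnorm H (x - y) \<le> hnorm H (s n - x) + hnorm H (s n - y)" for n
    using assms hnorm_diff_triangle[of x "s n" y] hnorm_diff_commute[of x "s n"] by (simp add: hlim_def)
  ultimately have "hnorm H (x - y) \<le> 0" by (intro LIMSEQ_le_const) auto
  then show ?thesis
    using assms hnorm_eq_0[of "x - y"] hnorm_nonneg[of H "x - y"] diff_closed
    by (auto simp: hlim_def simp del: hnorm_nonneg)
qed

lemma hlim_ip:
  assumes "hlim H s x" "hlim H t y"
  shows "(\<lambda>n. hip H (s n) (t n)) \<longlonglongrightarrow> hip H x y"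
proof (rule LIM_zero_cancel, rule Lim_null_comparison)
  have c: "s n \<in> hcar H" "t n \<in> hcar H" "x \<in> hcar H" "y \<in> hcar H" for n
    using assms by (auto simp: hlim_def)
  have "norm (hip H (s n) (t n) - hip H x y)
      \<le> hnorm H (s n - x) * hnorm H (t n - y) + hnorm H (s n - x) * hnorm H y + hnorm H x * hnorm H (t n - y)" for n
  proof -
    have "hip H (s n) (t n) - hip H x y
        = hip H (s n - x) (t n - y) + hip H (s n - x) y + hip H x (t n - y)"
      using c by (simp add: ip_diff_left ip_diff_right diff_closed)
    then show ?thesis
      by (simp only:) (intro norm_triangle_mono Cauchy_Schwarz c diff_closed)
  qed
  then show "\<forall>\<^sub>F n in sequentially. norm (hip H (s n) (t n) - hip H x y)
      \<le> hnorm H (s n - x) * hnorm H (t n - y) + hnorm H (s n - x) * hnorm H y + hnorm H x * hnorm H (t n - y)"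
    by simp
  have "(\<lambda>n. hnorm H (s n - x)) \<longlonglongrightarrow> 0" "(\<lambda>n. hnorm H (t n - y)) \<longlonglongrightarrow> 0"
    using assms by (auto simp: hlim_def)
  then show "(\<lambda>n. hnorm H (s n - x) * hnorm H (t n - y) + hnorm H (s n - x) * hnorm H y
      + hnorm H x * hnorm H (t n - y)) \<longlonglongrightarrow> 0"
    by (intro tendsto_add_zero tendsto_mult_zero tendsto_mult_left_zero tendsto_mult_right_zero)
qed

lemma hlim_const: "x \<in> hcar H \<Longrightarrow> hlim H (\<lambda>n. x) x"
  by (simp add: hlim_def)

lemma hlimI_bound:
  assumes "\<And>n. s n \<in> hcar H" "x \<in> hcar H" "\<And>n. hnorm H (s n - x) \<le> d n" "d \<longlonglongrightarrow> 0"
  shows "hlim H s x"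
  using assms Lim_null_comparison[of "\<lambda>n. hnorm H (s n - x)" d sequentially] by (simp add: hlim_def)

lemma hlim_add:
  assumes "hlim H s x" "hlim H t y"
  shows "hlim H (\<lambda>n. s n + t n) (x + y)"
proof (rule hlimI_bound)
  show "hnorm H (s n + t n - (x + y)) \<le> hnorm H (s n - x) + hnorm H (t n - y)" for n
    using assms hnorm_triangle[of "s n - x" "t n - y"] by (simp add: hlim_def diff_closed algebra_simps)
  show "(\<lambda>n. hnorm H (s n - x) + hnorm H (t n - y)) \<longlonglongrightarrow> 0"
    using assms by (intro tendsto_add_zero) (simp_all add: hlim_def)
qed (use assms in \<open>auto simp: hlim_def add_closed\<close>)

lemma hlim_Suc: "hlim H s x \<Longrightarrow> hlim H (\<lambda>n. s (Suc n)) x"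
  using LIMSEQ_Suc[of "\<lambda>n. hnorm H (s n - x)"] by (simp add: hlim_def)

lemma closure_of_iff:
  assumes "S \<subseteq> hcar H"
  shows "x \<in> htopology H closure_of S \<longleftrightarrow> x \<in> hcar H \<and> (\<forall>e>0. \<exists>y\<in>S. hnorm H (x - y) < e)"
  using assms by (auto simp: metric.metric_closure_of hdist_def metric.mball_def) blast+

lemma hlim_in_closure: "hlim H s x \<Longrightarrow> (\<And>n. s n \<in> S) \<Longrightarrow> S \<subseteq> hcar H \<Longrightarrow> x \<in> htopology H closure_of S"
  unfolding closure_of_iff hlim_def
  by (metis (no_types, lifting) LIMSEQ_D abs_of_nonneg diff_zero hnorm_diff_commute hnorm_nonneg
      order_refl real_norm_def)

lemma in_closureE:
  assumes "x \<in> htopology H closure_of S" "S \<subseteq> hcar H"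
  obtains s where "hlim H s x" "\<And>n. s n \<in> S"
proof -
  have "\<forall>n. \<exists>y\<in>S. hnorm H (x - y) < inverse (real (Suc n))" and x: "x \<in> hcar H"
    using assms closure_of_iff by auto
  then obtain s where s: "\<And>n. s n \<in> S" "\<And>n. hnorm H (x - s n) < inverse (real (Suc n))"
    by metis
  have "hlim H s x"
  proof (rule hlimI_bound)
    show "hnorm H (s n - x) \<le> inverse (real (Suc n))" for n
      using s assms(2) x hnorm_diff_commute[of x "s n"] by (metis less_imp_le subsetD)
  qed (use s assms x LIMSEQ_inverse_real_of_nat in auto)
  with s that show ?thesis by blast
qed

lemma closed_submodule_hlim:
  assumes "closed_submodule H M" "hlim H s x" "\<And>n. s n \<in> M"
  shows "x \<in> M"
  using assms hlim_in_closure[of s x M] closure_of_closedin[of "htopology H" M]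
  by (auto simp: closed_submodule_def)

lemma hilbert_module_sub:
  assumes M: "closed_submodule H M"
  shows "hilbert_module (sub H M)"
proof -
  have MH: "x \<in> M \<Longrightarrow> x \<in> hcar H" for x using M by (auto simp: closed_submodule_def)
  interpret M: Metric_space M "hdist (sub H M)" by (rule Metric_space_sub) (use MH in auto)
  have "M.mcomplete" unfolding M.mcomplete_def
  proof safe
    fix s assume s: "M.MCauchy s"
    then have sM: "s n \<in> M" for n by (auto simp: M.MCauchy_def)
    have "\<exists>N. \<forall>m\<ge>N. \<forall>n\<ge>N. hnorm H (s m - s n) < e" if "e > 0" for e
      using s that sM by (auto simp: M.MCauchy_def hdist_def)
    then obtain x where x: "hlim H s x" using Cauchy_imp_hlim sM MH by blast
    then have "x \<in> M" using closed_submodule_hlim M sM by blast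
    then have "limitin M.mtopology s x sequentially"
      using x sM by (simp add: M.limitin_metric_dist_null hlim_def hdist_def)
    then show "\<exists>x. limitin M.mtopology s x sequentially" by blast
  qed
  then show ?thesis
    using M by unfold_locales
      (auto simp: closed_submodule_def MH scale_add_right scale_add_left scale_scale scale_one
        act_add_left act_add_right act_mult scale_act act_scaleC ip_add_right ip_scale_right
        ip_act_right ip_pos ip_definite dest: MH intro: ip_star)
qed

lemma closed_submoduleI:
  assumes "0 \<in> M" "\<And>x y. x \<in> M \<Longrightarrow> y \<in> M \<Longrightarrow> x + y \<in> M" "\<And>c x. x \<in> M \<Longrightarrow> hscale H c x \<in> M"
    "\<And>a x. x \<in> M \<Longrightarrow> hact H x a \<in> M" "M \<subseteq> hcar H" 
    and lim: "\<And>s x. hlim H s x \<Longrightarrow> (\<And>n. s n \<in> M) \<Longrightarrow> x \<in> M"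
  shows "closed_submodule H M"
proof -
  have "htopology H closure_of M \<subseteq> M" using in_closureE[OF _ assms(5)] lim by blast
  then have "closedin (htopology H) M"
    using assms(5) by (simp add: closure_of_subset_eq[symmetric])
  with assms show ?thesis by (auto simp: closed_submodule_def)
qed

lemma closed_submodule_orth:
  assumes "M \<subseteq> hcar H"
  shows "closed_submodule H (orth H M)"
proof (rule closed_submoduleI)
  fix s x assume s: "hlim H s x" "\<And>n. s n \<in> orth H M"
  have "hip H y x = 0" if "y \<in> M" for y
  proof -
    have "(\<lambda>n. hip H y (s n)) \<longlonglongrightarrow> hip H y x"
      using that assms by (intro hlim_ip hlim_const s) auto
    moreover have "(\<lambda>n. hip H y (s n)) = (\<lambda>n. 0)" using s(2) that by (auto simp: orth_def)
    ultimately show ?thesis by (simp add: LIMSEQ_const_iff)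
  qed
  then show "x \<in> orth H M" using s by (auto simp: orth_def hlim_def)
qed (use assms in \<open>auto simp: orth_def zero_closed add_closed scale_closed act_closed
      ip_add_right ip_scale_right ip_act_right subset_iff\<close>)

end

section \<open>Adjointable operators\<close>

text \<open>Naming the adjoint avoids the definite description in \<open>adj\<close>, and
  \<open>swap\<close> makes every fact available for both operators. Linearity and uniqueness of the
  adjoint come from testing against all vectors.\<close>

locale adj_pair = H: hilbert_module H + K: hilbert_module K
  for H :: "('a::cstar_algebra, 'h::ab_group_add) hmod" and K :: "('a, 'k::ab_group_add) hmod"
    and T S +
  assumes maps: "T \<in> maps H K" and maps_adj: "S \<in> maps K H"
    and ip: "x \<in> hcar H \<Longrightarrow> y \<in> hcar K \<Longrightarrow> hip K (T x) y = hip H x (S y)"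
begin

lemma closed: "x \<in> hcar H \<Longrightarrow> T x \<in> hcar K"
  using maps by (simp add: maps_def)

lemma closed_adj: "y \<in> hcar K \<Longrightarrow> S y \<in> hcar H"
  using maps_adj by (simp add: maps_def)

lemma outside: "x \<notin> hcar H \<Longrightarrow> T x = 0"
  using maps by (simp add: maps_def)

lemma ip': "x \<in> hcar H \<Longrightarrow> y \<in> hcar K \<Longrightarrow> hip K y (T x) = hip H (S y) x"
  using ip[of x y] K.ip_star[of "T x" y] H.ip_star[of x "S y"] by (simp add: closed closed_adj)

lemma swap: "adj_pair K H S T"
  by unfold_locales (simp_all add: maps maps_adj ip' )

lemma add: "x \<in> hcar H \<Longrightarrow> y \<in> hcar H \<Longrightarrow> T (x + y) = T x + T y"
  by (rule K.ip_eq_imp_eq)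
    (simp_all add: closed H.add_closed K.add_closed ip' H.ip_add_right K.ip_add_right closed_adj)

lemma diff: "x \<in> hcar H \<Longrightarrow> y \<in> hcar H \<Longrightarrow> T (x - y) = T x - T y"
  by (rule K.ip_eq_imp_eq)
    (simp_all add: closed H.diff_closed K.diff_closed ip' H.ip_diff_right K.ip_diff_right closed_adj)

lemma scale: "x \<in> hcar H \<Longrightarrow> T (hscale H c x) = hscale K c (T x)"
  by (rule K.ip_eq_imp_eq)
    (simp_all add: closed H.scale_closed K.scale_closed ip' H.ip_scale_right K.ip_scale_right closed_adj)

lemma zero: "T 0 = 0"
  using diff[of 0 0] by (simp add: H.zero_closed)

lemma adjoint_unique:
  assumes "is_adjoint H K T S'"
  shows "S' = S"
proof
  fix y
  show "S' y = S y"
  proof (cases "y \<in> hcar K")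
    case True
    then show ?thesis
      using assms by (intro H.ip_eq_imp_eq)
        (auto simp: is_adjoint_def maps_def closed_adj ip[symmetric])
  next
    case False
    then show ?thesis using assms maps_adj by (simp add: is_adjoint_def maps_def)
  qed
qed

lemma is_adjoint: "is_adjoint H K T S"
  by (simp add: is_adjoint_def maps_adj ip)

lemma adj_eq: "adj H K T = S"
  unfolding adj_def using is_adjoint adjoint_unique by blast

lemma adjointable: "T \<in> adjointable H K"
  using maps is_adjoint by (auto simp: adjointable_def)

end

lemma adjointable_imp_adj_pair:
  assumes "hilbert_module H" "hilbert_module K" "T \<in> adjointable H K"
  shows "adj_pair H K T (adj H K T)"
proof -
  interpret H: hilbert_module H by fact
  interpret K: hilbert_module K by fact
  obtain S where "T \<in> maps H K" "is_adjoint H K T S" using assms(3) by (auto simp: adjointable_def)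
  then have "adj_pair H K T S" by unfold_locales (auto simp: is_adjoint_def)
  then show ?thesis using adj_pair.adj_eq by metis
qed

lemma maps_eqI:
  assumes "f \<in> maps H K" "g \<in> maps H K" "\<And>x. x \<in> hcar H \<Longrightarrow> f x = g x"
  shows "f = g"
  using assms by (fastforce simp: maps_def)

section \<open>Algebraic operations on adjoint pairs\<close>

lemma adj_pair_comp:
  assumes "adj_pair H K T S" "adj_pair K L T' S'"
  shows "adj_pair H L (T' \<circ> T) (S \<circ> S')"
proof -
  interpret p: adj_pair H K T S by fact
  interpret q: adj_pair K L T' S' by fact
  interpret r: adj_pair K H S T by (rule p.swap)
  interpret s: adj_pair L K S' T' by (rule q.swap)
  show ?thesis
    by unfold_locales
      (auto simp: maps_def p.closed q.closed p.outside q.zero q.closed_adj p.closed_adj s.outside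
        r.zero p.ip q.ip)
qed

lemma adj_pair_add:
  assumes "adj_pair H K T S" "adj_pair H K T' S'"
  shows "adj_pair H K (\<lambda>x. T x + T' x) (\<lambda>y. S y + S' y)"
proof -
  interpret p: adj_pair H K T S by fact
  interpret q: adj_pair H K T' S' by fact
  show ?thesis
    using p.maps q.maps p.maps_adj q.maps_adj
    by unfold_locales
      (auto simp: maps_def p.H.add_closed p.K.add_closed p.H.ip_add_right p.K.ip_add_left p.ip q.ip)
qed

lemma adj_pair_diff:
  assumes "adj_pair H K T S" "adj_pair H K T' S'"
  shows "adj_pair H K (\<lambda>x. T x - T' x) (\<lambda>y. S y - S' y)"
proof -
  interpret p: adj_pair H K T S by fact
  interpret q: adj_pair H K T' S' by fact
  show ?thesis
    using p.maps q.maps p.maps_adj q.maps_adj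
    by unfold_locales
      (auto simp: maps_def p.H.diff_closed p.K.diff_closed p.H.ip_diff_right p.K.ip_diff_left p.ip q.ip)
qed

lemma adj_pair_scale:
  assumes "adj_pair H K T S"
  shows "adj_pair H K (\<lambda>x. hscale K (complex_of_real r) (T x)) (\<lambda>y. hscale H (complex_of_real r) (S y))"
proof -
  interpret p: adj_pair H K T S by fact
  show ?thesis
    using p.maps p.maps_adj
    by unfold_locales
      (auto simp: maps_def p.H.scale_closed p.K.scale_closed p.H.ip_scale_right p.K.ip_scale_left p.ip)
qed

lemma idop_apply [simp]: "x \<in> hcar H \<Longrightarrow> idop H x = x"
  by (simp add: idop_def restr_def)

lemma adj_pair_idop: "hilbert_module H \<Longrightarrow> adj_pair H H (idop H) (idop H)"
  by (intro adj_pair.intro adj_pair_axioms.intro)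
    (auto simp: maps_def idop_def restr_def)

lemma adj_pair_zero: "hilbert_module H \<Longrightarrow> hilbert_module K \<Longrightarrow> adj_pair H K (\<lambda>x. 0) (\<lambda>y. 0)"
  by (intro adj_pair.intro adj_pair_axioms.intro)
    (auto simp: maps_def hilbert_module.zero_closed hilbert_module.ip_0_left hilbert_module.ip_0_right)

lemma adj_pair_idop_diff: "adj_pair H H T S \<Longrightarrow> adj_pair H H (idop H - T) (idop H - S)"
  unfolding fun_diff_def by (intro adj_pair_diff adj_pair_idop) (auto simp: adj_pair_def)

subsection \<open>Boundedness\<close>

text \<open>An explicit bound takes the place of the operator norm, so that no supremum has to be
  formed.\<close>

definition opbound :: "('a::cstar_algebra, 'h::ab_group_add) hmod \<Rightarrow> ('a, 'k::ab_group_add) hmod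
    \<Rightarrow> ('h \<Rightarrow> 'k) \<Rightarrow> real \<Rightarrow> bool" where
  "opbound H K T c \<longleftrightarrow> 0 \<le> c \<and> (\<forall>x\<in>hcar H. hnorm K (T x) \<le> c * hnorm H x)"

lemma opboundD: "opbound H K T c \<Longrightarrow> x \<in> hcar H \<Longrightarrow> hnorm K (T x) \<le> c * hnorm H x"
  by (simp add: opbound_def)

text \<open>A gliding hump: if \<open>T\<close> is unbounded, choose unit vectors \<open>u n\<close> with \<open>\<parallel>T (u n)\<parallel> > 4\<^sup>n\<close> and
  let \<open>y\<close> be a sum of vectors \<open>\<plusminus> w n\<close> of length \<open>3\<^sup>-\<^sup>n\<close> along \<open>T (u n)\<close>.  Each sign is chosen such
  that the \<open>n\<close>-th partial sum has an inner product of norm at least \<open>3\<^sup>-\<^sup>n \<parallel>T (u n)\<parallel>\<close> with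
  \<open>T (u n)\<close>.  Then \<open>\<langle>T (u n), y\<rangle> = \<langle>u n, S y\<rangle>\<close> is unbounded in \<open>n\<close>.\<close>

lemma (in adj_pair) bounded:
  obtains c where "0 < c" "opbound H K T c"
proof -
  have "\<exists>c>0. opbound H K T c"
  proof (rule ccontr)
    assume neg: "\<not> ?thesis"
    have "\<exists>u. u \<in> hcar H \<and> hnorm H u = 1 \<and> 4 ^ n < hnorm K (T u)" for n :: nat
    proof -
      have "\<not> opbound H K T (4 ^ n)" using neg by auto
      then obtain x where x: "x \<in> hcar H" "4 ^ n * hnorm H x < hnorm K (T x)"
        by (auto simp: opbound_def not_le)
      have "hnorm H x \<noteq> 0" using x H.hnorm_eq_0 zero by auto
      then have pos: "hnorm H x > 0" using hnorm_nonneg[of H x] by linarith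
      let ?u = "hscale H (complex_of_real (1 / hnorm H x)) x"
      have "hnorm H ?u = 1" using x pos by (simp add: H.hnorm_scale norm_divide)
      moreover have "hnorm K (T ?u) = hnorm K (T x) / hnorm H x"
        using x pos by (simp add: scale K.hnorm_scale closed norm_divide)
      moreover have "4 ^ n < hnorm K (T x) / hnorm H x" using x pos by (simp add: field_simps)
      ultimately show ?thesis using x H.scale_closed by metis
    qed
    then obtain u where u: "\<And>n. u n \<in> hcar H" "\<And>n. hnorm H (u n) = 1" "\<And>n. 4 ^ n < hnorm K (T (u n))"
      by metis
    have Tu: "hnorm K (T (u n)) > 0" for n
      using u(3)[of n] by (meson less_trans zero_less_numeral zero_less_power)
    define w where "w n = hscale K (complex_of_real ((1/3) ^ n / hnorm K (T (u n)))) (T (u n))" for n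
    have w: "w n \<in> hcar K" for n by (simp add: w_def K.scale_closed closed u)
    have nw: "hnorm K (w n) = (1/3) ^ n" for n
      using Tu[of n] by (simp add: w_def K.hnorm_scale closed u norm_divide norm_power)
    have ipw: "norm (hip K (T (u n)) (w n)) = (1/3) ^ n * hnorm K (T (u n))" for n
      using Tu[of n]
      by (simp add: w_def K.ip_scale_right closed u norm_scaleC norm_divide norm_power power2_eq_square
          flip: hnorm_square)
    define step where "step n v =
      (if norm (hip K (T (u n)) (v + w n)) \<ge> (1/3) ^ n * hnorm K (T (u n)) then v + w n else v - w n)" for n v
    define y where "y = rec_nat 0 step"
    have y0: "y 0 = 0" and ySuc: "y (Suc n) = step n (y n)" for n by (simp_all add: y_def)
    have y: "y n \<in> hcar K" for n
      by (induction n) (auto simp: y0 ySuc step_def K.zero_closed K.add_closed K.diff_closed w)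
    have big: "norm (hip K (T (u n)) (y (Suc n))) \<ge> (1/3) ^ n * hnorm K (T (u n))" for n
    proof (cases "norm (hip K (T (u n)) (y n + w n)) \<ge> (1/3) ^ n * hnorm K (T (u n))")
      \<comment> \<open>The inner products with \<open>y n + w n\<close> and
        \<open>y n - w n\<close> differ by twice that with \<open>w n\<close>, so if the first falls
        short, the second reaches the bound.\<close>
      case False
      have "2 *\<^sub>R hip K (T (u n)) (w n) = hip K (T (u n)) (y n + w n) - hip K (T (u n)) (y n - w n)"
        by (simp add: K.ip_add_right K.ip_diff_right closed u y w scaleR_2)
      then have "2 * ((1/3) ^ n * hnorm K (T (u n)))
          = norm (hip K (T (u n)) (y n + w n) - hip K (T (u n)) (y n - w n))"
        by (metis ipw norm_scaleR abs_numeral)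
      also have "\<dots> \<le> norm (hip K (T (u n)) (y n + w n)) + norm (hip K (T (u n)) (y n - w n))"
        by (rule norm_triangle_ineq4)
      finally show ?thesis using False by (simp add: ySuc step_def)
    qed (simp add: ySuc step_def)
    have ydiff: "hnorm K (y (Suc n) - y n) = (1/3) ^ n" for n
      by (simp add: ySuc step_def nw w K.hnorm_minus)
    \<comment> \<open>The bound is the geometric sum of \<open>(1/3) ^ k\<close> over
      \<open>m <= k < n\<close>.\<close>
    have ytel: "hnorm K (y n - y m) \<le> 3/2 * (1/3) ^ m - 3/2 * (1/3) ^ n" if "m \<le> n" for m n
      using that
    proof (induction n rule: dec_induct)
      case (step n)
      then show ?case
        using K.hnorm_diff_triangle[of "y (Suc n)" "y n" "y m"] ydiff[of n] y by simp
    qed simp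
    have lim0: "(\<lambda>n. 3/2 * (1/3::real) ^ n) \<longlonglongrightarrow> 0"
      by (rule tendsto_mult_right_zero) (simp add: LIMSEQ_power_zero)
    obtain v where v: "hlim K y v" "\<And>m. hnorm K (y m - v) \<le> 3/2 * (1/3) ^ m"
    proof (rule K.hlim_bound_Cauchy[OF y lim0])
      show "hnorm K (y n - y m) \<le> 3/2 * (1/3) ^ m" if "m \<le> n" for m n
        using ytel[OF that] by (rule order_trans) simp
    qed blast
    have vK: "v \<in> hcar K" using v by (simp add: hlim_def)
    \<comment> \<open>Replacing \<open>y (Suc n)\<close> by \<open>v\<close> costs at most
      \<open>3/2 * (1/3) ^ Suc n\<close>, that is half of \<open>(1/3) ^ n\<close>, times the norm
      of \<open>T (u n)\<close>. Half of the lower bound \<open>big\<close> survives, and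
      \<open>4 ^ n\<close> outgrows \<open>3 ^ n\<close>.\<close>
    have "(4/3) ^ n \<le> 2 * hnorm H (S v)" for n :: nat
    proof -
      have "hip K (T (u n)) (y (Suc n)) = hip K (T (u n)) (y (Suc n) - v) + hip K (T (u n)) v"
        by (simp add: K.ip_diff_right closed u y vK)
      then have "norm (hip K (T (u n)) (y (Suc n)))
          \<le> norm (hip K (T (u n)) (y (Suc n) - v)) + norm (hip K (T (u n)) v)"
        by (metis norm_triangle_ineq)
      also have "norm (hip K (T (u n)) (y (Suc n) - v)) \<le> hnorm K (T (u n)) * hnorm K (y (Suc n) - v)"
        by (intro K.Cauchy_Schwarz closed u K.diff_closed y vK)
      also have "\<dots> \<le> hnorm K (T (u n)) * (3/2 * (1/3) ^ Suc n)"
        by (intro mult_left_mono v) simp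
      also have "norm (hip K (T (u n)) v) \<le> hnorm H (u n) * hnorm H (S v)"
        unfolding ip[OF u(1) vK] by (intro H.Cauchy_Schwarz u closed_adj vK)
      finally have "(1/3) ^ n * hnorm K (T (u n)) \<le> (1/3) ^ n * hnorm K (T (u n)) / 2 + hnorm H (S v)"
        using big[of n] u(2)[of n] by (simp add: mult.commute)
      then have "(1/3) ^ n * hnorm K (T (u n)) \<le> 2 * hnorm H (S v)" by simp
      moreover have "(4/3) ^ n = (1/3) ^ n * (4::real) ^ n" by (simp add: power_divide)
      moreover have "(1/3) ^ n * (4::real) ^ n \<le> (1/3) ^ n * hnorm K (T (u n))"
        using u(3)[of n] by (intro mult_left_mono) auto
      ultimately show ?thesis by linarith
    qed
    moreover obtain n where "(4/3) ^ n > 2 * hnorm H (S v)"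
      using real_arch_pow[of "4/3"] by auto
    ultimately show False by (meson not_le)
  qed
  then show ?thesis using that by blast
qed

text \<open>The squared norm of \<open>S y\<close> is the norm of the inner product of
  \<open>T (S y)\<close> with \<open>y\<close>; Cauchy-Schwarz and division by the norm of
  \<open>S y\<close> finish.\<close>

lemma (in adj_pair) opbound_adj:
  assumes "opbound H K T c"
  shows "opbound K H S c"
  unfolding opbound_def
proof (intro conjI ballI)
  show "0 \<le> c" using assms by (simp add: opbound_def)
  fix y assume y: "y \<in> hcar K"
  have "hnorm H (S y) * hnorm H (S y) = norm (hip K (T (S y)) y)"
    using y by (simp add: ip closed_adj power2_eq_square[symmetric] hnorm_square)
  also have "\<dots> \<le> hnorm K (T (S y)) * hnorm K y"
    using y by (intro K.Cauchy_Schwarz closed closed_adj)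
  also have "\<dots> \<le> c * hnorm H (S y) * hnorm K y"
    using assms y by (intro mult_right_mono opboundD) (auto simp: closed_adj)
  finally have "hnorm H (S y) * hnorm H (S y) \<le> hnorm H (S y) * (c * hnorm K y)"
    by (simp add: mult_ac)
  then show "hnorm H (S y) \<le> c * hnorm K y"
    using \<open>0 \<le> c\<close> hnorm_nonneg[of H "S y"]
    by (cases "hnorm H (S y) = 0") (auto simp: less_le)
qed

lemma opbound_comp:
  assumes "adj_pair H K T S" "opbound H K T c" "opbound K L T' d"
  shows "opbound H L (T' \<circ> T) (d * c)"
proof -
  interpret adj_pair H K T S by fact
  show ?thesis
    unfolding opbound_def
  proof (intro conjI ballI)
    show "0 \<le> d * c" using assms by (simp add: opbound_def)
    fix x assume x: "x \<in> hcar H"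
    have "hnorm L (T' (T x)) \<le> d * hnorm K (T x)" using x closed by (intro opboundD[OF assms(3)])
    also have "\<dots> \<le> d * (c * hnorm H x)"
      using assms x by (intro mult_left_mono opboundD) (auto simp: opbound_def)
    finally show "hnorm L ((T' \<circ> T) x) \<le> d * c * hnorm H x" by (simp add: mult.assoc)
  qed
qed

lemma (in adj_pair) hlim_op:
  assumes "hlim H s x"
  shows "hlim K (\<lambda>n. T (s n)) (T x)"
proof -
  obtain c where c: "opbound H K T c" using bounded by blast
  show ?thesis
  proof (rule K.hlimI_bound)
    show "hnorm K (T (s n) - T x) \<le> c * hnorm H (s n - x)" for n
      using assms opboundD[OF c, of "s n - x"] by (simp add: hlim_def diff H.diff_closed)
    show "(\<lambda>n. c * hnorm H (s n - x)) \<longlonglongrightarrow> 0"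
      using assms by (intro tendsto_mult_right_zero) (simp add: hlim_def)
  qed (use assms in \<open>auto simp: hlim_def closed\<close>)
qed

text \<open>The bound on differences passes to the adjoints with the same constant, so both
  sequences converge, and continuity of the inner product keeps the limits adjoint to each
  other.\<close>

lemma adj_pair_limit:
  assumes hm: "hilbert_module H" "hilbert_module K"
    and p: "\<And>n. adj_pair H K (V n) (W n)"
    and d: "d \<longlonglongrightarrow> 0" "\<And>m. 0 \<le> d m"
    and le: "\<And>m n x. m \<le> n \<Longrightarrow> x \<in> hcar H \<Longrightarrow> hnorm K (V n x - V m x) \<le> d m * hnorm H x"
  obtains T S where "adj_pair H K T S" "\<And>x. x \<in> hcar H \<Longrightarrow> hlim K (\<lambda>n. V n x) (T x)"
    "\<And>y. y \<in> hcar K \<Longrightarrow> hlim H (\<lambda>n. W n y) (S y)"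
    "\<And>m x. x \<in> hcar H \<Longrightarrow> hnorm K (V m x - T x) \<le> d m * hnorm H x"
proof -
  interpret H: hilbert_module H by fact
  interpret K: hilbert_module K by fact
  have bd: "opbound H K (\<lambda>x. V n x - V m x) (d m)" if "m \<le> n" for m n
    using le[OF that] d by (simp add: opbound_def)
  have bd': "opbound K H (\<lambda>y. W n y - W m y) (d m)" if "m \<le> n" for m n
    by (rule adj_pair.opbound_adj[OF adj_pair_diff[OF p p] bd[OF that]])
  have lim: "(\<lambda>n. d n * c) \<longlonglongrightarrow> 0" for c using d(1) by (rule tendsto_mult_left_zero)
  have "\<exists>v. hlim K (\<lambda>n. V n x) v \<and> (\<forall>m. hnorm K (V m x - v) \<le> d m * hnorm H x)" if x: "x \<in> hcar H" for x
    using K.hlim_bound_Cauchy[of "\<lambda>n. V n x" "\<lambda>n. d n * hnorm H x"] lim le x adj_pair.closed[OF p x]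
    by metis
  then obtain t where t: "\<And>x. x \<in> hcar H \<Longrightarrow> hlim K (\<lambda>n. V n x) (t x)"
    "\<And>x m. x \<in> hcar H \<Longrightarrow> hnorm K (V m x - t x) \<le> d m * hnorm H x" by metis
  have "\<exists>v. hlim H (\<lambda>n. W n y) v" if y: "y \<in> hcar K" for y
    using H.hlim_bound_Cauchy[of "\<lambda>n. W n y" "\<lambda>n. d n * hnorm K y"] lim opboundD[OF bd' y] 
      adj_pair.closed_adj[OF p y] by metis
  then obtain s where s: "\<And>y. y \<in> hcar K \<Longrightarrow> hlim H (\<lambda>n. W n y) (s y)" by metis
  \<comment> \<open>The pointwise limits were chosen on the carriers only; \<open>restr\<close>
    supplies the value 0 elsewhere that \<open>maps\<close> demands.\<close>
  have "adj_pair H K (restr (hcar H) t) (restr (hcar K) s)"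
  proof
    show "restr (hcar H) t \<in> maps H K" "restr (hcar K) s \<in> maps K H"
      using s t by (auto simp: maps_def restr_def hlim_def)
    fix x y assume x: "x \<in> hcar H" and y: "y \<in> hcar K"
    have "(\<lambda>n. hip K (V n x) y) \<longlonglongrightarrow> hip K (t x) y" by (intro K.hlim_ip t x K.hlim_const y)
    moreover have "(\<lambda>n. hip H x (W n y)) \<longlonglongrightarrow> hip H x (s y)" by (intro H.hlim_ip s x H.hlim_const y)
    moreover have "(\<lambda>n. hip K (V n x) y) = (\<lambda>n. hip H x (W n y))"
      using adj_pair.ip[OF p x y] by auto
    ultimately have "hip K (t x) y = hip H x (s y)" using LIMSEQ_unique by auto
    then show "hip K (restr (hcar H) t x) y = hip H x (restr (hcar K) s y)"
      using x y by (simp add: restr_def)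
  qed
  then show ?thesis using that[of "restr (hcar H) t" "restr (hcar K) s"] t s by (simp add: restr_def)
qed

section \<open>Square roots of positive operators\<close>

fun op_sqrt_iter :: "('a::cstar_algebra, 'h::ab_group_add) hmod \<Rightarrow> ('h \<Rightarrow> 'h) \<Rightarrow> nat \<Rightarrow> 'h \<Rightarrow> 'h" where
  "op_sqrt_iter H X 0 = (\<lambda>x. 0)"
| "op_sqrt_iter H X (Suc n) =
    (\<lambda>x. hscale H (complex_of_real (1/2)) (X x + op_sqrt_iter H X n (op_sqrt_iter H X n x)))"

lemma adj_pair_op_sqrt_iter:
  assumes "adj_pair H H X X"
  shows "adj_pair H H (op_sqrt_iter H X n) (op_sqrt_iter H X n)"
proof (induction n)
  case 0
  show ?case
    unfolding op_sqrt_iter.simps by (rule adj_pair_zero) (use assms in \<open>simp_all add: adj_pair_def\<close>)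
next
  case (Suc n)
  show ?case
    unfolding op_sqrt_iter.simps
    by (rule adj_pair_scale[OF adj_pair_add[OF assms adj_pair_comp[OF Suc Suc, unfolded comp_def]]])
qed

lemma opbound_op_sqrt_iter:
  assumes p: "adj_pair H H X X" and b: "opbound H H X 1"
  shows "opbound H H (op_sqrt_iter H X n) (majorant n)"
proof (induction n)
  case 0
  interpret hilbert_module H using p by (simp add: adj_pair_def)
  show ?case by (simp add: opbound_def)
next
  case (Suc n)
  interpret hilbert_module H using p by (simp add: adj_pair_def)
  note q = adj_pair_op_sqrt_iter[OF p, of n]
  have "hnorm H (op_sqrt_iter H X (Suc n) x) \<le> majorant (Suc n) * hnorm H x" if x: "x \<in> hcar H" for x
  proof -
    have "hnorm H (X x + op_sqrt_iter H X n (op_sqrt_iter H X n x))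
        \<le> hnorm H (X x) + hnorm H (op_sqrt_iter H X n (op_sqrt_iter H X n x))"
      by (intro hnorm_triangle adj_pair.closed[OF p] adj_pair.closed[OF q] x)
    also have "\<dots> \<le> 1 * hnorm H x + majorant n * majorant n * hnorm H x"
      using opboundD[OF b x] opboundD[OF opbound_comp[OF q Suc Suc] x] by simp
    finally show ?thesis
      using x by (simp add: hnorm_scale add_closed adj_pair.closed[OF p] adj_pair.closed[OF q] norm_divide
          algebra_simps)
  qed
  then show ?case using majorant_bounds[of "Suc n"] by (simp add: opbound_def del: op_sqrt_iter.simps)
qed

text \<open>With consecutive iterates \<open>b\<close> and \<open>c\<close>, the splitting
  \<open>b b x - c c x = b (b x - c x) + (b - c) (c x)\<close> holds without commutation. The
  induction hypothesis is used at \<open>x\<close> and at \<open>c x\<close>, hence the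
  generalization over \<open>x\<close>.\<close>

lemma op_sqrt_iter_Suc_diff:
  assumes p: "adj_pair H H X X" and b: "opbound H H X 1" and x: "x \<in> hcar H"
  shows "hnorm H (op_sqrt_iter H X (Suc n) x - op_sqrt_iter H X n x)
    \<le> (majorant (Suc n) - majorant n) * hnorm H x"
  using x
proof (induction n arbitrary: x)
  case 0
  interpret hilbert_module H using p by (simp add: adj_pair_def)
  show ?case using opboundD[OF b 0] by (simp add: hnorm_scale adj_pair.closed[OF p] 0 norm_divide)
next
  case (Suc n)
  interpret hilbert_module H using p by (simp add: adj_pair_def)
  let ?b = "op_sqrt_iter H X (Suc n)" and ?c = "op_sqrt_iter H X n"
  note qb = adj_pair_op_sqrt_iter[OF p, of "Suc n"] and qc = adj_pair_op_sqrt_iter[OF p, of n]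
  note cl = adj_pair.closed[OF p] adj_pair.closed[OF qb] adj_pair.closed[OF qc]
  define e where "e = ?b x - ?c x"
  have e: "e \<in> hcar H" by (simp only: e_def diff_closed cl Suc.prems)
  have eq: "op_sqrt_iter H X (Suc (Suc n)) x - ?b x
      = hscale H (complex_of_real (1/2)) (?b e + (?b (?c x) - ?c (?c x)))"
  proof -
    have "op_sqrt_iter H X (Suc (Suc n)) x - ?b x
      = hscale H (complex_of_real (1/2)) (X x + ?b (?b x)) - hscale H (complex_of_real (1/2)) (X x + ?c (?c x))"
      by (intro arg_cong2[where f="(-)"] fun_cong[OF op_sqrt_iter.simps(2)])
    also have "\<dots> = hscale H (complex_of_real (1/2)) ((X x + ?b (?b x)) - (X x + ?c (?c x)))"
      by (intro hscale_diff[symmetric] add_closed cl Suc.prems)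
    also have "(X x + ?b (?b x)) - (X x + ?c (?c x)) = ?b e + (?b (?c x) - ?c (?c x))"
      unfolding e_def adj_pair.diff[OF qb cl(2) cl(3), OF Suc.prems Suc.prems] by simp
    finally show ?thesis .
  qed
  have "hnorm H (?b e + (?b (?c x) - ?c (?c x))) \<le> hnorm H (?b e) + hnorm H (?b (?c x) - ?c (?c x))"
    by (intro hnorm_triangle diff_closed cl Suc.prems e)
  also have "hnorm H (?b e) \<le> majorant (Suc n) * hnorm H e"
    by (rule opboundD[OF opbound_op_sqrt_iter[OF p b] e])
  also have "\<dots> \<le> majorant (Suc n) * ((majorant (Suc n) - majorant n) * hnorm H x)"
    unfolding e_def using majorant_bounds by (intro mult_left_mono Suc.IH Suc.prems) blast
  also have "hnorm H (?b (?c x) - ?c (?c x)) \<le> (majorant (Suc n) - majorant n) * hnorm H (?c x)"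
    by (intro Suc.IH cl Suc.prems)
  also have "\<dots> \<le> (majorant (Suc n) - majorant n) * (majorant n * hnorm H x)"
    using majorant_mono_Suc[of n]
    by (intro mult_left_mono opboundD[OF opbound_op_sqrt_iter[OF p b] Suc.prems]) simp
  finally have "hnorm H (?b e + (?b (?c x) - ?c (?c x)))
      \<le> 2 * ((majorant (Suc (Suc n)) - majorant (Suc n)) * hnorm H x)"
    by (simp only: majorant.simps(2)[of "Suc n"] majorant.simps(2)[of n]) (simp add: field_simps)
  moreover have "?b e + (?b (?c x) - ?c (?c x)) \<in> hcar H" by (intro add_closed diff_closed cl Suc.prems e)
  ultimately show ?case unfolding eq by (simp add: hnorm_scale norm_divide del: op_sqrt_iter.simps majorant.simps)
qed

text \<open>Intertwining generalizes commuting: with \<open>Z\<close> between two modules, roots on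
  one are carried to roots on the other, as \<open>V_op_factorization\<close> requires.\<close>

lemma op_sqrt_iter_intertwine:
  assumes p: "adj_pair H H X X" and q: "adj_pair K K Y Y" and z: "adj_pair H K Z Z'"
    and ZX: "\<And>x. x \<in> hcar H \<Longrightarrow> Z (X x) = Y (Z x)" and x: "x \<in> hcar H"
  shows "Z (op_sqrt_iter H X n x) = op_sqrt_iter K Y n (Z x)"
  using x
proof (induction n arbitrary: x)
  case 0
  then show ?case by (simp add: adj_pair.zero[OF z])
next
  case (Suc n)
  interpret hilbert_module H using p by (simp add: adj_pair_def)
  note q = adj_pair_op_sqrt_iter[OF p, of n]
  show ?case
    using Suc by (simp add: adj_pair.scale[OF z] adj_pair.add[OF z] add_closed adj_pair.closed[OF p]
        adj_pair.closed[OF q] ZX)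
qed

lemma op_sqrt_iter_limit:
  assumes p: "adj_pair H H X X" and b: "opbound H H X 1"
  obtains B where "adj_pair H H B B" "opbound H H B 1"
    "\<And>x. x \<in> hcar H \<Longrightarrow> hlim H (\<lambda>n. op_sqrt_iter H X n x) (B x)"
    "\<And>x. x \<in> hcar H \<Longrightarrow> B x + B x = X x + B (B x)"
proof -
  interpret hilbert_module H using p by (simp add: adj_pair_def)
  obtain l where l: "majorant \<longlonglongrightarrow> l" using majorant_convergent by (auto simp: convergent_def)
  have mono: "m \<le> n \<Longrightarrow> majorant m \<le> majorant n" for m n
    using lift_Suc_mono_le[of majorant] majorant_mono_Suc by blast
  have ml: "majorant n \<le> l" for n
    by (rule LIMSEQ_le_const[OF l]) (use mono in blast)
  define d where "d m = l - majorant m" for m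
  have d: "d \<longlonglongrightarrow> 0" unfolding d_def using tendsto_diff[OF tendsto_const l, of l] by simp
  have d0: "0 \<le> d m" for m using ml by (simp add: d_def)
  note q = adj_pair_op_sqrt_iter[OF p]
  have tel: "hnorm H (op_sqrt_iter H X n x - op_sqrt_iter H X m x) \<le> (majorant n - majorant m) * hnorm H x"
    if "m \<le> n" "x \<in> hcar H" for m n x
    using that(1)
  proof (induction n rule: dec_induct)
    case (step n)
    then show ?case
      using hnorm_diff_triangle[of "op_sqrt_iter H X (Suc n) x" "op_sqrt_iter H X n x" "op_sqrt_iter H X m x"]
        op_sqrt_iter_Suc_diff[OF p b that(2), of n] adj_pair.closed[OF q that(2)]
      by (simp add: left_diff_distrib del: op_sqrt_iter.simps majorant.simps)
  qed simp
  have le: "hnorm H (op_sqrt_iter H X n x - op_sqrt_iter H X m x) \<le> d m * hnorm H x"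
    if "m \<le> n" "x \<in> hcar H" for m n x
    using tel[OF that] by (rule order_trans) (simp add: d_def ml mult_right_mono)
  obtain B B' where B: "adj_pair H H B B'"
    and lim: "\<And>x. x \<in> hcar H \<Longrightarrow> hlim H (\<lambda>n. op_sqrt_iter H X n x) (B x)"
    and lim': "\<And>x. x \<in> hcar H \<Longrightarrow> hlim H (\<lambda>n. op_sqrt_iter H X n x) (B' x)"
    and dist: "\<And>m x. x \<in> hcar H \<Longrightarrow> hnorm H (op_sqrt_iter H X m x - B x) \<le> d m * hnorm H x"
    using adj_pair_limit[OF hilbert_module_axioms hilbert_module_axioms q d d0 le] by metis
  have "B' = B"
    by (rule maps_eqI[OF adj_pair.maps_adj[OF B] adj_pair.maps[OF B]]) (use lim lim' hlim_unique in blast)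
  with B have BB: "adj_pair H H B B" by simp
  note cl = adj_pair.closed[OF BB] adj_pair.closed[OF q] adj_pair.closed[OF p]
  have le1: "hnorm H (op_sqrt_iter H X n x) \<le> hnorm H x" if "x \<in> hcar H" for n x
    using opboundD[OF opbound_op_sqrt_iter[OF p b] that, of n] majorant_bounds[of n]
    by (meson mult_left_le_one_le hnorm_nonneg order_trans)
  have "hnorm H (B x) \<le> hnorm H x" if x: "x \<in> hcar H" for x
  proof (rule LIMSEQ_le_const)
    show "(\<lambda>m. d m * hnorm H x + hnorm H x) \<longlonglongrightarrow> hnorm H x"
      using tendsto_add[OF tendsto_mult_left_zero[OF d] tendsto_const] by simp
    have "hnorm H (B x) \<le> d m * hnorm H x + hnorm H x" for m
      using hnorm_triangle[of "B x - op_sqrt_iter H X m x" "op_sqrt_iter H X m x"] x cl dist[OF x, of m]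
        le1[OF x, of m] hnorm_diff_commute[of "B x" "op_sqrt_iter H X m x"] by (simp add: diff_closed)
    then show "\<exists>N. \<forall>n\<ge>N. hnorm H (B x) \<le> d n * hnorm H x + hnorm H x" by blast
  qed
  then have bd: "opbound H H B 1" by (simp add: opbound_def)
  have eq: "B x + B x = X x + B (B x)" if x: "x \<in> hcar H" for x
  proof -
    have "hlim H (\<lambda>n. op_sqrt_iter H X n (op_sqrt_iter H X n x)) (B (B x))"
    proof (rule hlimI_bound)
      fix n
      let ?b = "op_sqrt_iter H X n"
      \<comment> \<open>Both the operator and its argument vary with \<open>n\<close>; that all
        iterates are contractions absorbs the moving argument.\<close>
      have "hnorm H (?b (?b x) - B (B x)) \<le> hnorm H (?b (?b x) - ?b (B x)) + hnorm H (?b (B x) - B (B x))"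
        by (intro hnorm_diff_triangle cl x)
      also have "?b (?b x) - ?b (B x) = ?b (?b x - B x)"
        using x cl by (simp add: adj_pair.diff[OF q])
      also have "hnorm H \<dots> \<le> hnorm H (?b x - B x)" by (intro le1 diff_closed cl x)
      finally show "hnorm H (?b (?b x) - B (B x)) \<le> d n * hnorm H x + d n * hnorm H (B x)"
        using dist[OF x, of n] dist[of "B x" n] cl x by simp
    next
      show "(\<lambda>n. d n * hnorm H x + d n * hnorm H (B x)) \<longlonglongrightarrow> 0"
        by (intro tendsto_add_zero tendsto_mult_left_zero d)
    qed (use cl x in auto)
    then have "hlim H (\<lambda>n. X x + op_sqrt_iter H X n (op_sqrt_iter H X n x)) (X x + B (B x))"
      by (intro hlim_add hlim_const cl x)
    moreover have "op_sqrt_iter H X (Suc n) x + op_sqrt_iter H X (Suc n) x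
        = X x + op_sqrt_iter H X n (op_sqrt_iter H X n x)" for n
      using x cl by (simp add: add_closed scale_one flip: scale_add_left)
    then have "(\<lambda>n. op_sqrt_iter H X (Suc n) x + op_sqrt_iter H X (Suc n) x)
        = (\<lambda>n. X x + op_sqrt_iter H X n (op_sqrt_iter H X n x))" by (rule ext)
    moreover have "hlim H (\<lambda>n. op_sqrt_iter H X (Suc n) x + op_sqrt_iter H X (Suc n) x) (B x + B x)"
      using hlim_Suc[OF lim[OF x]] by (intro hlim_add)
    ultimately show ?thesis using hlim_unique by simp
  qed
  show ?thesis using that[OF BB bd lim eq] .
qed

section \<open>Existence and comparison of positive roots\<close>

lemma adj_pair_hilbert_module: "adj_pair H K T S \<Longrightarrow> hilbert_module H"
  by (simp add: adj_pair_def)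

lemma (in hilbert_module) ip_add_pos_eq_0:
  assumes "x \<in> hcar H" "alg_pos a" "hip H x x + a = 0"
  shows "x = 0"
  using hnorm_le_add_pos[OF assms(1,2)] assms hnorm_eq_0 by simp

text \<open>Write \<open>a\<close> and \<open>b\<close> for the two products and
  \<open>u = (a - b) x\<close>. Then \<open>(a + b) u = (a^2 - b^2) x = 0\<close>, so the inner
  squares of \<open>T u\<close> and \<open>R u\<close> add up to 0 and both vectors vanish. Pairing
  \<open>u\<close> with \<open>a x - b x\<close> then gives 0.\<close>

lemma commuting_positive_squares_eq:
  assumes p: "adj_pair H K T T'" and q: "adj_pair H L R R'"
    and comm: "\<And>x. x \<in> hcar H \<Longrightarrow> T' (T (R' (R x))) = R' (R (T' (T x)))"
    and square: "\<And>x. x \<in> hcar H \<Longrightarrow> T' (T (T' (T x))) = R' (R (R' (R x)))"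
  shows "T' \<circ> T = R' \<circ> R"
proof -
  interpret H: hilbert_module H using p by (rule adj_pair_hilbert_module)
  interpret p: adj_pair H K T T' by fact
  interpret q: adj_pair H L R R' by fact
  note pp = adj_pair_comp[OF p p.swap] and qq = adj_pair_comp[OF q q.swap]
  show ?thesis
  proof (rule maps_eqI[OF adj_pair.maps[OF pp] adj_pair.maps[OF qq]])
    fix x assume x: "x \<in> hcar H"
    define a b where "a = T' (T x)" and "b = R' (R x)"
    have ab: "a \<in> hcar H" "b \<in> hcar H"
      using x by (simp_all add: a_def b_def p.closed p.closed_adj q.closed q.closed_adj)
    define u where "u = a - b"
    have u: "u \<in> hcar H" using ab by (simp add: u_def H.diff_closed)
    have "T' (T u) = T' (T a) - T' (T b)" "R' (R u) = R' (R a) - R' (R b)"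
      using adj_pair.diff[OF pp ab] adj_pair.diff[OF qq ab] by (simp_all add: u_def)
    then have 0: "T' (T u) + R' (R u) = 0"
      using comm[OF x] square[OF x] by (simp add: a_def b_def)
    have sum: "hip K (T u) (T u) + hip L (R u) (R u) = 0"
      using u 0 H.ip_add_right[of u "T' (T u)" "R' (R u)"]
      by (simp add: p.ip q.ip p.closed q.closed p.closed_adj q.closed_adj)
    then have "T u = 0"
      using u by (intro p.K.ip_add_pos_eq_0[of "T u"]) (auto simp: p.closed q.closed q.K.alg_pos_ip)
    moreover have "R u = 0"
      using u sum
      by (intro q.K.ip_add_pos_eq_0[of "R u"]) (auto simp: p.closed q.closed p.K.alg_pos_ip add.commute)
    moreover have "hip H u u = hip K (T u) (T x) - hip L (R u) (R x)"
      using H.ip_diff_right[OF u ab, folded u_def] u x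
      by (simp add: a_def b_def p.ip q.ip p.closed q.closed)
    ultimately have "u = 0" using u x by (simp add: p.closed q.closed H.ip_definite)
    then show "(T' \<circ> T) x = (R' \<circ> R) x" by (simp add: u_def a_def b_def)
  qed
qed

text \<open>The limit \<open>B\<close> of the iteration is again a self-adjoint contraction, so the
  construction applies to \<open>B\<close> itself and exhibits \<open>s = 1 - B\<close> as a square
  \<open>c \<circ> c\<close>. This makes the root positive. The limit clause is kept for passing
  intertwining relations to \<open>s\<close>.\<close>

lemma op_root:
  assumes p: "adj_pair H H X X" and b: "opbound H H X 1"
  obtains s c where "adj_pair H H s s" "adj_pair H H c c" "s = c \<circ> c"
    "\<And>x. x \<in> hcar H \<Longrightarrow> s (s x) = x - X x"
    "\<And>x. x \<in> hcar H \<Longrightarrow> hlim H (\<lambda>n. op_sqrt_iter H X n x) (x - s x)"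
    "\<And>x. x \<in> hcar H \<Longrightarrow> hnorm H (x - s x) \<le> hnorm H x"
proof -
  interpret hilbert_module H using p by (rule adj_pair_hilbert_module)
  have root: "\<exists>B. adj_pair H H B B \<and> opbound H H B 1
      \<and> (\<forall>x\<in>hcar H. hlim H (\<lambda>n. op_sqrt_iter H X n x) (B x))
      \<and> adj_pair H H (idop H - B) (idop H - B)
      \<and> (\<forall>x\<in>hcar H. (idop H - B) ((idop H - B) x) = x - X x)"
    if p: "adj_pair H H X X" and b: "opbound H H X 1" for X
  proof -
    obtain B where B: "adj_pair H H B B" "opbound H H B 1"
      "\<And>x. x \<in> hcar H \<Longrightarrow> hlim H (\<lambda>n. op_sqrt_iter H X n x) (B x)"
      "\<And>x. x \<in> hcar H \<Longrightarrow> B x + B x = X x + B (B x)"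
      using op_sqrt_iter_limit[OF p b] by blast
    have "(idop H - B) ((idop H - B) x) = x - X x" if x: "x \<in> hcar H" for x
    proof -
      have "(idop H - B) ((idop H - B) x) = x - B x - (B x - B (B x))"
        using x adj_pair.closed[OF B(1)] by (simp add: adj_pair.diff[OF B(1)] diff_closed)
      then show ?thesis using B(4)[OF x] by (simp add: algebra_simps)
    qed
    with B adj_pair_idop_diff[OF B(1)] show ?thesis by blast
  qed
  obtain B where B: "adj_pair H H B B" "opbound H H B 1"
    "\<And>x. x \<in> hcar H \<Longrightarrow> hlim H (\<lambda>n. op_sqrt_iter H X n x) (B x)"
    "adj_pair H H (idop H - B) (idop H - B)"
    "\<And>x. x \<in> hcar H \<Longrightarrow> (idop H - B) ((idop H - B) x) = x - X x"
    using root[OF p b] by blast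
  obtain C where C: "adj_pair H H (idop H - C) (idop H - C)"
    "\<And>x. x \<in> hcar H \<Longrightarrow> (idop H - C) ((idop H - C) x) = x - B x"
    using root[OF B(1,2)] by blast
  have eq: "idop H - B = (idop H - C) \<circ> (idop H - C)"
    by (rule maps_eqI[OF adj_pair.maps[OF B(4)] adj_pair.maps[OF adj_pair_comp[OF C(1) C(1)]]])
      (use C(2) in simp)
  show ?thesis
    by (rule that[OF B(4) C(1) eq B(5)]) (use B(3) opboundD[OF B(2)] in simp_all)
qed

lemma op_root_intertwine:
  assumes p: "adj_pair H H X X" and q: "adj_pair K K Y Y" and z: "adj_pair H K Z Z'"
    and ZX: "\<And>x. x \<in> hcar H \<Longrightarrow> Z (X x) = Y (Z x)"
    and s: "\<And>x. x \<in> hcar H \<Longrightarrow> hlim H (\<lambda>n. op_sqrt_iter H X n x) (x - s x)"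
    and t: "\<And>y. y \<in> hcar K \<Longrightarrow> hlim K (\<lambda>n. op_sqrt_iter K Y n y) (y - t y)"
    and x: "x \<in> hcar H" and sx: "s x \<in> hcar H"
  shows "Z (s x) = t (Z x)"
proof -
  interpret adj_pair H K Z Z' by fact
  have "hlim K (\<lambda>n. Z (op_sqrt_iter H X n x)) (Z (x - s x))" by (intro hlim_op s x)
  then have "hlim K (\<lambda>n. op_sqrt_iter K Y n (Z x)) (Z (x - s x))"
    using op_sqrt_iter_intertwine[OF p q z ZX x] by simp
  then have "Z (x - s x) = Z x - t (Z x)" using t[OF closed[OF x]] K.hlim_unique by blast
  then show ?thesis using x sx by (simp add: diff)
qed

text \<open>For \<open>A = T* T\<close> the identity \<open>s\<^sup>2 + A\<^sup>2 = 1\<close> makes \<open>s\<close>, and hence \<open>1 - A\<^sup>2\<close>, a contraction.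
  So \<open>A\<^sup>2\<close> has a positive root \<open>k\<close> at distance at most 1 from the identity, and \<open>A = k\<close>.\<close>

lemma opbound_idop_diff:
  assumes p: "adj_pair H K T T'" and b: "opbound H K T 1"
  shows "opbound H H (idop H - (T' \<circ> T)) 1"
proof -
  interpret H: hilbert_module H using p by (rule adj_pair_hilbert_module)
  interpret p: adj_pair H K T T' by fact
  define A where "A = T' \<circ> T"
  have pA: "adj_pair H H A A" unfolding A_def by (rule adj_pair_comp[OF p p.swap])
  have bA: "opbound H H A 1" unfolding A_def using opbound_comp[OF p b p.opbound_adj[OF b]] by simp
  have pAA: "adj_pair H H (A \<circ> A) (A \<circ> A)" by (rule adj_pair_comp[OF pA pA])
  have bAA: "opbound H H (A \<circ> A) 1" using opbound_comp[OF pA bA bA] by simp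
  obtain s where ps: "adj_pair H H s s" and s: "\<And>x. x \<in> hcar H \<Longrightarrow> s (s x) = x - A (A x)"
    using op_root[OF pAA bAA] by (metis comp_apply)
  note cl = adj_pair.closed[OF pA] adj_pair.closed[OF ps]
  have "hnorm H (s x) \<le> hnorm H x" if x: "x \<in> hcar H" for x
  proof (rule power2_le_imp_le)
    have "(hnorm H (s x))\<^sup>2 \<le> norm (hip H (s x) (s x) + hip H (A x) (A x))"
      by (intro H.hnorm_le_add_pos H.alg_pos_ip cl x)
    also have "hip H (s x) (s x) + hip H (A x) (A x) = hip H x x"
      using x cl by (simp add: adj_pair.ip[OF ps] adj_pair.ip[OF pA] s H.ip_diff_right)
    finally show "(hnorm H (s x))\<^sup>2 \<le> (hnorm H x)\<^sup>2" by (simp add: hnorm_square)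
  qed simp
  then have bs: "opbound H H s 1" by (simp add: opbound_def)
  have pss: "adj_pair H H (s \<circ> s) (s \<circ> s)" by (rule adj_pair_comp[OF ps ps])
  have bss: "opbound H H (s \<circ> s) 1" using opbound_comp[OF ps bs bs] by simp
  obtain k c where pk: "adj_pair H H k k" and pc: "adj_pair H H c c" and kc: "k = c \<circ> c"
    and kk: "\<And>x. x \<in> hcar H \<Longrightarrow> k (k x) = x - (s \<circ> s) x"
    and lim: "\<And>x. x \<in> hcar H \<Longrightarrow> hlim H (\<lambda>n. op_sqrt_iter H (s \<circ> s) n x) (x - k x)"
    and le: "\<And>x. x \<in> hcar H \<Longrightarrow> hnorm H (x - k x) \<le> hnorm H x"
    by (rule op_root[OF pss bss]) blast
  have "A ((s \<circ> s) x) = (s \<circ> s) (A x)" if "x \<in> hcar H" for x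
    using that cl by (simp add: s adj_pair.diff[OF pA])
  then have comm: "A (k x) = k (A x)" if "x \<in> hcar H" for x
    using op_root_intertwine[OF pss pss pA _ lim lim that] adj_pair.closed[OF pk that] by blast
  have kkA: "k (k x) = A (A x)" if "x \<in> hcar H" for x using that by (simp add: kk s)
  have "T' \<circ> T = c \<circ> c"
  proof (rule commuting_positive_squares_eq[OF p pc])
    fix x assume x: "x \<in> hcar H"
    show "T' (T (c (c x))) = c (c (T' (T x)))" using comm[OF x] by (simp add: A_def kc)
    show "T' (T (T' (T x))) = c (c (c (c x)))" using kkA[OF x] by (simp add: A_def kc)
  qed
  then have "T' \<circ> T = k" by (simp add: kc)
  then show ?thesis unfolding opbound_def using le by simp
qed

text \<open>Dividing \<open>T\<close> by its bound \<open>r\<close> makes \<open>X\<close> a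
  contraction, and the root obtained from \<open>X\<close> is multiplied by \<open>r\<close> in the
  end, its own root \<open>c\<close> by \<open>sqrt r\<close>. \<open>X\<close> is spelled out
  because later proofs need the iteration, with its scaling, behind the root.\<close>

lemma op_square_root_exists:
  assumes p: "adj_pair H K T T'" and b: "opbound H K T r" and r: "0 < r"
  defines "X \<equiv> (\<lambda>x. idop H x - hscale H (complex_of_real (1 / (r * r))) (T' (T x)))"
  obtains s c where "adj_pair H H c c" "s = c \<circ> c" "s \<circ> s = T' \<circ> T" "adj_pair H H X X"
    "\<And>x. x \<in> hcar H \<Longrightarrow> hlim H (\<lambda>n. op_sqrt_iter H X n x) (x - hscale H (complex_of_real (1 / r)) (s x))"
proof -
  interpret H: hilbert_module H using p by (rule adj_pair_hilbert_module)
  interpret p: adj_pair H K T T' by fact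
  note sc = adj_pair_scale[OF p, of "1 / r"]
  have "opbound H K (\<lambda>x. hscale K (complex_of_real (1 / r)) (T x)) 1"
    using opboundD[OF b] r by (simp add: opbound_def p.K.hnorm_scale p.closed norm_divide field_simps)
  then have bd: "opbound H H (idop H - ((\<lambda>y. hscale H (complex_of_real (1 / r)) (T' y)) \<circ> (\<lambda>x. hscale K (complex_of_real (1 / r)) (T x)))) 1"
    by (rule opbound_idop_diff[OF sc])
  have X: "X = idop H - ((\<lambda>y. hscale H (complex_of_real (1 / r)) (T' y)) \<circ> (\<lambda>x. hscale K (complex_of_real (1 / r)) (T x)))"
  proof
    fix x
    show "X x = (idop H - ((\<lambda>y. hscale H (complex_of_real (1 / r)) (T' y)) \<circ> (\<lambda>x. hscale K (complex_of_real (1 / r)) (T x)))) x"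
    proof (cases "x \<in> hcar H")
      case True
      then show ?thesis
        using adj_pair.scale[OF p.swap, of "T x"]
        by (simp add: X_def H.scale_scale p.closed p.closed_adj)
    next
      case False
      then show ?thesis by (simp add: X_def p.outside adj_pair.zero[OF p.swap])
    qed
  qed
  have pX: "adj_pair H H X X" unfolding X
    by (rule adj_pair_idop_diff, rule adj_pair_comp[OF sc adj_pair.swap[OF sc]])
  obtain s c where s: "adj_pair H H s s" and c: "adj_pair H H c c" "s = c \<circ> c"
    and ss: "\<And>x. x \<in> hcar H \<Longrightarrow> s (s x) = x - X x"
    and lim: "\<And>x. x \<in> hcar H \<Longrightarrow> hlim H (\<lambda>n. op_sqrt_iter H X n x) (x - s x)"
    by (rule op_root[OF pX bd[folded X]]) blast
  define c' where "c' x = hscale H (complex_of_real (sqrt r)) (c x)" for x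
  have c': "adj_pair H H c' c'" unfolding c'_def by (rule adj_pair_scale[OF c(1)])
  have s': "(c' \<circ> c') x = hscale H (complex_of_real r) (s x)" if "x \<in> hcar H" for x
    using that r adj_pair.closed[OF c(1)]
    by (simp add: c'_def c(2) adj_pair.scale[OF c(1)] H.scale_scale flip: of_real_mult)
  have "(c' \<circ> c') \<circ> (c' \<circ> c') = T' \<circ> T"
  proof (rule maps_eqI[of _ H H])
    show "(c' \<circ> c') \<circ> (c' \<circ> c') \<in> maps H H" "T' \<circ> T \<in> maps H H"
      using adj_pair.maps adj_pair_comp[OF adj_pair_comp[OF c' c'] adj_pair_comp[OF c' c']]
        adj_pair_comp[OF p p.swap] by blast+
    fix x assume x: "x \<in> hcar H"
    have "((c' \<circ> c') \<circ> (c' \<circ> c')) x = hscale H (complex_of_real (r * r)) (s (s x))"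
      using x adj_pair.closed[OF s] s'[OF x] s'[of "hscale H (complex_of_real r) (s x)"]
      by (simp add: H.scale_closed adj_pair.scale[OF s] H.scale_scale)
    also have "s (s x) = hscale H (complex_of_real (1 / (r * r))) (T' (T x))"
      using ss[OF x] x by (simp add: X_def)
    finally show "((c' \<circ> c') \<circ> (c' \<circ> c')) x = (T' \<circ> T) x"
      using r x p.closed p.closed_adj by (simp add: H.scale_scale H.scale_one flip: of_real_mult)
  qed
  moreover have "hlim H (\<lambda>n. op_sqrt_iter H X n x) (x - hscale H (complex_of_real (1 / r)) ((c' \<circ> c') x))"
    if x: "x \<in> hcar H" for x
    using lim[OF x] r x adj_pair.closed[OF s]
    by (simp only: s') (simp add: H.scale_scale H.scale_one flip: of_real_mult)
  ultimately show ?thesis using that[OF c' refl _ pX] by blast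
qed

section \<open>Positive operators and the uniqueness of their roots\<close>

lemma op_posE:
  assumes "hilbert_module H" "op_pos H A"
  obtains B B' where "adj_pair H H B B'" "A = B' \<circ> B"
  using assms adjointable_imp_adj_pair[OF assms(1,1)] by (auto simp: op_pos_def)

lemma op_pos_self_adjoint: "hilbert_module H \<Longrightarrow> op_pos H A \<Longrightarrow> adj_pair H H A A"
  by (metis op_posE adj_pair_comp adj_pair.swap)

lemma op_posI_square: "adj_pair H H c c \<Longrightarrow> op_pos H (c \<circ> c)"
  unfolding op_pos_def using adj_pair.adj_eq adj_pair.adjointable by metis

text \<open>Here \<open>T\<close> may lead to another module, while \<open>op_pos\<close> asks for
  an operator on \<open>H\<close>. The self-adjoint root of \<open>T' \<circ> T\<close> is
  one.\<close>

lemma op_posI: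
  assumes "adj_pair H K T T'"
  shows "op_pos H (T' \<circ> T)"
proof -
  obtain r where r: "0 < r" "opbound H K T r" using adj_pair.bounded[OF assms] by blast
  obtain s c where "adj_pair H H c c" "s = c \<circ> c" "s \<circ> s = T' \<circ> T"
    by (rule op_square_root_exists[OF assms r(2,1)]) blast
  then show ?thesis using op_posI_square adj_pair_comp by metis
qed

text \<open>A positive root \<open>v\<close> of \<open>A\<close> commutes with \<open>A\<close>, its
  own square, hence with the root \<open>u\<close> obtained as a limit of polynomials in
  \<open>A\<close>. Commuting positive operators with equal squares agree.\<close>

lemma op_sqrt_eqI:
  assumes hm: "hilbert_module H" and A: "op_pos H A" and s: "op_pos H s" "s \<circ> s = A"
  shows "op_sqrt H A = s"
proof -
  interpret hilbert_module H by fact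
  obtain T T' where T: "adj_pair H H T T'" "A = T' \<circ> T" using op_posE[OF hm A] .
  interpret T: adj_pair H H T T' by (rule T)
  obtain r where r: "0 < r" "opbound H H T r" using T.bounded by blast
  obtain u c where c: "adj_pair H H c c" "u = c \<circ> c" and uu: "u \<circ> u = T' \<circ> T"
    and pX: "adj_pair H H (\<lambda>x. idop H x - hscale H (complex_of_real (1 / (r * r))) (T' (T x)))
      (\<lambda>x. idop H x - hscale H (complex_of_real (1 / (r * r))) (T' (T x)))"
    and lim: "\<And>x. x \<in> hcar H \<Longrightarrow>
      hlim H (\<lambda>n. op_sqrt_iter H (\<lambda>x. idop H x - hscale H (complex_of_real (1 / (r * r))) (T' (T x))) n x)
        (x - hscale H (complex_of_real (1 / r)) (u x))"
    by (rule op_square_root_exists[OF T(1) r(2,1)]) blast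
  have pu: "adj_pair H H u u" using c adj_pair_comp by metis
  have eq: "v = u" if v: "op_pos H v" "v \<circ> v = A" for v
  proof -
    obtain B B' where B: "adj_pair H H B B'" "v = B' \<circ> B" using op_posE[OF hm v(1)] .
    have pv: "adj_pair H H v v" by (rule op_pos_self_adjoint[OF hm v(1)])
    note cl = adj_pair.closed[OF pv] adj_pair.closed[OF pu] T.closed T.closed_adj
    have vA: "v (T' (T x)) = T' (T (v x))" for x
      using v(2) T(2) by (metis comp_apply)
    have "v (hscale H (complex_of_real (1 / r)) (u x)) = hscale H (complex_of_real (1 / r)) (u (v x))"
      if x: "x \<in> hcar H" for x
      by (rule op_root_intertwine[OF pX pX pv _ lim lim x])
        (use cl x vA in \<open>simp_all add: adj_pair.diff[OF pv] adj_pair.scale[OF pv] scale_closed\<close>)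
    then have "hscale H (complex_of_real r) (hscale H (complex_of_real (1 / r)) (v (u x)))
        = hscale H (complex_of_real r) (hscale H (complex_of_real (1 / r)) (u (v x)))"
      if x: "x \<in> hcar H" for x
      using x cl by (simp add: adj_pair.scale[OF pv])
    then have comm: "v (u x) = u (v x)" if "x \<in> hcar H" for x
      using that cl r by (simp add: scale_scale scale_one flip: of_real_mult)
    have "v (v x) = u (u x)" for x using v(2) uu T(2) by (metis comp_apply)
    then have "B' \<circ> B = c \<circ> c"
      by (intro commuting_positive_squares_eq[OF B(1) c(1)])
        (use comm B(2) c(2) in \<open>auto simp: fun_eq_iff\<close>)
    then show ?thesis using B(2) c(2) by simp
  qed
  have "op_sqrt H A = u"
    unfolding op_sqrt_def
  proof (rule the_equality)
    show "op_pos H u \<and> u \<circ> u = A" using op_posI_square[OF c(1), folded c(2)] uu T(2) by blast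
  qed (use eq in blast)
  then show ?thesis using eq[OF s] by simp
qed

lemma op_sqrt_intertwine:
  assumes hm: "hilbert_module H" "hilbert_module K" and A: "op_pos H A" "op_pos K A'"
    and Z: "adj_pair H K Z Z'" and ZA: "\<And>x. x \<in> hcar H \<Longrightarrow> Z (A x) = A' (Z x)"
    and x: "x \<in> hcar H"
  shows "Z (op_sqrt H A x) = op_sqrt K A' (Z x)"
proof -
  interpret H: hilbert_module H by fact
  interpret K: hilbert_module K by fact
  interpret Z: adj_pair H K Z Z' by fact
  obtain T T' where T: "adj_pair H H T T'" "A = T' \<circ> T" using op_posE[OF hm(1) A(1)] .
  obtain R R' where R: "adj_pair K K R R'" "A' = R' \<circ> R" using op_posE[OF hm(2) A(2)] .
  interpret T: adj_pair H H T T' by (rule T)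
  interpret R: adj_pair K K R R' by (rule R)
  obtain r1 where r1: "0 < r1" "opbound H H T r1" using T.bounded by blast
  obtain r2 where r2: "0 < r2" "opbound K K R r2" using R.bounded by blast
  \<comment> \<open>A common bound gives both iterations the same scaling, so that \<open>Z\<close>
    intertwines their starting operators.\<close>
  define r where "r = max r1 r2"
  have r: "0 < r" using r1 by (simp add: r_def)
  have rT: "opbound H H T r" unfolding opbound_def
  proof (intro conjI ballI)
    fix x assume x: "x \<in> hcar H"
    show "hnorm H (T x) \<le> r * hnorm H x"
      by (rule order_trans[OF opboundD[OF r1(2) x]]) (simp add: r_def mult_right_mono)
  qed (use r in simp)
  have rR: "opbound K K R r" unfolding opbound_def
  proof (intro conjI ballI)
    fix x assume x: "x \<in> hcar K"
    show "hnorm K (R x) \<le> r * hnorm K x"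
      by (rule order_trans[OF opboundD[OF r2(2) x]]) (simp add: r_def mult_right_mono)
  qed (use r in simp)
  obtain s c where c: "adj_pair H H c c" "s = c \<circ> c" and ss: "s \<circ> s = T' \<circ> T"
    and pX: "adj_pair H H (\<lambda>x. idop H x - hscale H (complex_of_real (1 / (r * r))) (T' (T x)))
      (\<lambda>x. idop H x - hscale H (complex_of_real (1 / (r * r))) (T' (T x)))"
    and lim: "\<And>x. x \<in> hcar H \<Longrightarrow>
      hlim H (\<lambda>n. op_sqrt_iter H (\<lambda>x. idop H x - hscale H (complex_of_real (1 / (r * r))) (T' (T x))) n x)
        (x - hscale H (complex_of_real (1 / r)) (s x))"
    by (rule op_square_root_exists[OF T(1) rT r]) blast
  obtain t d where d: "adj_pair K K d d" "t = d \<circ> d" and tt: "t \<circ> t = R' \<circ> R"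
    and pY: "adj_pair K K (\<lambda>x. idop K x - hscale K (complex_of_real (1 / (r * r))) (R' (R x)))
      (\<lambda>x. idop K x - hscale K (complex_of_real (1 / (r * r))) (R' (R x)))"
    and lim': "\<And>x. x \<in> hcar K \<Longrightarrow>
      hlim K (\<lambda>n. op_sqrt_iter K (\<lambda>x. idop K x - hscale K (complex_of_real (1 / (r * r))) (R' (R x))) n x)
        (x - hscale K (complex_of_real (1 / r)) (t x))"
    by (rule op_square_root_exists[OF R(1) rR r]) blast
  have ps: "adj_pair H H s s" using c adj_pair_comp by metis
  have pt: "adj_pair K K t t" using d adj_pair_comp by metis
  have "Z (hscale H (complex_of_real (1 / r)) (s x)) = hscale K (complex_of_real (1 / r)) (t (Z x))"
    by (rule op_root_intertwine[OF pX pY Z _ lim lim' x])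
      (use x ZA adj_pair.closed[OF ps] T R in \<open>simp_all add: Z.diff Z.scale Z.closed T.closed T.closed_adj H.scale_closed\<close>)
  then have "hscale K (complex_of_real r) (hscale K (complex_of_real (1 / r)) (Z (s x)))
      = hscale K (complex_of_real r) (hscale K (complex_of_real (1 / r)) (t (Z x)))"
    using x adj_pair.closed[OF ps] by (simp add: Z.scale)
  then have "Z (s x) = t (Z x)"
    using x adj_pair.closed[OF ps] adj_pair.closed[OF pt] r
    by (simp add: Z.closed K.scale_scale K.scale_one flip: of_real_mult)
  moreover have "op_sqrt H A = s"
    using op_sqrt_eqI[OF hm(1) A(1) op_posI_square[OF c(1), folded c(2)]] ss T(2) by blast
  moreover have "op_sqrt K A' = t"
    using op_sqrt_eqI[OF hm(2) A(2) op_posI_square[OF d(1), folded d(2)]] tt R(2) by blast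
  ultimately show ?thesis by simp
qed

lemma op_sqrt:
  assumes hm: "hilbert_module H" and A: "op_pos H A"
  shows "op_pos H (op_sqrt H A)" "op_sqrt H A \<circ> op_sqrt H A = A"
proof -
  obtain T T' where T: "adj_pair H H T T'" "A = T' \<circ> T" using op_posE[OF hm A] .
  obtain r where r: "0 < r" "opbound H H T r" using adj_pair.bounded[OF T(1)] by blast
  obtain s c where c: "adj_pair H H c c" "s = c \<circ> c" and ss: "s \<circ> s = T' \<circ> T"
    by (rule op_square_root_exists[OF T(1) r(2,1)]) blast
  have pos: "op_pos H s" unfolding c(2) by (rule op_posI_square[OF c(1)])
  have eq: "op_sqrt H A = s" using op_sqrt_eqI[OF hm A pos] ss T(2) by blast
  show "op_pos H (op_sqrt H A)" "op_sqrt H A \<circ> op_sqrt H A = A"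
    unfolding eq using pos ss T(2) by blast+
qed

section \<open>The factorization \<open>R = V |R|\<^sup>1\<^sup>/\<^sup>2\<close>\<close>

text \<open>With \<open>B = C\<^sup>2 = 1 - \<epsilon> S\<^sup>2\<close> the elements \<open>\<langle>S C\<^sup>k x, S C\<^sup>k x\<rangle>\<close> decrease in \<open>k\<close> and their sums
  are at most \<open>\<langle>x, x\<rangle> / \<epsilon>\<close>, because \<open>\<langle>x, x\<rangle> = \<epsilon> \<langle>S x, S x\<rangle> + \<langle>C x, C x\<rangle>\<close>.\<close>

lemma self_adjoint_decay:
  assumes p: "adj_pair H H S S"
  obtains e B d where "0 < e" "adj_pair H H B B"
    "\<And>x. x \<in> hcar H \<Longrightarrow> hscale H (complex_of_real e) (S (S x)) = x - B x"
    "\<And>x. x \<in> hcar H \<Longrightarrow> S (B x) = B (S x)"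
    "\<And>n. 0 \<le> d n" "decseq d" "d \<longlonglongrightarrow> 0"
    "\<And>n x. x \<in> hcar H \<Longrightarrow> hnorm H (S ((B ^^ n) x)) \<le> d n * hnorm H x"
proof -
  interpret H: hilbert_module H using p by (rule adj_pair_hilbert_module)
  interpret S: adj_pair H H S S by fact
  obtain r where r: "0 < r" "opbound H H S r" using S.bounded by blast
  define S1 where "S1 x = hscale H (complex_of_real (1 / r)) (S x)" for x
  have p1: "adj_pair H H S1 S1" unfolding S1_def by (rule adj_pair_scale[OF p])
  have b1: "opbound H H S1 1"
    using opboundD[OF r(2)] r by (simp add: S1_def opbound_def H.hnorm_scale S.closed norm_divide field_simps)
  have pX: "adj_pair H H (S1 \<circ> S1) (S1 \<circ> S1)" by (rule adj_pair_comp[OF p1 p1])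
  have bX: "opbound H H (S1 \<circ> S1) 1" using opbound_comp[OF p1 b1 b1] by simp
  obtain C where pC: "adj_pair H H C C" and CC: "\<And>x. x \<in> hcar H \<Longrightarrow> C (C x) = x - (S1 \<circ> S1) x"
    and lim: "\<And>x. x \<in> hcar H \<Longrightarrow> hlim H (\<lambda>n. op_sqrt_iter H (S1 \<circ> S1) n x) (x - C x)"
    by (rule op_root[OF pX bX]) blast
  note cl = adj_pair.closed[OF pC] adj_pair.closed[OF p1] S.closed
  have comm: "S1 (C x) = C (S1 x)" if "x \<in> hcar H" for x
    by (rule op_root_intertwine[OF pX pX p1 _ lim lim that]) (use that cl in simp_all)
  have SS1: "S x = hscale H (complex_of_real r) (S1 x)" if "x \<in> hcar H" for x
    using that r by (simp add: S1_def H.scale_scale S.closed H.scale_one flip: of_real_mult)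
  have Cpow: "(C ^^ k) x \<in> hcar H" if "x \<in> hcar H" for k x
    using that by (induction k) (auto simp: cl)
  \<comment> \<open>As \<open>Q\<close> decreases, \<open>Suc n\<close> copies of \<open>Q n\<close>
    are at most \<open>Q 0 + ... + Q n\<close>, which telescopes to
    \<open>P 0 - P (Suc n)\<close>.\<close>
  have bound: "real (Suc n) * (hnorm H (S1 ((C ^^ n) x)))\<^sup>2 \<le> (hnorm H x)\<^sup>2" if x: "x \<in> hcar H" for n x
  proof -
    define P where "P k = hip H ((C ^^ k) x) ((C ^^ k) x)" for k
    define Q where "Q k = hip H (S1 ((C ^^ k) x)) (S1 ((C ^^ k) x))" for k
    have split: "hip H z z = hip H (S1 z) (S1 z) + hip H (C z) (C z)" if z: "z \<in> hcar H" for z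
    proof -
      have "hip H (S1 z) (S1 z) + hip H (C z) (C z) = hip H z (S1 (S1 z) + C (C z))"
        using z cl by (simp add: adj_pair.ip[OF p1] adj_pair.ip[OF pC] H.ip_add_right)
      then show ?thesis using CC[OF z] by simp
    qed
    have PQ: "P k = Q k + P (Suc k)" for k
      using split[OF Cpow[OF x]] by (simp add: P_def Q_def)
    have Qdec: "alg_pos (Q k - Q (Suc k))" for k
    proof -
      let ?z = "S1 ((C ^^ k) x)"
      have z: "?z \<in> hcar H" by (intro cl Cpow x)
      have "Q k = hip H (S1 ?z) (S1 ?z) + Q (Suc k)"
        using split[OF z] by (simp add: Q_def comm Cpow x)
      then show ?thesis using z cl by (simp add: H.alg_pos_ip)
    qed
    have Ppos: "alg_pos (P k)" for k by (simp add: P_def H.alg_pos_ip Cpow x)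
    have Qpos: "alg_pos (Q k)" for k by (simp add: Q_def H.alg_pos_ip Cpow x cl)
    have "alg_pos (P 0 - P (Suc n) - real (Suc n) *\<^sub>R Q n)" for n
    proof (induction n)
      case 0
      then show ?case using PQ[of 0] by (simp add: alg_pos_0)
    next
      case (Suc n)
      have "P 0 - P (Suc (Suc n)) - real (Suc (Suc n)) *\<^sub>R Q (Suc n)
          = P 0 - P (Suc n) - real (Suc n) *\<^sub>R Q n + real (Suc n) *\<^sub>R (Q n - Q (Suc n))"
        using PQ[of "Suc n"] by (simp add: algebra_simps scaleR_2)
      moreover have "alg_pos (real (Suc n) *\<^sub>R (Q n - Q (Suc n)))" by (intro alg_pos_scaleR Qdec) simp
      ultimately show ?case using alg_pos_add[OF Suc] by (simp only:)
    qed
    from alg_pos_add[OF this[of n] Ppos[of "Suc n"]]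
    have "alg_pos (P 0 - real (Suc n) *\<^sub>R Q n)" by simp
    then have "norm (real (Suc n) *\<^sub>R Q n) \<le> norm (P 0)"
      by (intro alg_pos_norm_mono alg_pos_scaleR Qpos) simp_all
    then show ?thesis by (simp add: P_def Q_def hnorm_square)
  qed
  \<comment> \<open>The rate comes from \<open>bound\<close>, with \<open>r\<close> restoring the
    scale of \<open>S\<close>. It is independent of \<open>x\<close>, which later gives convergence
    in operator norm.\<close>
  define d where "d n = r * sqrt (inverse (real (Suc n)))" for n
  have d0: "0 \<le> d n" for n using r by (simp add: d_def)
  have ddec: "decseq d"
    using r by (auto simp: decseq_def d_def le_imp_inverse_le)
  have dlim: "d \<longlonglongrightarrow> 0"
    unfolding d_def using tendsto_real_sqrt[OF LIMSEQ_inverse_real_of_nat]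
    by (intro tendsto_mult_right_zero) simp
  have decay: "hnorm H (S (((C \<circ> C) ^^ n) x)) \<le> d n * hnorm H x" if x: "x \<in> hcar H" for n x
  proof -
    have "C \<circ> C = C ^^ 2" by (simp add: numeral_2_eq_2)
    then have pow: "(C \<circ> C) ^^ n = C ^^ (n * 2)" by (simp add: funpow_mult mult.commute)
    let ?t = "hnorm H (S1 ((C ^^ (n * 2)) x))"
    have "real (Suc n) * ?t\<^sup>2 \<le> real (Suc (n * 2)) * ?t\<^sup>2" by (intro mult_right_mono) auto
    also have "\<dots> \<le> (hnorm H x)\<^sup>2" by (rule bound[OF x])
    finally have "?t\<^sup>2 \<le> inverse (real (Suc n)) * (hnorm H x)\<^sup>2" by (simp add: field_simps)
    also have "\<dots> = (sqrt (inverse (real (Suc n))) * hnorm H x)\<^sup>2"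
      by (simp add: power_mult_distrib)
    finally have "?t \<le> sqrt (inverse (real (Suc n))) * hnorm H x" by (rule power2_le_imp_le) simp
    then show ?thesis
      using r x Cpow cl by (simp add: pow SS1 H.hnorm_scale d_def)
  qed
  have "hscale H (complex_of_real (1 / (r * r))) (S (S x)) = x - (C \<circ> C) x" if x: "x \<in> hcar H" for x
    using CC[OF x] x r by (simp add: S1_def S.scale S.closed H.scale_scale)
  moreover have "S ((C \<circ> C) x) = (C \<circ> C) (S x)" if x: "x \<in> hcar H" for x
    using x cl by (simp add: SS1 comm adj_pair.scale[OF pC])
  moreover have "0 < 1 / (r * r)" using r by simp
  ultimately show ?thesis using that[OF _ adj_pair_comp[OF pC pC] _ _ d0 ddec dlim decay] by blast
qed

text \<open>Since \<open>1 - B ^^ n\<close> is a multiple of the square of \<open>S\<close>, the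
  vector \<open>S x\<close> differs from a value of that square by \<open>S ((B ^^ n) x)\<close>,
  which decays.\<close>

lemma range_in_closure_range_square:
  assumes p: "adj_pair H H S S" and x: "x \<in> hcar H"
  shows "S x \<in> htopology H closure_of ((\<lambda>z. S (S z)) ` hcar H)"
proof -
  interpret H: hilbert_module H using p by (rule adj_pair_hilbert_module)
  interpret S: adj_pair H H S S by fact
  obtain e B d where e: "0 < e" and B: "adj_pair H H B B"
    and SS: "\<And>x. x \<in> hcar H \<Longrightarrow> hscale H (complex_of_real e) (S (S x)) = x - B x"
    and d: "d \<longlonglongrightarrow> 0" and decay: "\<And>n x. x \<in> hcar H \<Longrightarrow> hnorm H (S ((B ^^ n) x)) \<le> d n * hnorm H x"
    by (rule self_adjoint_decay[OF p]) blast
  have Bpow: "(B ^^ n) x \<in> hcar H" for n using x by (induction n) (auto simp: adj_pair.closed[OF B])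
  have "\<exists>g\<in>hcar H. x - (B ^^ n) x = S (S g)" for n
  proof (induction n)
    case 0
    then show ?case using H.zero_closed S.zero by (intro bexI[of _ 0]) auto
  next
    case (Suc n)
    then obtain g where g: "g \<in> hcar H" "x - (B ^^ n) x = S (S g)" by blast
    let ?h = "hscale H (complex_of_real e) ((B ^^ n) x)"
    have "S (S ?h) = (B ^^ n) x - (B ^^ Suc n) x" using SS[OF Bpow] Bpow by (simp add: S.scale S.closed)
    moreover have "S (S (g + ?h)) = S (S g) + S (S ?h)"
      using g Bpow by (simp add: S.add H.scale_closed S.closed)
    ultimately have "x - (B ^^ Suc n) x = S (S (g + ?h))" using g by (simp add: algebra_simps)
    then show ?case using g Bpow H.add_closed H.scale_closed by blast
  qed
  then obtain g where g: "\<And>n. g n \<in> hcar H" "\<And>n. x - (B ^^ n) x = S (S (g n))" by metis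
  show ?thesis
  proof (rule H.hlim_in_closure[where s="\<lambda>n. S (S (S (g n)))"])
    show "hlim H (\<lambda>n. S (S (S (g n)))) (S x)"
    proof (rule H.hlimI_bound)
      show "hnorm H (S (S (S (g n))) - S x) \<le> d n * hnorm H x" for n
        using decay[OF x, of n] x Bpow[of n]
        by (simp add: g(2)[symmetric] S.diff S.closed H.hnorm_minus)
      show "(\<lambda>n. d n * hnorm H x) \<longlonglongrightarrow> 0" by (intro tendsto_mult_left_zero d)
    qed (use g x S.closed in auto)
  qed (use g S.closed in auto)
qed

text \<open>Formally \<open>V\<close> is \<open>R\<close> times the inverse of \<open>S\<close>, and
  \<open>G n\<close> approximates this inverse: \<open>S \<circ> G n = 1 - B ^^ n\<close>. As
  \<open>R x\<close> and \<open>S (S x)\<close> have equal norms, convergence of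
  \<open>R \<circ> G n\<close> reduces to that of \<open>S \<circ> S \<circ> G n\<close>, whose
  distance from \<open>S\<close> decays.\<close>

lemma root_factorization:
  assumes pS: "adj_pair H H S S" and pR: "adj_pair H K R R'"
    and RR: "\<And>x. x \<in> hcar H \<Longrightarrow> R' (R x) = S (S (S (S x)))"
  obtains V V' where "adj_pair H K V V'" "\<And>x. x \<in> hcar H \<Longrightarrow> V (S x) = R x"
    "\<And>x. x \<in> hcar H \<Longrightarrow> V' (V x) = S (S x)"
    "\<And>y. y \<in> hcar K \<Longrightarrow> V' y \<in> htopology H closure_of (S ` hcar H)"
    "\<And>x. x \<in> hcar H \<Longrightarrow> V x \<in> htopology K closure_of (R ` hcar H)"
proof -
  interpret H: hilbert_module H using pS by (rule adj_pair_hilbert_module)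
  interpret K: hilbert_module K using pR by (simp add: adj_pair_def)
  interpret S: adj_pair H H S S by fact
  interpret R: adj_pair H K R R' by fact
  obtain e B d where e: "0 < e" and B: "adj_pair H H B B"
    and SS: "\<And>x. x \<in> hcar H \<Longrightarrow> hscale H (complex_of_real e) (S (S x)) = x - B x"
    and SB: "\<And>x. x \<in> hcar H \<Longrightarrow> S (B x) = B (S x)"
    and d: "\<And>n. 0 \<le> d n" "decseq d" "d \<longlonglongrightarrow> 0"
    and decay: "\<And>n x. x \<in> hcar H \<Longrightarrow> hnorm H (S ((B ^^ n) x)) \<le> d n * hnorm H x"
    by (rule self_adjoint_decay[OF pS]) blast
  have Bpow: "(B ^^ n) x \<in> hcar H" if "x \<in> hcar H" for n x
    using that by (induction n) (auto simp: adj_pair.closed[OF B])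
  have SBpow: "S ((B ^^ n) x) = (B ^^ n) (S x)" if "x \<in> hcar H" for n x
    using that Bpow by (induction n) (auto simp: SB)
  define G where "G n x = (\<Sum>k<n. hscale H (complex_of_real e) (S ((B ^^ k) x)))" for n x
  define G' where "G' n x = (\<Sum>k<n. hscale H (complex_of_real e) ((B ^^ k) (S x)))" for n x
  have pSB: "adj_pair H H (\<lambda>x. S ((B ^^ k) x)) (\<lambda>x. (B ^^ k) (S x))" for k
  proof (induction k)
    case 0
    then show ?case using pS by simp
  next
    case (Suc k)
    then show ?case using adj_pair_comp[OF B Suc] by (simp add: comp_def funpow_swap1)
  qed
  have pG: "adj_pair H H (G n) (G' n)" for n
  proof (induction n)
    case 0
    then show ?case using adj_pair_zero[OF H.hilbert_module_axioms H.hilbert_module_axioms]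
      by (simp add: G_def[abs_def] G'_def[abs_def])
  next
    case (Suc n)
    have "G (Suc n) = (\<lambda>x. G n x + hscale H (complex_of_real e) (S ((B ^^ n) x)))"
      "G' (Suc n) = (\<lambda>x. G' n x + hscale H (complex_of_real e) ((B ^^ n) (S x)))"
      by (auto simp: G_def G'_def)
    then show ?case using adj_pair_add[OF Suc adj_pair_scale[OF pSB]] by simp
  qed
  have Gcl: "G n x \<in> hcar H" if "x \<in> hcar H" for n x using that adj_pair.closed[OF pG] by blast
  have SG: "S (G n x) = x - (B ^^ n) x" if x: "x \<in> hcar H" for n x
  proof (induction n)
    case 0
    then show ?case by (simp add: G_def S.zero)
  next
    case (Suc n)
    have "G (Suc n) x = G n x + hscale H (complex_of_real e) (S ((B ^^ n) x))" by (simp add: G_def)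
    then have "S (G (Suc n) x) = S (G n x) + hscale H (complex_of_real e) (S (S ((B ^^ n) x)))"
      using Gcl[OF x] Bpow[OF x] by (simp add: S.add S.scale S.closed H.scale_closed)
    then show ?case using Suc SS[OF Bpow[OF x]] by simp
  qed
  have ipR: "hip K (R x) (R y) = hip H (S (S x)) (S (S y))" if "x \<in> hcar H" "y \<in> hcar H" for x y
    using that by (simp add: R.ip R.closed RR S.closed S.ip)
  have nR: "hnorm K (R x) = hnorm H (S (S x))" if "x \<in> hcar H" for x
    using ipR[OF that that] by (simp add: hnorm_def)
  have SSG: "S (S (G n x)) = S x - S ((B ^^ n) x)" if "x \<in> hcar H" for n x
    using that Bpow by (simp add: SG S.diff)
  define V where "V n = R \<circ> G n" for n
  define W where "W n = G' n \<circ> R'" for n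
  have pV: "adj_pair H K (V n) (W n)" for n
    unfolding V_def W_def by (rule adj_pair_comp[OF pG pR])
  have le: "hnorm K (V n x - V m x) \<le> 2 * d m * hnorm H x" if "m \<le> n" and x: "x \<in> hcar H" for m n x
  proof -
    have "hnorm K (V n x - V m x) = hnorm H (S (S (G n x)) - S (S (G m x)))"
      using x Gcl by (simp add: V_def nR H.diff_closed S.closed flip: R.diff S.diff)
    also have "\<dots> = hnorm H (S ((B ^^ m) x) - S ((B ^^ n) x))" using x by (simp add: SSG)
    also have "\<dots> \<le> hnorm H (S ((B ^^ m) x)) + hnorm H (S ((B ^^ n) x))"
      by (intro H.hnorm_triangle_diff S.closed Bpow x)
    also have "\<dots> \<le> d m * hnorm H x + d n * hnorm H x" by (intro add_mono decay x)
    also have "d n * hnorm H x \<le> d m * hnorm H x"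
      using decseqD[OF d(2) that(1)] by (intro mult_right_mono) auto
    finally show ?thesis by simp
  qed
  have d2: "(\<lambda>n. 2 * d n) \<longlonglongrightarrow> 0" "\<And>n. 0 \<le> 2 * d n"
    using d tendsto_mult_right_zero[OF d(3)] by auto
  obtain L L' where L: "adj_pair H K L L'"
    and lim: "\<And>x. x \<in> hcar H \<Longrightarrow> hlim K (\<lambda>n. V n x) (L x)"
    and lim': "\<And>y. y \<in> hcar K \<Longrightarrow> hlim H (\<lambda>n. W n y) (L' y)"
    by (rule adj_pair_limit[OF H.hilbert_module_axioms K.hilbert_module_axioms pV d2 le]) iprover+
  interpret L: adj_pair H K L L' by (rule L)
  show ?thesis
  proof (rule that[OF L])
    fix x assume x: "x \<in> hcar H"
    have "hlim K (\<lambda>n. V n (S x)) (R x)"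
    proof (rule K.hlimI_bound)
      fix n
      have "hnorm K (V n (S x) - R x) = hnorm H (S (S (G n (S x))) - S (S x))"
        using x Gcl by (simp add: V_def nR H.diff_closed S.closed flip: R.diff S.diff)
      also have "\<dots> = hnorm H (S ((B ^^ n) (S x)))"
        using x Bpow by (simp add: SSG S.closed H.hnorm_minus)
      finally show "hnorm K (V n (S x) - R x) \<le> d n * hnorm H (S x)"
        using decay[OF S.closed[OF x]] by simp
      show "(\<lambda>n. d n * hnorm H (S x)) \<longlonglongrightarrow> 0" by (intro tendsto_mult_left_zero d)
    qed (use x S.closed R.closed adj_pair.closed[OF pV] in auto)
    then show "L (S x) = R x" using lim[OF S.closed[OF x]] K.hlim_unique by blast
    have SSGlim: "hlim H (\<lambda>n. S (S (G n z))) (S z)" if z: "z \<in> hcar H" for z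
    proof (rule H.hlimI_bound)
      show "hnorm H (S (S (G n z)) - S z) \<le> d n * hnorm H z" for n
        using z Bpow decay[OF z] by (simp add: SSG S.closed H.hnorm_minus)
      show "(\<lambda>n. d n * hnorm H z) \<longlonglongrightarrow> 0" by (intro tendsto_mult_left_zero d)
    qed (use z Gcl S.closed in auto)
    \<comment> \<open>Inner products of values of \<open>R\<close> are those of values of
      \<open>S \<circ> S\<close>, so in the limit \<open>L\<close> has the inner products of
      \<open>S\<close>.\<close>
    show "L' (L x) = S (S x)"
    proof (rule H.ip_eq_imp_eq)
      fix z assume z: "z \<in> hcar H"
      have "(\<lambda>n. hip K (V n z) (V n x)) \<longlonglongrightarrow> hip K (L z) (L x)"
        by (intro K.hlim_ip lim x z)
      moreover have "(\<lambda>n. hip H (S (S (G n z))) (S (S (G n x)))) \<longlonglongrightarrow> hip H (S z) (S x)"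
        by (intro H.hlim_ip SSGlim x z)
      moreover have "hip K (V n z) (V n x) = hip H (S (S (G n z))) (S (S (G n x)))" for n
        using x z Gcl by (simp add: V_def ipR)
      ultimately have "hip K (L z) (L x) = hip H (S z) (S x)" using LIMSEQ_unique by auto
      then show "hip H z (L' (L x)) = hip H z (S (S x))"
        using x z by (simp add: L.ip L.closed S.ip S.closed)
    qed (use x L.closed L.closed_adj S.closed in auto)
    show "L x \<in> htopology K closure_of (R ` hcar H)"
      by (rule K.hlim_in_closure[OF lim[OF x]]) (use x Gcl R.closed in \<open>auto simp: V_def\<close>)
  next
    fix y assume y: "y \<in> hcar K"
    have z: "R' y \<in> hcar H" using y by (rule R.closed_adj)
    \<comment> \<open>Moving \<open>S\<close> in front of the sum shows that every approximant of
      \<open>L' y\<close> lies in the range of \<open>S\<close>.\<close>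
    have "W n y = S (\<Sum>k<n. hscale H (complex_of_real e) ((B ^^ k) (R' y)))
        \<and> (\<Sum>k<n. hscale H (complex_of_real e) ((B ^^ k) (R' y))) \<in> hcar H" for n
    proof (induction n)
      case 0
      then show ?case by (simp add: W_def G'_def S.zero H.zero_closed)
    next
      case (Suc n)
      then show ?case
        using Bpow[OF z] by (simp add: W_def G'_def S.add H.add_closed H.scale_closed S.scale SBpow z)
    qed
    then show "L' y \<in> htopology H closure_of (S ` hcar H)"
      by (intro H.hlim_in_closure[OF lim'[OF y]]) (use S.closed in auto)
  qed
qed

section \<open>Reduced solutions and blocks\<close>

text \<open>The difference of two solutions is killed by \<open>A\<close>, hence orthogonal to the
  closure of the range of \<open>A'\<close>, where both solutions take their values. This gives
  meaning to the definite descriptions in \<open>V_op\<close> and \<open>shorted\<close>.\<close>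

lemma reduced_solution_unique:
  assumes A: "adj_pair H K A A'" and E: "hilbert_module E"
    and D: "reduced_solution H K E A C D" "reduced_solution H K E A C D'"
  shows "D = D'"
proof -
  interpret A: adj_pair H K A A' by fact
  have p: "adj_pair E H D (adj E H D)" and q: "adj_pair E H D' (adj E H D')"
    using D adjointable_imp_adj_pair[OF E A.H.hilbert_module_axioms]
    by (auto simp: reduced_solution_def)
  have sub: "A' ` hcar K \<subseteq> hcar H" using A.closed_adj by auto
  show ?thesis
  proof (rule maps_eqI[OF adj_pair.maps[OF p] adj_pair.maps[OF q]])
    fix x assume x: "x \<in> hcar E"
    note cl = adj_pair.closed[OF p x] adj_pair.closed[OF q x]
    define u where "u = D x - D' x"
    have u: "u \<in> hcar H" using cl by (simp add: u_def A.H.diff_closed)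
    have "A (D x) = A (D' x)" using D by (metis comp_apply reduced_solution_def)
    then have Au: "A u = 0" using cl by (simp add: u_def A.diff)
    have orth: "hip H u v = 0" if v: "v \<in> htopology H closure_of (A' ` hcar K)" for v
    proof -
      obtain s where s: "hlim H s v" "\<And>n. s n \<in> A' ` hcar K" using A.H.in_closureE[OF v sub] by blast
      have "hip H u (s n) = 0" for n
        using s(2)[of n] u Au by (auto simp: A.ip[symmetric])
      then have "(\<lambda>n. hip H u (s n)) = (\<lambda>n. 0)" by simp
      then show ?thesis
        using A.H.hlim_ip[OF A.H.hlim_const[OF u] s(1)] by (simp add: LIMSEQ_const_iff)
    qed
    have "hip H u (D x) = 0" "hip H u (D' x) = 0"
      using D x by (intro orth; auto simp: reduced_solution_def A.adj_eq)+
    then have "hip H u u = 0" using A.H.ip_diff_right[OF u cl] by (simp add: u_def)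
    then show "D x = D' x" using A.H.ip_definite[OF u] by (simp add: u_def)
  qed
qed

text \<open>\<open>V\<close> comes from \<open>op_abs H K R\<close>, but \<open>V_op\<close> is
  defined through \<open>op_abs K H R'\<close>. The positive operator \<open>V \<circ> V'\<close>
  squares to \<open>R \<circ> R'\<close>, so it is the latter absolute value. Hence \<open>V\<close>
  intertwines the two absolute values and, by \<open>op_sqrt_intertwine\<close>, their roots; so
  \<open>S' \<circ> V = V \<circ> S = R\<close>.\<close>

lemma V_op_factorization:
  assumes p: "adj_pair H K R R'"
  defines "S \<equiv> op_sqrt H (op_abs H K R)" and "S' \<equiv> op_sqrt K (op_abs K H R')"
  obtains V V' where "adj_pair H H S S" "adj_pair K K S' S'" "adj_pair H K V V'" "V_op H K R = V"
    "\<forall>x\<in>hcar H. V (S x) = R x" "\<forall>x\<in>hcar H. S' (V x) = R x"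
    "\<forall>x\<in>hcar H. V' (V x) = S (S x)" "\<forall>y\<in>hcar K. V (V' y) = S' (S' y)"
    "\<forall>y\<in>hcar K. V' y \<in> htopology H closure_of (S ` hcar H)"
    "\<forall>x\<in>hcar H. V x \<in> htopology K closure_of (S' ` hcar K)"
proof -
  interpret p: adj_pair H K R R' by fact
  note hH = p.H.hilbert_module_axioms and hK = p.K.hilbert_module_axioms
  have pos: "op_pos H (R' \<circ> R)" "op_pos K (R \<circ> R')" by (rule op_posI[OF p] op_posI[OF p.swap])+
  have abs: "op_abs H K R = op_sqrt H (R' \<circ> R)" "op_abs K H R' = op_sqrt K (R \<circ> R')"
    unfolding op_abs_def p.adj_eq adj_pair.adj_eq[OF p.swap] by (rule refl)+
  have abs_pos: "op_pos H (op_abs H K R)" "op_pos K (op_abs K H R')"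
    and abs_sq: "op_abs H K R \<circ> op_abs H K R = R' \<circ> R" "op_abs K H R' \<circ> op_abs K H R' = R \<circ> R'"
    unfolding abs by (rule op_sqrt[OF hH pos(1)] op_sqrt[OF hK pos(2)])+
  have S_pos: "op_pos H S" "op_pos K S'" and SS: "S \<circ> S = op_abs H K R" "S' \<circ> S' = op_abs K H R'"
    unfolding S_def S'_def by (rule op_sqrt[OF hH abs_pos(1)] op_sqrt[OF hK abs_pos(2)])+
  have pS: "adj_pair H H S S" and pS': "adj_pair K K S' S'"
    using op_pos_self_adjoint[OF hH S_pos(1)] op_pos_self_adjoint[OF hK S_pos(2)] .
  have RR: "R' (R x) = S (S (S (S x)))" for x
    using abs_sq(1) SS(1) by (metis comp_apply)
  obtain V V' where V: "adj_pair H K V V'" and VS: "\<And>x. x \<in> hcar H \<Longrightarrow> V (S x) = R x"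
    and VV: "\<And>x. x \<in> hcar H \<Longrightarrow> V' (V x) = S (S x)"
    and cl': "\<And>y. y \<in> hcar K \<Longrightarrow> V' y \<in> htopology H closure_of (S ` hcar H)"
    and cl: "\<And>x. x \<in> hcar H \<Longrightarrow> V x \<in> htopology K closure_of (R ` hcar H)"
    by (rule root_factorization[OF pS p RR]) iprover+
  interpret V: adj_pair H K V V' by (rule V)
  interpret S: adj_pair H H S S by (rule pS)
  interpret S': adj_pair K K S' S' by (rule pS')
  have SV: "S (V' y) = R' y" if y: "y \<in> hcar K" for y
  proof (rule p.H.ip_eq_imp_eq)
    fix z assume z: "z \<in> hcar H"
    have "hip H z (S (V' y)) = hip K (V (S z)) y"
      using y z by (simp add: S.ip[symmetric] V.ip S.closed V.closed_adj)
    then show "hip H z (S (V' y)) = hip H z (R' y)" using y z by (simp add: VS p.ip)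
  qed (use y S.closed V.closed_adj p.closed_adj in auto)
  have "(V \<circ> V') \<circ> (V \<circ> V') = R \<circ> R'"
  proof (rule maps_eqI)
    show "(V \<circ> V') \<circ> (V \<circ> V') \<in> maps K K" "R \<circ> R' \<in> maps K K"
      using adj_pair.maps adj_pair_comp[OF adj_pair_comp[OF V.swap V] adj_pair_comp[OF V.swap V]]
        adj_pair_comp[OF p.swap p] by blast+
    show "((V \<circ> V') \<circ> (V \<circ> V')) y = (R \<circ> R') y" if y: "y \<in> hcar K" for y
      using y by (simp add: VV VS V.closed_adj p.closed_adj SV)
  qed
  then have "op_abs K H R' = V \<circ> V'"
    unfolding abs(2) by (rule op_sqrt_eqI[OF hK pos(2) op_posI[OF V.swap]])
  then have VV': "V (V' y) = S' (S' y)" for y using SS(2) by (metis comp_apply)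
  have "V (op_abs H K R x) = op_abs K H R' (V x)" if "x \<in> hcar H" for x
    using VV[OF that] VV'[of "V x"] SS by (metis comp_apply)
  then have "V (S x) = S' (V x)" if "x \<in> hcar H" for x
    unfolding S_def S'_def using op_sqrt_intertwine[OF hH hK abs_pos V _ that] by blast
  then have S'V: "S' (V x) = R x" if "x \<in> hcar H" for x using VS that by simp
  have "R ` hcar H \<subseteq> S' ` hcar K" using S'V[symmetric] V.closed by auto
  then have clV: "V x \<in> htopology K closure_of (S' ` hcar K)" if "x \<in> hcar H" for x
    using cl[OF that] closure_of_mono by blast
  have "reduced_solution K K H S' R V"
    unfolding reduced_solution_def S'.adj_eq
  proof (intro conjI)
    show "S' \<circ> V = R"
      by (rule maps_eqI[OF adj_pair.maps[OF adj_pair_comp[OF V pS']] p.maps]) (simp add: S'V)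
  qed (use V.adjointable clV in auto)
  then have Vop: "V_op H K R = V"
    unfolding V_op_def p.adj_eq S'_def[symmetric]
    by (intro the_equality) (auto intro: reduced_solution_unique[OF pS' hH])
  show ?thesis by (rule that[OF pS pS' V Vop]) (simp_all add: VS S'V VV VV' cl' clV)
qed

section \<open>Projections as operators onto submodules\<close>

context hilbert_module
begin

lemma orth_complemented_proj:
  assumes "orth_complemented H M" "x \<in> hcar H"
  shows "proj H M x \<in> M" "x - proj H M x \<in> orth H M"
proof -
  have MH: "M \<subseteq> hcar H" and sub: "closed_submodule H M"
    using assms by (auto simp: orth_complemented_def closed_submodule_def)
  obtain y z where yz: "y \<in> M" "z \<in> orth H M" "x = y + z"
    using assms by (auto simp: orth_complemented_def)
  have "y' = y" if y': "y' \<in> M" "x - y' \<in> orth H M" for y'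
  proof -
    have M: "y - y' \<in> M"
      using yz y' MH sub hscale_minus_one unfolding closed_submodule_def
      by (metis add_uminus_conv_diff subsetD)
    have c: "y \<in> hcar H" "y' \<in> hcar H" "z \<in> hcar H" "x - y' \<in> hcar H" "y - y' \<in> hcar H"
      using yz y' MH M by (auto simp: orth_def)
    have "hip H (y - y') (y - y') = hip H (y - y') ((x - y') - z)" by (simp add: yz)
    also have "\<dots> = 0"
      unfolding ip_diff_right[OF c(5,4,3)] using M yz(2) y'(2) by (simp add: orth_def)
    finally show "y' = y" using ip_definite[OF c(5)] by simp
  qed
  then have "(THE y. y \<in> M \<and> x - y \<in> orth H M) = y"
    using yz by (intro the_equality) auto
  then show "proj H M x \<in> M" "x - proj H M x \<in> orth H M"
    using yz assms(2) by (simp_all add: proj_def restr_def)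
qed

text \<open>Regarded as an operator onto the module \<open>sub H M\<close>, the projection has the
  inclusion of \<open>M\<close> as its adjoint.\<close>

lemma adj_pair_proj:
  assumes "orth_complemented H M"
  shows "adj_pair H (sub H M) (proj H M) (restr M id)"
proof (intro adj_pair.intro hilbert_module_axioms adj_pair_axioms.intro)
  have MH: "M \<subseteq> hcar H" and M: "closed_submodule H M"
    using assms by (auto simp: orth_complemented_def closed_submodule_def)
  show "hilbert_module (sub H M)" by (rule hilbert_module_sub[OF M])
  show "proj H M \<in> maps H (sub H M)"
    using orth_complemented_proj[OF assms] by (auto simp: maps_def) (simp add: proj_def restr_def)
  show "restr M id \<in> maps (sub H M) H" using MH by (auto simp: maps_def restr_def)
  fix x y assume x: "x \<in> hcar H" and y: "y \<in> hcar (sub H M)"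
  have yM: "y \<in> M" using y by simp
  note P = orth_complemented_proj[OF assms x]
  have c: "proj H M x \<in> hcar H" "y \<in> hcar H" "x - proj H M x \<in> hcar H"
    using P yM MH by (auto simp: orth_def)
  have "hip H y (x - proj H M x) = 0" using P yM by (auto simp: orth_def)
  then have "hip H (x - proj H M x) y = 0" using ip_star[OF c(2,3)] by simp
  then show "hip (sub H M) (proj H M x) y = hip H x (restr M id y)"
    using c x yM by (simp add: ip_diff_left restr_def)
qed

lemma adj_pair_proj_orth:
  assumes "orth_complemented H M"
  shows "adj_pair H (sub H (orth H M)) (idop H - proj H M) (restr (orth H M) id)"
proof (intro adj_pair.intro hilbert_module_axioms adj_pair_axioms.intro)
  have MH: "M \<subseteq> hcar H" using assms by (auto simp: orth_complemented_def closed_submodule_def)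
  show "hilbert_module (sub H (orth H M))" by (rule hilbert_module_sub[OF closed_submodule_orth[OF MH]])
  show "(idop H - proj H M) \<in> maps H (sub H (orth H M))"
    using orth_complemented_proj[OF assms] by (auto simp: maps_def) (simp add: proj_def restr_def idop_def)
  show "restr (orth H M) id \<in> maps (sub H (orth H M)) H" by (auto simp: maps_def restr_def orth_def)
  fix x y assume x: "x \<in> hcar H" and y: "y \<in> hcar (sub H (orth H M))"
  then have "y \<in> orth H M" by simp
  moreover note P = orth_complemented_proj[OF assms x]
  moreover have "proj H M x \<in> hcar H" using P MH by auto
  ultimately show "hip (sub H (orth H M)) ((idop H - proj H M) x) y = hip H x (restr (orth H M) id y)"
    using x by (simp add: ip_diff_left restr_def orth_def)
qed

lemma proj_eq_self:
  assumes "orth_complemented H M" "x \<in> M"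
  shows "proj H M x = x"
proof -
  interpret p: adj_pair H "sub H M" "proj H M" "restr M id" by (rule adj_pair_proj[OF assms(1)])
  have x: "x \<in> hcar H" using assms by (auto simp: orth_complemented_def closed_submodule_def)
  show ?thesis
    using p.K.ip_eq_imp_eq[of "proj H M x" x] p.ip'[OF x] p.closed[OF x] assms(2)
    by (simp add: restr_def)
qed

lemma proj_orth_eq_self:
  assumes "orth_complemented H M" "x \<in> orth H M"
  shows "(idop H - proj H M) x = x"
proof -
  interpret p: adj_pair H "sub H (orth H M)" "idop H - proj H M" "restr (orth H M) id"
    by (rule adj_pair_proj_orth[OF assms(1)])
  have x: "x \<in> hcar H" using assms by (auto simp: orth_def)
  show ?thesis
    using p.K.ip_eq_imp_eq[of "(idop H - proj H M) x" x] p.ip'[OF x] p.closed[OF x] assms(2)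
    by (simp add: restr_def del: fun_diff_def minus_apply)
qed

end

text \<open>Turns the blocks of \<open>T\<close> into compositions with inclusions, so that
  \<open>adj_pair_comp\<close> provides their adjoints.\<close>

lemma restr_eq_comp_inclusion:
  assumes "\<And>x. x \<in> M \<Longrightarrow> P x = x" "f 0 = 0"
  shows "restr M (f \<circ> P) = f \<circ> restr M id"
  using assms by (auto simp: restr_def fun_eq_iff)

theorem proposition5p3:
  fixes H :: "('a::cstar_algebra, 'h::ab_group_add) hmod"
    and K :: "('a, 'k::ab_group_add) hmod"
    and M :: "'h set" and N :: "'k set" and T :: "'h \<Rightarrow> 'k"
  assumes "hilbert_module H" and "hilbert_module K"
    and "orth_complemented H M" and "orth_complemented K N"
    and "T \<in> adjointable H K"
    and "complementable H K M N T"
  shows "weakly_complementable H K M N T \<and>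
    (\<forall>E F. is_E H K M N T E \<and> is_F H K M N T F \<longrightarrow>
       shorted H K M N T =
         from_corner H K M N (T11 H K M N T - (adj (sub K N) (sub H (orth H M)) F \<circ> E)))"
proof -
  interpret H: hilbert_module H by fact
  interpret K: hilbert_module K by fact
  define Hp Kp HM KN where "Hp = sub H (orth H M)" and "Kp = sub K (orth K N)"
    and "HM = sub H M" and "KN = sub K N"
  define P P' Q Q' where "P = proj H M" and "P' = idop H - proj H M"
    and "Q = proj K N" and "Q' = idop K - proj K N"
  define i i' j j' where "i = restr M (id :: 'h \<Rightarrow> 'h)" and "i' = restr (orth H M) (id :: 'h \<Rightarrow> 'h)"
    and "j = restr N (id :: 'k \<Rightarrow> 'k)" and "j' = restr (orth K N) (id :: 'k \<Rightarrow> 'k)"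
  have pP: "adj_pair H HM P i" and pP': "adj_pair H Hp P' i'"
    and pQ: "adj_pair K KN Q j" and pQ': "adj_pair K Kp Q' j'"
    using H.adj_pair_proj H.adj_pair_proj_orth K.adj_pair_proj K.adj_pair_proj_orth assms(3,4)
    by (simp_all add: Hp_def Kp_def HM_def KN_def P_def P'_def Q_def Q'_def i_def i'_def j_def j'_def)
  note pi = adj_pair.swap[OF pP] and pi' = adj_pair.swap[OF pP'] and pj' = adj_pair.swap[OF pQ']
  have T: "adj_pair H K T (adj H K T)" by (rule adjointable_imp_adj_pair[OF assms(1,2,5)])
  obtain Mr Ml where Mr: "Mr \<in> adjointable H H" and Ml: "Ml \<in> adjointable K K"
    and P'Mr: "P' \<circ> Mr = Mr" and MlQ': "Ml \<circ> Q' = Ml"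
    and TMr: "Q' \<circ> T \<circ> Mr = Q' \<circ> T" and MlT: "Ml \<circ> T \<circ> P' = T \<circ> P'"
    using assms(6) unfolding complementable_def P'_def Q'_def by blast
  note pMr = adjointable_imp_adj_pair[OF assms(1,1) Mr] and pMl = adjointable_imp_adj_pair[OF assms(2,2) Ml]
  have z: "T 0 = 0" "Q 0 = 0" "Q' 0 = 0"
    by (rule adj_pair.zero[OF T] adj_pair.zero[OF pQ] adj_pair.zero[OF pQ'])+
  have Pi: "x \<in> M \<Longrightarrow> P x = x" and Pi': "x \<in> orth H M \<Longrightarrow> P' x = x" for x
    using H.proj_eq_self[OF assms(3)] H.proj_orth_eq_self[OF assms(3)] unfolding P_def P'_def by blast+
  have Qj': "y \<in> orth K N \<Longrightarrow> Q' y = y" for y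
    using K.proj_orth_eq_self[OF assms(4)] unfolding Q'_def by blast
  have T12: "T12 H K M N T = Q \<circ> T \<circ> i'" and T21: "T21 H K M N T = Q' \<circ> T \<circ> i"
    and T22: "T22 H K M N T = Q' \<circ> T \<circ> i'"
    unfolding T12_def T21_def T22_def P'_def[symmetric] Q'_def[symmetric]
    unfolding P_def[symmetric] Q_def[symmetric] i_def i'_def
    by (rule restr_eq_comp_inclusion; simp add: Pi Pi' z; fail)+
  define R where "R = T22 H K M N T"
  define R' where "R' = adj Hp Kp R"
  have "R \<in> adjointable Hp Kp"
    unfolding R_def T22 by (rule adj_pair.adjointable[OF adj_pair_comp[OF pi' adj_pair_comp[OF T pQ']], unfolded comp_assoc[symmetric]])
  then have R: "adj_pair Hp Kp R R'"
    unfolding R'_def using adjointable_imp_adj_pair pP' pQ' unfolding adj_pair_def by blast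
  interpret R: adj_pair Hp Kp R R' by (rule R)
  interpret HM: hilbert_module HM using pP by (simp add: adj_pair_def)
  interpret KN: hilbert_module KN using pQ by (simp add: adj_pair_def)
  \<comment> \<open>\<open>Mr\<close> and \<open>Ml\<close> compressed to the submodules. Nothing is
    lost on the side of the complements: \<open>Mr\<close> takes its values in that of
    \<open>M\<close>, and \<open>Ml\<close> factors through the projection onto that of
    \<open>N\<close>.\<close>
  define X where "X = P' \<circ> (Mr \<circ> i)"
  obtain X' where X: "adj_pair HM Hp X X'"
    unfolding X_def using adj_pair_comp[OF adj_pair_comp[OF pi pMr] pP'] by blast
  define Y where "Y = Q \<circ> (Ml \<circ> j')"
  obtain W where Y: "adj_pair Kp KN Y W"
    unfolding Y_def using adj_pair_comp[OF adj_pair_comp[OF pj' pMl] pQ] by blast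
  interpret X: adj_pair HM Hp X X' by (rule X)
  interpret W: adj_pair KN Kp W Y by (rule adj_pair.swap[OF Y])
  have RX: "T21 H K M N T = R \<circ> X"
  proof
    fix x
    \<comment> \<open>Here \<open>P' \<circ> Mr = Mr\<close> enters: projecting onto the complement
      and including it again leaves the values of \<open>Mr\<close> unchanged.\<close>
    have "i' (X x) = Mr (i x)"
    proof (cases "x \<in> M")
      case True
      then have "X x \<in> orth H M" using X.closed[of x] by (simp add: HM_def Hp_def)
      then have "i' (X x) = X x" by (simp add: i'_def restr_def)
      then show ?thesis using P'Mr by (simp add: X_def fun_eq_iff)
    next
      case False
      then show ?thesis
        using adj_pair.zero[OF pMr] adj_pair.zero[OF pP'] adj_pair.zero[OF pi']
        by (simp add: X_def i_def restr_def)
    qed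
    then show "T21 H K M N T x = (R \<circ> X) x"
      unfolding T21 R_def T22 using TMr by (simp add: fun_eq_iff)
  qed
  have YR: "T12 H K M N T = Y \<circ> R"
  proof
    fix x
    show "T12 H K M N T x = (Y \<circ> R) x"
    proof (cases "x \<in> orth H M")
      case True
      then have "R x \<in> orth K N" using R.closed[of x] by (simp add: Hp_def Kp_def)
      then have "(Y \<circ> R) x = Q (Ml (Q' (T x)))"
        using True by (simp add: Y_def j'_def restr_def R_def T22 i'_def)
      also have "\<dots> = Q (Ml (T (P' x)))" using MlQ' Pi'[OF True] by (simp add: fun_eq_iff)
      also have "\<dots> = Q (T x)" using MlT Pi'[OF True] by (metis comp_apply)
      finally show ?thesis using True by (simp add: T12 i'_def restr_def)
    next
      case False
      then have "R x = 0" using R.outside by (simp add: Hp_def)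
      moreover have "T12 H K M N T x = 0" using False by (simp add: T12_def restr_def)
      ultimately show ?thesis using adj_pair.zero[OF Y] by simp
    qed
  qed
  have T12adj: "adj Hp KN (T12 H K M N T) = R' \<circ> W"
    unfolding YR by (rule adj_pair.adj_eq[OF adj_pair_comp[OF R Y]])
  define S S' where "S = op_sqrt Hp (op_abs Hp Kp R)" and "S' = op_sqrt Kp (op_abs Kp Hp R')"
  obtain V V' where pS: "adj_pair Hp Hp S S" and pS': "adj_pair Kp Kp S' S'" and pV: "adj_pair Hp Kp V V'"
    and Vop: "V_op Hp Kp R = V"
    and rel: "\<forall>x\<in>hcar Hp. V (S x) = R x" "\<forall>x\<in>hcar Hp. S' (V x) = R x"
      "\<forall>x\<in>hcar Hp. V' (V x) = S (S x)" "\<forall>y\<in>hcar Kp. V (V' y) = S' (S' y)"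
      "\<forall>y\<in>hcar Kp. V' y \<in> htopology Hp closure_of (S ` hcar Hp)"
      "\<forall>x\<in>hcar Hp. V x \<in> htopology Kp closure_of (S' ` hcar Kp)"
    by (rule V_op_factorization[OF R, folded S_def S'_def]) blast
  note VS = rel(1)[rule_format] and S'V = rel(2)[rule_format] and VV = rel(3)[rule_format]
    and VV' = rel(4)[rule_format] and clV' = rel(5)[rule_format] and clV = rel(6)[rule_format]
  interpret S: adj_pair Hp Hp S S by (rule pS)
  interpret S': adj_pair Kp Kp S' S' by (rule pS')
  interpret V: adj_pair Hp Kp V V' by (rule pV)
  have VSeq: "V \<circ> S = R" and S'Veq: "S' \<circ> V = R"
    using maps_eqI[OF adj_pair.maps[OF adj_pair_comp[OF pS pV]] R.maps]
      maps_eqI[OF adj_pair.maps[OF adj_pair_comp[OF pV pS']] R.maps] VS S'V by simp_all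
  have SV'eq: "S \<circ> V' = R'" and V'S'eq: "V' \<circ> S' = R'"
    using adj_pair.adj_eq[OF adj_pair_comp[OF pS pV]] adj_pair.adj_eq[OF adj_pair_comp[OF pV pS']]
      R.adj_eq VSeq S'Veq by simp_all
  \<comment> \<open>Reducedness of \<open>S \<circ> X\<close>: the range of the square of
    \<open>S\<close> lies in that of \<open>V'\<close>, and it is dense in the range of
    \<open>S\<close>.\<close>
  have clS: "S x \<in> htopology Hp closure_of (V' ` hcar Kp)" if "x \<in> hcar Hp" for x
  proof -
    have "(\<lambda>z. S (S z)) ` hcar Hp \<subseteq> V' ` hcar Kp" using VV[symmetric] V.closed by auto
    then show ?thesis using range_in_closure_range_square[OF pS that] closure_of_mono by blast
  qed
  have clS': "S' y \<in> htopology Kp closure_of (V ` hcar Hp)" if "y \<in> hcar Kp" for y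
  proof -
    have "(\<lambda>z. S' (S' z)) ` hcar Kp \<subseteq> V ` hcar Hp" using VV'[symmetric] V.closed_adj by auto
    then show ?thesis using range_in_closure_range_square[OF pS' that] closure_of_mono by blast
  qed
  have E_iff: "is_E H K M N T E \<longleftrightarrow> reduced_solution Hp Kp HM V (R \<circ> X) E" for E
    unfolding is_E_def Let_def Hp_def[symmetric] Kp_def[symmetric] HM_def[symmetric] RX
      R_def[symmetric] Vop ..
  have F_iff: "is_F H K M N T F \<longleftrightarrow> reduced_solution Hp Hp KN S (R' \<circ> W) F" for F
    unfolding is_F_def Let_def Hp_def[symmetric] Kp_def[symmetric] KN_def[symmetric] T12adj
      R_def[symmetric] S_def ..
  have Et_iff: "is_E_tilde H K M N T E \<longleftrightarrow> reduced_solution Kp Kp HM S' (R \<circ> X) E" for E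
    unfolding is_E_tilde_def Let_def Hp_def[symmetric] Kp_def[symmetric] HM_def[symmetric] RX
      R_def[symmetric] R'_def[symmetric] S'_def ..
  have Ft_iff: "is_F_tilde H K M N T F \<longleftrightarrow> reduced_solution Kp Hp KN V' (R' \<circ> W) F" for F
    unfolding is_F_tilde_def Let_def Hp_def[symmetric] Kp_def[symmetric] KN_def[symmetric] T12adj
      R_def[symmetric] Vop V.adj_eq ..
  have pE: "adj_pair HM Hp (S \<circ> X) (X' \<circ> S)" and pF: "adj_pair KN Hp (V' \<circ> W) (Y \<circ> V)"
    and pEt: "adj_pair HM Kp (V \<circ> X) (X' \<circ> V')" and pFt: "adj_pair KN Kp (S' \<circ> W) (Y \<circ> S')"
    by (rule adj_pair_comp[OF X pS] adj_pair_comp[OF adj_pair.swap[OF Y] adj_pair.swap[OF pV]]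
        adj_pair_comp[OF X pV] adj_pair_comp[OF adj_pair.swap[OF Y] pS'])+
  have E: "is_E H K M N T (S \<circ> X)"
    unfolding E_iff reduced_solution_def V.adj_eq
    using adj_pair.adjointable[OF pE] clS X.closed by (auto simp: VSeq simp flip: comp_assoc)
  have F: "is_F H K M N T (V' \<circ> W)"
    unfolding F_iff reduced_solution_def S.adj_eq
    using adj_pair.adjointable[OF pF] clV' W.closed by (auto simp: SV'eq simp flip: comp_assoc)
  have Et: "is_E_tilde H K M N T (V \<circ> X)"
    unfolding Et_iff reduced_solution_def S'.adj_eq
    using adj_pair.adjointable[OF pEt] clV X.closed by (auto simp: S'Veq simp flip: comp_assoc)
  have Ft: "is_F_tilde H K M N T (S' \<circ> W)"
    unfolding Ft_iff reduced_solution_def adj_pair.adj_eq[OF V.swap]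
    using adj_pair.adjointable[OF pFt] clS' W.closed by (auto simp: V'S'eq simp flip: comp_assoc)
  have uE: "is_E H K M N T E \<Longrightarrow> E = S \<circ> X" for E
    using E unfolding E_iff by (rule reduced_solution_unique[OF pV HM.hilbert_module_axioms, rotated])
  have uF: "is_F H K M N T F \<Longrightarrow> F = V' \<circ> W" for F
    using F unfolding F_iff by (rule reduced_solution_unique[OF pS KN.hilbert_module_axioms, rotated])
  have uEt: "is_E_tilde H K M N T E \<Longrightarrow> E = V \<circ> X" for E
    using Et unfolding Et_iff by (rule reduced_solution_unique[OF pS' HM.hilbert_module_axioms, rotated])
  have uFt: "is_F_tilde H K M N T F \<Longrightarrow> F = S' \<circ> W" for F
    using Ft unfolding Ft_iff by (rule reduced_solution_unique[OF V.swap KN.hilbert_module_axioms, rotated])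
  have the: "(THE E. is_E H K M N T E) = S \<circ> X" "(THE F. is_F H K M N T F) = V' \<circ> W"
    "(THE E. is_E_tilde H K M N T E) = V \<circ> X" "(THE F. is_F_tilde H K M N T F) = S' \<circ> W"
    using E F Et Ft uE uF uEt uFt by (blast intro: the_equality)+
  have FE: "adj KN Hp (V' \<circ> W) \<circ> (S \<circ> X) = Y \<circ> R \<circ> X"
    unfolding adj_pair.adj_eq[OF pF] using VSeq by (auto simp: fun_eq_iff)
  have FEt: "adj KN Kp (S' \<circ> W) \<circ> (V \<circ> X) = Y \<circ> R \<circ> X"
    unfolding adj_pair.adj_eq[OF pFt] using S'Veq by (auto simp: fun_eq_iff)
  \<comment> \<open>Proved for every \<open>x\<close>, since it is rewritten under the abstraction
    in \<open>shorted\<close>; outside \<open>M\<close> the composite is 0.\<close>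
  have half: "hscale K (1 / 2) ((Y \<circ> R \<circ> X) x + (Y \<circ> R \<circ> X) x) = (Y \<circ> R \<circ> X) x" for x
  proof -
    have pYRX: "adj_pair HM KN (Y \<circ> R \<circ> X) (X' \<circ> (R' \<circ> W))"
      using adj_pair_comp[OF X adj_pair_comp[OF R Y]] by (simp add: comp_assoc)
    have "N \<subseteq> hcar K" using assms(4) by (auto simp: orth_complemented_def closed_submodule_def)
    then have y: "(Y \<circ> R \<circ> X) x \<in> hcar K"
      using adj_pair.closed[OF pYRX, of x] adj_pair.outside[OF pYRX, of x] K.zero_closed
      by (cases "x \<in> hcar HM") (auto simp: KN_def)
    have "hscale K (1 / 2) ((Y \<circ> R \<circ> X) x + (Y \<circ> R \<circ> X) x) = hscale K (1 / 2 + 1 / 2) ((Y \<circ> R \<circ> X) x)"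
      by (simp only: K.scale_add_right[OF y y] K.scale_add_left[OF y])
    then show ?thesis using K.scale_one[OF y] by simp
  qed
  have "shorted H K M N T = from_corner H K M N (T11 H K M N T - (Y \<circ> R \<circ> X))"
    unfolding shorted_def Let_def Hp_def[symmetric] Kp_def[symmetric] KN_def[symmetric] the FE FEt half
      fun_diff_def ..
  then have "shorted H K M N T = from_corner H K M N (T11 H K M N T - (adj KN Hp F \<circ> E))"
    if "is_E H K M N T E" "is_F H K M N T F" for E F
    using uE[OF that(1)] uF[OF that(2)] FE by simp
  moreover have "weakly_complementable H K M N T"
    unfolding weakly_complementable_def using E F Et Ft by blast
  ultimately show ?thesis unfolding KN_def Hp_def by blast
qed

end
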